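(* Let $M\in\mathbb{R}_+^{m\times n}$ and $p\ge1$, and let $\{(X^k,Y^k)\}_{k=1}^\infty$ be the sequence generated by the modified rank-one residue iteration described in the context from any starting point $(X^0,Y^0)$. Then $\{Y^k\}$ is bounded, and $(X^k,Y^k)$ converges to a critical point of the nonnegative matrix factorization problem $$\min_{X,Y}\ \|XY^\top-M\|_F^2\quad\text{s.t. }X\in\mathbb{R}_+^{m\times p},\ Y\in\mathbb{R}_+^{n\times p}.$$
   Context: $\mathbb{R}_+^{m\times p}$ is the set of entrywise nonnegative $m\times p$ matrices; $x_i,y_i$ denote the $i$-th columns of $X,Y$. Modified rank-one residue iteration: fix $L_{\min}>0$. At the beginning of the $k$-th cycle the blocks are shuffled to a permutation $\pi^k=(\pi_1^k,\dots,\pi_p^k)$ of $(1,\dots,p)$. Put $L_i^k=\max(L_{\min},\|y_i^k\|^2)$. Then for $i=1,\dots,p$ sequentially perform $$x_{\pi_i^k}^{k+1}=\arg\min_{x_{\pi_i^k}\ge0,\ \|x_{\pi_i^k}\|=1}\ \frac{L_{\pi_i^k}^k}2\|x_{\pi_i^k}-x_{\pi_i^k}^k\|^2+(y_{\pi_i^k}^k)^\top\big(X_{\pi_{<i}^k}^{k+1}(Y_{\pi_{<i}^k}^{k+1})^\top+X_{\pi_{\ge i}^k}^k(Y_{\pi_{\ge i}^k}^k)^\top-M\big)^\top x_{\pi_i^k},$$ $$y_{\pi_i^k}^{k+1}=\arg\min_{y_{\pi_i^k}\ge0}\ \frac12\|y_{\pi_i^k}\|^2+y_{\pi_i^k}^\top\big(X_{\pi_{<i}^k}^{k+1}(Y_{\pi_{<i}^k}^{k+1})^\top+X_{\pi_{>i}^k}^k(Y_{\pi_{>i}^k}^k)^\top-M\big)^\top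 x_{\pi_i^k}^{k+1},$$ where $X_{\pi_{<i}^k}$ is the submatrix formed by the columns of $X$ with indices $\pi_1^k,\dots,\pi_{i-1}^k$, $X_{\pi_{\ge i}^k}$ by those with indices $\pi_i^k,\dots,\pi_p^k$, $X_{\pi_{>i}^k}$ by those with indices $\pi_{i+1}^k,\dots,\pi_p^k$, and similarly for $Y$. If the first minimization problem has several solutions, any one of them may be taken. A critical point of the problem is a point $(X,Y)$ with $0\in\partial F(X,Y)$, where $F(X,Y)=\frac12\|XY^\top-M\|_F^2+\iota_{\mathbb{R}_+^{m\times p}}(X)+\iota_{\mathbb{R}_+^{n\times p}}(Y)$, $\iota_S$ is the indicator function of $S$ ($0$ on $S$, $+\infty$ elsewhere), and $\partial$ is the limiting Fréchet subdifferential. *)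

theory Defs
  imports "HOL-Analysis.Analysis"
begin

section \<open>Limiting Frechet subdifferential\<close>

definition frechet_subdifferential ::
    "('a::euclidean_space \<Rightarrow> ereal) \<Rightarrow> 'a \<Rightarrow> 'a set" where
  "frechet_subdifferential F x =
     {g. \<bar>F x\<bar> \<noteq> \<infinity> \<and>
         0 \<le> Liminf (at x) (\<lambda>z. (F z - F x - ereal (g \<bullet> (z - x))) / ereal (norm (z - x)))}"

definition limiting_subdifferential ::
    "('a::euclidean_space \<Rightarrow> ereal) \<Rightarrow> 'a \<Rightarrow> 'a set" where
  "limiting_subdifferential F x =
     {g. \<bar>F x\<bar> \<noteq> \<infinity> \<and>
         (\<exists>u v. u \<longlonglongrightarrow> x \<and> (\<lambda>l. F (u l)) \<longlonglongrightarrow> F x \<and>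
                (\<forall>l::nat. v l \<in> frechet_subdifferential F (u l)) \<and> v \<longlonglongrightarrow> g)}"

section \<open>Nonnegative matrix factorization\<close>

text \<open>
  An \<open>m \<times> p\<close> matrix has type \<open>real ^ 'p ^ 'm\<close>. On this type the norm is the Frobenius norm,
  and the order is entrywise, so that \<open>{0..}\<close> is the set of entrywise nonnegative matrices.
\<close>

definition set_indicator :: "'a set \<Rightarrow> 'a \<Rightarrow> ereal" where
  "set_indicator S x = (if x \<in> S then 0 else \<infinity>)"

definition nmf_objective ::
    "real ^ 'n ^ 'm \<Rightarrow> (real ^ 'p ^ 'm) \<times> (real ^ 'p ^ 'n) \<Rightarrow> ereal" where
  "nmf_objective M = (\<lambda>(X, Y).
     ereal (1 / 2 * (norm (X ** transpose Y - M))\<^sup>2)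
       + set_indicator {0..} X + set_indicator {0..} Y)"

definition nmf_critical_point ::
    "real ^ 'n ^ 'm \<Rightarrow> (real ^ 'p ^ 'm) \<times> (real ^ 'p ^ 'n) \<Rightarrow> bool" where
  "nmf_critical_point M Z \<longleftrightarrow> 0 \<in> limiting_subdifferential (nmf_objective M) Z"

section \<open>Modified rank-one residue iteration\<close>

text \<open>
  The product of the submatrix of \<open>X\<close> formed by the columns with indices in \<open>S\<close> and the
  transpose of the corresponding submatrix of \<open>Y\<close>.
\<close>

definition cols_product ::
    "'p set \<Rightarrow> real ^ 'p ^ 'm \<Rightarrow> real ^ 'p ^ 'n \<Rightarrow> real ^ 'n ^ 'm" where
  "cols_product S X Y = (\<chi> a b. \<Sum>j\<in>S. X $ a $ j * Y $ b $ j)"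

lemma cols_product_UNIV: "cols_product UNIV X Y = X ** transpose Y"
  by (simp add: cols_product_def matrix_matrix_mult_def transpose_def)

definition rri_L :: "real \<Rightarrow> real ^ 'p ^ 'n \<Rightarrow> 'p \<Rightarrow> real" where
  "rri_L Lmin Y j = max Lmin ((norm (column j Y))\<^sup>2)"

text \<open>
  One cycle, from \<open>(X, Y)\<close> to \<open>(X', Y')\<close>. The permutation is the enumeration
  \<open>\<pi> 1, \<dots>, \<pi> p\<close> of the column indices. Each column is updated exactly once per cycle, so the
  columns already updated before step \<open>i\<close> are columns of \<open>X'\<close> and \<open>Y'\<close>.
\<close>

definition rri_cycle ::
    "real \<Rightarrow> real ^ 'n ^ 'm \<Rightarrow> (nat \<Rightarrow> 'p) \<Rightarrow>
     real ^ 'p ^ 'm \<Rightarrow> real ^ 'p ^ 'n \<Rightarrow> real ^ 'p ^ 'm \<Rightarrow> real ^ 'p ^ 'n \<Rightarrow> bool" where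
  "rri_cycle Lmin M \<pi> X Y X' Y' \<longleftrightarrow>
     bij_betw \<pi> {1..CARD('p)} UNIV \<and>
     (\<forall>i\<in>{1..CARD('p)}.
        is_arg_min
          (\<lambda>x. rri_L Lmin Y (\<pi> i) / 2 * (norm (x - column (\<pi> i) X))\<^sup>2
               + column (\<pi> i) Y \<bullet>
                   (transpose (cols_product (\<pi> ` {1..<i}) X' Y'
                               + cols_product (\<pi> ` {i..CARD('p)}) X Y - M) *v x))
          (\<lambda>x. 0 \<le> x \<and> norm x = 1)
          (column (\<pi> i) X') \<and>
        is_arg_min
          (\<lambda>y. 1 / 2 * (norm y)\<^sup>2
               + y \<bullet>
                   (transpose (cols_product (\<pi> ` {1..<i}) X' Y'
                               + cols_product (\<pi> ` {i<..CARD('p)}) X Y - M) *v column (\<pi> i) X'))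
          (\<lambda>y. 0 \<le> y)
          (column (\<pi> i) Y'))"

end

theory Submission
  imports Defs "HOL-Library.Function_Algebras" "HOL-Computational_Algebra.Polynomial"
begin

text \<open>
  From the second iterate on, all iterates are feasible with columns \<open>x\<^sub>i\<close> on the unit sphere. The update
  of a column of \<open>Y\<close> decreases the objective strongly; the update of a column of \<open>X\<close> does so
  unless the following update of \<open>Y\<close> decreases the objective by a fixed amount, which happens only finitely
  often. Hence eventually the decrease dominates the squared step length, and the step length
  dominates the gradient on the positive coordinates. Convergence then follows from the Lojasiewicz
  gradient inequality for polynomials, applied on each face of the nonnegative orthant.

  The gradient inequality \<open>norm (grad f) \<ge> c * f powr (\<theta> / 2)\<close> with \<open>\<theta> < 2\<close> is obtained without quantifier
  elimination. One minimizes a polynomial \<open>H s\<close> that penalizes both \<open>f - s\<close> and the gradient of \<open>f\<close>,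
  regularized by a top-degree term. By a dimension count, every polynomial expression in a critical
  point of \<open>H s\<close> is algebraic over the single parameter \<open>s\<close>. So if the inequality failed,
  there would be a continuous algebraic curve \<open>w\<close> with \<open>f (w s) = s + O(s^2)\<close> and gradient \<open>O(s)\<close> along \<open>w\<close>.
  An algebraic curve has finite length, since each coordinate crosses almost every level a bounded number of
  times, whereas \<open>ln (f (w s))\<close> is unbounded; this is a contradiction.
\<close>

section \<open>Elimination\<close>

text \<open>\<open>L\<close> may equal the squared norm of the column of \<open>Y\<close>. The
  objective of the \<open>X\<close> update is then linear on the sphere, and the proximal term gives
  no curvature; the multiplier \<open>lam\<close> of the sphere constraint, whose sign is not fixed,
  has to supply it. This is why the descent estimate looks at the two updates of a pair of columns
  together. In the gradient inequality a minimizer of \<open>H s\<close> is chosen separately for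
  each \<open>s\<close> and may jump. Its coordinates are roots of fixed bivariate polynomials, and
  the bounded roots lie on finitely many continuous branches, so one combination of branches is hit
  for arbitrarily small \<open>s\<close>. An algebraic function has constant sign near zero; hence
  polynomial inequalities that hold at these minimizers extend along that combination to all small
  \<open>s\<close>. Faces enter because the set of positive coordinates of the iterates may change
  infinitely often. There are only finitely many faces, so one exponent and one constant serve all
  of them.\<close>

definition bieval :: "real poly poly \<Rightarrow> real \<Rightarrow> real \<Rightarrow> real" where
  "bieval Q s u = poly (poly Q [:u:]) s"

lemma bieval_0 [simp]: "bieval 0 s u = 0"
  by (simp add: bieval_def)

lemma bieval_pCons [simp]: "bieval (pCons a Q) s u = poly a s + u * bieval Q s u"
  by (simp add: bieval_def)

lemma bieval_add [simp]: "bieval (P + Q) s u = bieval P s u + bieval Q s u"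
  by (simp add: bieval_def)

lemma bieval_minus [simp]: "bieval (- P) s u = - bieval P s u"
  by (simp add: bieval_def)

lemma bieval_mult [simp]: "bieval (P * Q) s u = bieval P s u * bieval Q s u"
  by (simp add: bieval_def)

lemma bieval_sum: "bieval (\<Sum>i\<in>A. P i) s u = (\<Sum>i\<in>A. bieval (P i) s u)"
  by (induction A rule: infinite_finite_induct) auto

lemma bieval_monom [simp]: "bieval (monom c j) s u = poly c s * u ^ j"
  by (simp add: bieval_def poly_monom)

lemma bieval_altdef: "bieval Q s u = (\<Sum>j\<le>degree Q. poly (coeff Q j) s * u ^ j)"
proof -
  have "bieval Q s u = bieval (\<Sum>j\<le>degree Q. monom (coeff Q j) j) s u"
    by (simp add: poly_as_sum_of_monoms)
  then show ?thesis
    by (simp add: bieval_sum)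
qed

lemma continuous_on_bieval [continuous_intros]:
  assumes "continuous_on A f" "continuous_on A g"
  shows "continuous_on A (\<lambda>x. bieval Q (f x) (g x))"
proof (induction Q)
  case 0
  then show ?case by simp
next
  case (pCons a Q)
  then show ?case
    using assms by (auto intro!: continuous_intros)
qed

text \<open>The outer variable of \<open>Q\<close> is \<open>u\<close>, and its coefficients are
  polynomials in \<open>s\<close>. Hence \<open>pderiv\<close> differentiates in \<open>u\<close>,
  while \<open>poly Q [:c:]\<close> is the polynomial in \<open>s\<close> that describes the level
  \<open>u = c\<close>.\<close>

lemma has_field_derivative_bieval:
  "((\<lambda>u. bieval Q s u) has_field_derivative bieval (pderiv Q) s u) (at u)"
proof (induction Q)
  case 0
  then show ?case by simp
next
  case (pCons a Q)
  show ?case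
    by (auto intro!: derivative_eq_intros pCons.IH simp: pderiv_pCons)
qed

section \<open>Linear relations between real functions\<close>

interpretation fs: vector_space "\<lambda>(c::real) (f::'x \<Rightarrow> real) x. c * f x"
  by unfold_locales (auto simp: fun_eq_iff algebra_simps)

lemma sum_fun_apply: "(\<Sum>i\<in>A. f i) x = (\<Sum>i\<in>A. f i x :: real)"
  by (induction A rule: infinite_finite_induct) auto

text \<open>Dependence is a notion for sets, whereas the family \<open>F\<close> may repeat a
  function. A repetition gives a relation with the coefficients 1 and -1.\<close>

lemma fs_linear_relation:
  fixes F :: "'i \<Rightarrow> 'x \<Rightarrow> real"
  assumes "finite I" "finite B" "card B < card I" and F: "\<And>i. i \<in> I \<Longrightarrow> F i \<in> fs.span B"
  obtains c where "\<exists>i\<in>I. c i \<noteq> 0" "\<And>x. (\<Sum>i\<in>I. c i * F i x) = 0"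
proof (cases "inj_on F I")
  case True
  then have "card (F ` I) = card I"
    by (rule card_image)
  then have "fs.dependent (F ` I)"
    using fs.independent_span_bound[OF assms(2), of "F ` I"] F assms(3) by force
  then obtain u where u: "\<exists>v\<in>F ` I. u v \<noteq> 0" "(\<Sum>v\<in>F ` I. (\<lambda>x. u v * v x)) = 0"
    using fs.dependent_finite[of "F ` I"] \<open>finite I\<close> by auto
  have "(\<Sum>i\<in>I. u (F i) * F i x) = 0" for x
  proof -
    have "(\<Sum>v\<in>F ` I. (\<lambda>x. u v * v x)) x = (\<Sum>v\<in>F ` I. u v * v x)"
      by (rule sum_fun_apply)
    also have "\<dots> = (\<Sum>i\<in>I. u (F i) * F i x)"
      by (simp add: sum.reindex[OF True])
    finally show ?thesis using u(2) by simp
  qed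
  then show ?thesis using u(1) that[of "\<lambda>i. u (F i)"] by auto
next
  case False
  then obtain i j where ij: "i \<in> I" "j \<in> I" "i \<noteq> j" "F i = F j"
    by (auto simp: inj_on_def)
  define c where "c = (\<lambda>k. if k = i then 1 else if k = j then -1 else (0::real))"
  have "(\<Sum>k\<in>I. c k * F k x) = 0" for x
  proof -
    have "(\<Sum>k\<in>I. c k * F k x) = (\<Sum>k\<in>{i,j}. c k * F k x)"
      using ij \<open>finite I\<close> by (intro sum.mono_neutral_right) (auto simp: c_def)
    also have "\<dots> = 0" using ij by (simp add: c_def)
    finally show ?thesis .
  qed
  moreover have "c i \<noteq> 0" by (simp add: c_def)
  ultimately show ?thesis using that[of c] ij(1) by blast
qed

lemma fs_span_mult:
  assumes "F \<in> fs.span A" "\<And>g. g \<in> A \<Longrightarrow> h * g \<in> fs.span W"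
  shows "h * F \<in> fs.span W"
  using assms(1)
proof (induction rule: fs.span_induct_alt)
  case base
  then show ?case using fs.span_zero[of W] by (simp add: zero_fun_def times_fun_def)
next
  case (step c g F)
  have "h * ((\<lambda>x. c * g x) + F) = (\<lambda>x. c * (h * g) x) + h * F"
    by (auto simp: fun_eq_iff algebra_simps)
  then show ?case
    using step assms(2) by (metis fs.span_add fs.span_scale)
qed

section \<open>Polynomial functions in a parameter and in coordinates\<close>

definition pmonom :: "('x \<Rightarrow> real) \<Rightarrow> ('b \<Rightarrow> 'x \<Rightarrow> real) \<Rightarrow> 'b set \<Rightarrow> nat \<Rightarrow> ('b \<Rightarrow> nat) \<Rightarrow> 'x \<Rightarrow> real" where
  "pmonom s z B i \<alpha> = (\<lambda>x. s x ^ i * (\<Prod>b\<in>B. z b x ^ \<alpha> b))"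

text \<open>These are functions on the index type, not formal polynomials, so equations that hold at
  every index can be used to rewrite them. \<open>k\<close> bounds the degree in the parameter
  \<open>s\<close>, and \<open>n\<close> the total degree in \<open>z\<close>.\<close>

definition polys :: "('x \<Rightarrow> real) \<Rightarrow> ('b \<Rightarrow> 'x \<Rightarrow> real) \<Rightarrow> 'b set \<Rightarrow> nat \<Rightarrow> nat \<Rightarrow> ('x \<Rightarrow> real) set" where
  "polys s z B k n = fs.span {pmonom s z B i \<alpha> | i \<alpha>. i \<le> k \<and> sum \<alpha> B \<le> n}"

text \<open>Here each single exponent is bounded, independently of any total degree. For given
  \<open>d\<close> the number of spanning monomials grows only linearly in \<open>k\<close>, on
  which the dimension count rests.\<close>

definition reds :: "('x \<Rightarrow> real) \<Rightarrow> ('b \<Rightarrow> 'x \<Rightarrow> real) \<Rightarrow> 'b set \<Rightarrow> nat \<Rightarrow> nat \<Rightarrow> ('x \<Rightarrow> real) set" where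
  "reds s z B d k = fs.span {pmonom s z B i \<alpha> | i \<alpha>. i \<le> k \<and> (\<forall>b\<in>B. \<alpha> b < d)}"

lemma pmonom_mult: "pmonom s z B i \<alpha> * pmonom s z B j \<beta> = pmonom s z B (i + j) (\<lambda>b. \<alpha> b + \<beta> b)"
  by (auto simp: pmonom_def fun_eq_iff power_add prod.distrib)

lemma polys_mono: "k \<le> k' \<Longrightarrow> n \<le> n' \<Longrightarrow> polys s z B k n \<subseteq> polys s z B k' n'"
  unfolding polys_def by (intro fs.span_mono) force

lemma reds_mono: "k \<le> k' \<Longrightarrow> reds s z B d k \<subseteq> reds s z B d k'"
  unfolding reds_def by (intro fs.span_mono) force

lemma polys_pmonom: "i \<le> k \<Longrightarrow> sum \<alpha> B \<le> n \<Longrightarrow> pmonom s z B i \<alpha> \<in> polys s z B k n"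
  unfolding polys_def by (intro fs.span_base) auto

lemma polys_add: "F \<in> polys s z B k n \<Longrightarrow> G \<in> polys s z B k n \<Longrightarrow> F + G \<in> polys s z B k n"
  unfolding polys_def by (rule fs.span_add)

lemma polys_scale: "F \<in> polys s z B k n \<Longrightarrow> (\<lambda>x. c * F x) \<in> polys s z B k n"
  unfolding polys_def by (rule fs.span_scale)

lemma polys_mult:
  assumes "F \<in> polys s z B k n" "G \<in> polys s z B k' n'"
  shows "F * G \<in> polys s z B (k + k') (n + n')"
proof -
  have *: "pmonom s z B i \<alpha> * G \<in> polys s z B (k + k') (n + n')" if "i \<le> k" "sum \<alpha> B \<le> n" for i \<alpha>
    using assms(2) unfolding polys_def
  proof (rule fs_span_mult)
    fix g assume "g \<in> {pmonom s z B i \<alpha> |i \<alpha>. i \<le> k' \<and> sum \<alpha> B \<le> n'}"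
    then obtain j \<beta> where g: "g = pmonom s z B j \<beta>" "j \<le> k'" "sum \<beta> B \<le> n'" by auto
    show "pmonom s z B i \<alpha> * g \<in> fs.span {pmonom s z B i \<alpha> |i \<alpha>. i \<le> k + k' \<and> sum \<alpha> B \<le> n + n'}"
      unfolding g(1) pmonom_mult
      using that g by (intro fs.span_base) (auto intro!: exI[of _ "i + j"] exI[of _ "\<lambda>b. \<alpha> b + \<beta> b"] simp: sum.distrib)
  qed
  have "G * F \<in> polys s z B (k + k') (n + n')"
    using assms(1) unfolding polys_def
  proof (rule fs_span_mult)
    fix g assume "g \<in> {pmonom s z B i \<alpha> |i \<alpha>. i \<le> k \<and> sum \<alpha> B \<le> n}"
    then show "G * g \<in> fs.span {pmonom s z B i \<alpha> |i \<alpha>. i \<le> k + k' \<and> sum \<alpha> B \<le> n + n'}"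
      using * by (auto simp: polys_def mult.commute)
  qed
  then show ?thesis by (simp add: mult.commute)
qed

lemma polys_const: "(\<lambda>x. c) \<in> polys s z B k n"
  using polys_scale[OF polys_pmonom[of 0 k "\<lambda>_. 0" B n s z], of c] by (simp add: pmonom_def)

lemma polys_power: "F \<in> polys s z B k n \<Longrightarrow> (\<lambda>x. F x ^ j) \<in> polys s z B (k * j) (n * j)"
proof (induction j)
  case 0
  then show ?case using polys_const[of 1] by simp
next
  case (Suc j)
  have "(\<lambda>x. F x ^ Suc j) = F * (\<lambda>x. F x ^ j)" by (simp add: fun_eq_iff)
  then show ?case using polys_mult[OF Suc.prems Suc.IH[OF Suc.prems]] by simp
qed

lemma reds_poly_mult:
  assumes "F \<in> reds s z B d k" "degree a \<le> e"
  shows "(\<lambda>x. poly a (s x)) * F \<in> reds s z B d (k + e)"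
  using assms(1) unfolding reds_def
proof (rule fs_span_mult)
  fix g assume "g \<in> {pmonom s z B i \<alpha> |i \<alpha>. i \<le> k \<and> (\<forall>b\<in>B. \<alpha> b < d)}"
  then obtain i \<alpha> where g: "g = pmonom s z B i \<alpha>" "i \<le> k" "\<forall>b\<in>B. \<alpha> b < d" by auto
  have "(\<lambda>x. poly a (s x)) * g = (\<Sum>j\<le>degree a. (\<lambda>x. coeff a j * pmonom s z B (i + j) \<alpha> x))"
  proof
    fix x
    have "((\<lambda>x. poly a (s x)) * g) x = (\<Sum>j\<le>degree a. coeff a j * pmonom s z B (i + j) \<alpha> x)"
      by (simp add: g poly_altdef pmonom_def sum_distrib_left sum_distrib_right power_add mult_ac)
    also have "\<dots> = (\<Sum>j\<le>degree a. (\<lambda>x. coeff a j * pmonom s z B (i + j) \<alpha> x)) x"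
      by (simp add: sum_fun_apply)
    finally show "((\<lambda>x. poly a (s x)) * g) x = \<dots>" .
  qed
  also have "\<dots> \<in> fs.span {pmonom s z B i \<alpha> |i \<alpha>. i \<le> k + e \<and> (\<forall>b\<in>B. \<alpha> b < d)}"
    using g assms(2) by (intro fs.span_sum fs.span_scale fs.span_base) force
  finally show "(\<lambda>x. poly a (s x)) * g \<in> \<dots>" .
qed

text \<open>Replacing \<open>z b ^ d\<close> by \<open>r b\<close> costs one factor \<open>a\<close>
  and lowers the total degree in \<open>z\<close> by at least \<open>d - n\<close>, which is
  positive. So \<open>N\<close> factors reduce a monomial of total degree at most \<open>N\<close>,
  and each factor raises the degree in \<open>s\<close> by at most \<open>e\<close>.\<close>

lemma reduction:
  fixes s :: "'x \<Rightarrow> real" and z :: "'b \<Rightarrow> 'x \<Rightarrow> real"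
  assumes B: "finite B" and n: "n < d" and a: "degree a \<le> e"
    and r: "\<And>b. b \<in> B \<Longrightarrow> r b \<in> polys s z B e n"
    and eq: "\<And>b x. b \<in> B \<Longrightarrow> poly a (s x) * z b x ^ d = r b x"
  shows "sum \<alpha> B \<le> N \<Longrightarrow> (\<lambda>x. poly a (s x) ^ N) * pmonom s z B i \<alpha> \<in> reds s z B d (i + e * N)"
proof (induction N arbitrary: i \<alpha>)
  case 0
  have "pmonom s z B i \<alpha> \<in> reds s z B d i"
    unfolding reds_def using 0 n B by (intro fs.span_base) force
  then show ?case by (simp add: times_fun_def)
next
  case (Suc N)
  let ?A = "\<lambda>N x. poly a (s x) ^ N"
  show ?case
  proof (cases "\<forall>b\<in>B. \<alpha> b < d")
    case True
    have *: "?A M * pmonom s z B i \<alpha> \<in> reds s z B d (i + e * M)" for M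
    proof (induction M)
      case 0
      then show ?case unfolding reds_def
        using True by (intro fs.span_base) (auto simp: times_fun_def)
    next
      case (Suc M)
      have 1: "?A (Suc M) * pmonom s z B i \<alpha> = (\<lambda>x. poly a (s x)) * (?A M * pmonom s z B i \<alpha>)"
        by (simp add: fun_eq_iff)
      have 2: "i + e * Suc M = i + e * M + e" by simp
      show ?case unfolding 1 2 by (rule reds_poly_mult[OF Suc a])
    qed
    then show ?thesis by blast
  next
    case False
    then obtain b where b: "b \<in> B" "\<alpha> b \<ge> d" by (auto simp: not_less)
    define \<alpha>' where "\<alpha>' = \<alpha>(b := \<alpha> b - d)"
    have sum\<alpha>: "sum \<alpha> B = sum \<alpha>' B + d"
      using B b by (simp add: \<alpha>'_def sum.remove[of B b])
    have "pmonom s z B i \<alpha> x = pmonom s z B i \<alpha>' x * z b x ^ d" for x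
      using B b unfolding pmonom_def by (simp add: \<alpha>'_def prod.remove[of B b] flip: power_add)
    then have "?A (Suc N) * pmonom s z B i \<alpha> = (?A N * pmonom s z B i \<alpha>') * r b"
      using eq[OF b(1)] by (auto simp: fun_eq_iff mult_ac)
    also have "\<dots> \<in> reds s z B d (i + e * Suc N)"
      using r[OF b(1)] unfolding polys_def reds_def
    proof (rule fs_span_mult)
      fix g assume "g \<in> {pmonom s z B i \<alpha> |i \<alpha>. i \<le> e \<and> sum \<alpha> B \<le> n}"
      then obtain j \<beta> where g: "g = pmonom s z B j \<beta>" "j \<le> e" "sum \<beta> B \<le> n" by auto
      have "?A N * pmonom s z B i \<alpha>' * g = ?A N * pmonom s z B (i + j) (\<lambda>b. \<alpha>' b + \<beta> b)"
        by (simp add: g mult.assoc pmonom_mult)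
      moreover have "\<dots> \<in> reds s z B d (i + j + e * N)"
        using Suc.prems sum\<alpha> g n by (intro Suc.IH) (auto simp: sum.distrib)
      ultimately show "?A N * pmonom s z B i \<alpha>' * g \<in>
          fs.span {pmonom s z B i' \<beta> |i' \<beta>. i' \<le> i + e * Suc N \<and> (\<forall>b\<in>B. \<beta> b < d)}"
        using reds_mono[of "i + j + e * N" "i + e * Suc N" s z B d] g by (auto simp: reds_def)
    qed
    finally show ?thesis .
  qed
qed

lemma reduction_polys:
  fixes s :: "'x \<Rightarrow> real" and z :: "'b \<Rightarrow> 'x \<Rightarrow> real"
  assumes B: "finite B" and n: "n < d" and a: "degree a \<le> e"
    and r: "\<And>b. b \<in> B \<Longrightarrow> r b \<in> polys s z B e n"
    and eq: "\<And>b x. b \<in> B \<Longrightarrow> poly a (s x) * z b x ^ d = r b x"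
    and F: "F \<in> polys s z B k N"
  shows "(\<lambda>x. poly a (s x) ^ N) * F \<in> reds s z B d (k + e * N)"
  using F unfolding polys_def reds_def
proof (rule fs_span_mult)
  fix g assume "g \<in> {pmonom s z B i \<alpha> |i \<alpha>. i \<le> k \<and> sum \<alpha> B \<le> N}"
  then obtain j \<beta> where g: "g = pmonom s z B j \<beta>" "j \<le> k" "sum \<beta> B \<le> N" by auto
  show "(\<lambda>x. poly a (s x) ^ N) * g \<in> fs.span {pmonom s z B i \<alpha> |i \<alpha>. i \<le> k + e * N \<and> (\<forall>b\<in>B. \<alpha> b < d)}"
    using reduction[OF B n a r eq g(3), of j] reds_mono[of "j + e * N" "k + e * N" s z B d] g
    unfolding reds_def by auto
qed

lemma elimination:
  fixes s :: "'x \<Rightarrow> real" and z :: "'b \<Rightarrow> 'x \<Rightarrow> real"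
  assumes B: "finite B" and n: "n < d"
    and r: "\<And>b. b \<in> B \<Longrightarrow> r b \<in> polys s z B e n"
    and eq: "\<And>b x. b \<in> B \<Longrightarrow> poly a (s x) * z b x ^ d = r b x"
    and F: "F \<in> polys s z B k N" and nz: "\<And>x. poly a (s x) \<noteq> 0"
  obtains Q where "Q \<noteq> 0" "\<And>x. bieval Q (s x) (F x) = 0"
proof -
  define e' where "e' = max e (degree a)"
  have e': "degree a \<le> e'" and r': "\<And>b. b \<in> B \<Longrightarrow> r b \<in> polys s z B e' n"
    using r polys_mono[of e e' n n s z B] by (auto simp: e'_def)
  define T where "T = card (B \<rightarrow>\<^sub>E {..<d})"
  \<comment> \<open>\<open>N'\<close> bounds the degree in \<open>z\<close> of the powers of
    \<open>F\<close> up to \<open>T\<close>, and \<open>K\<close> the degree in \<open>s\<close>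
    that these powers and their reduction add. With \<open>i\<close> up to \<open>K * T\<close>
    there are \<open>(K * T + 1) * (T + 1)\<close> products, exactly one more than the bound
    \<open>(K * T + K + 1) * T\<close> on the size of \<open>W\<close>.\<close>
  define N' where "N' = N * T"
  define K where "K = k * T + e' * N'"
  define I where "I = {..K * T} \<times> {..T}"
  define G where "G = (\<lambda>(i,j). (\<lambda>x. poly a (s x) ^ N') * (\<lambda>x. s x ^ i * F x ^ j))"
  define W where "W = {pmonom s z B i \<alpha> | i \<alpha>. i \<le> K * T + K \<and> (\<forall>b\<in>B. \<alpha> b < d)}"
  have W: "W = (\<lambda>(i,\<alpha>). pmonom s z B i \<alpha>) ` ({..K * T + K} \<times> (B \<rightarrow>\<^sub>E {..<d}))" (is "_ = ?R")
  proof
    show "?R \<subseteq> W" unfolding W_def by force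
    show "W \<subseteq> ?R"
    proof
      fix g assume "g \<in> W"
      then obtain i \<alpha> where g: "g = pmonom s z B i \<alpha>" "i \<le> K * T + K" "\<forall>b\<in>B. \<alpha> b < d"
        unfolding W_def by auto
      have "g = pmonom s z B i (restrict \<alpha> B)" "restrict \<alpha> B \<in> B \<rightarrow>\<^sub>E {..<d}"
        using g by (auto simp: pmonom_def)
      then show "g \<in> ?R" using g(2) by (auto intro!: image_eqI[of _ _ "(i, restrict \<alpha> B)"])
    qed
  qed
  have finP: "finite (B \<rightarrow>\<^sub>E {..<d})" using B by (intro finite_PiE) auto
  have "card W \<le> card ({..K * T + K} \<times> (B \<rightarrow>\<^sub>E {..<d}))"
    unfolding W using finP by (intro card_image_le) auto
  also have "\<dots> = (K * T + K + 1) * T" by (simp add: card_cartesian_product T_def)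
  also have "\<dots> < card I"
    by (simp add: I_def card_cartesian_product algebra_simps)
  finally have card: "card W < card I" .
  have GW: "G p \<in> fs.span W" if p: "p \<in> I" for p
  proof -
    obtain i j where ij: "p = (i, j)" "i \<le> K * T" "j \<le> T" using p by (auto simp: I_def)
    have "(\<lambda>x. F x ^ j) \<in> polys s z B (k * j) (N * j)" by (rule polys_power[OF F])
    then have Fj: "(\<lambda>x. F x ^ j) \<in> polys s z B (k * T) N'"
      using polys_mono[of "k * j" "k * T" "N * j" N' s z B] ij by (auto simp: N'_def)
    have "(\<lambda>x. s x ^ i) = pmonom s z B i (\<lambda>_. 0)" by (simp add: pmonom_def)
    then have "(\<lambda>x. s x ^ i) \<in> polys s z B (K * T) 0"
      using polys_pmonom[of i "K*T" "\<lambda>_. 0" B 0 s z] ij by simp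
    from polys_mult[OF this Fj]
    have "(\<lambda>x. s x ^ i * F x ^ j) \<in> polys s z B (K * T + k * T) N'"
      by (simp add: times_fun_def)
    from reduction_polys[OF B n e' r' eq this]
    show ?thesis unfolding G_def ij W_def reds_def K_def by (simp add: algebra_simps)
  qed
  have "finite W" unfolding W using finP by auto
  moreover have "finite I" by (simp add: I_def)
  ultimately obtain c where c: "\<exists>p\<in>I. c p \<noteq> 0" "\<And>x. (\<Sum>p\<in>I. c p * G p x) = 0"
    using fs_linear_relation[of I W G] card GW by metis
  define Q where "Q = (\<Sum>j\<le>T. monom (\<Sum>i\<le>K * T. monom (c (i, j)) i) j)"
  have "bieval Q (s x) (F x) = 0" for x
  proof -
    have "0 = (\<Sum>i\<le>K * T. \<Sum>j\<le>T. c (i, j) * (poly a (s x) ^ N' * (s x ^ i * F x ^ j)))"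
      using c(2)[of x] unfolding I_def G_def sum.cartesian_product by (simp add: case_prod_beta)
    also have "\<dots> = poly a (s x) ^ N' * (\<Sum>j\<le>T. \<Sum>i\<le>K * T. c (i, j) * s x ^ i * F x ^ j)"
      by (subst sum.swap) (simp add: sum_distrib_left mult_ac)
    finally have "(\<Sum>j\<le>T. \<Sum>i\<le>K * T. c (i, j) * s x ^ i * F x ^ j) = 0" using nz by simp
    then show ?thesis
      by (simp add: Q_def bieval_sum poly_sum poly_monom sum_distrib_right)
  qed
  moreover have "Q \<noteq> 0"
  proof
    assume "Q = 0"
    obtain i j where ij: "i \<le> K * T" "j \<le> T" "c (i, j) \<noteq> 0" using c(1) by (auto simp: I_def)
    have "coeff (coeff Q j) i = c (i, j)"
      using ij by (simp add: Q_def coeff_sum coeff_monom if_distrib sum.delta cong: if_cong)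
    then show False using \<open>Q = 0\<close> ij by simp
  qed
  ultimately show ?thesis using that by blast
qed


text \<open>The degree bounds are chosen before \<open>s\<close> and \<open>Z\<close>, so they
  remain valid for any parametrization of a solution set that is inserted later.\<close>

lemma polynomial_in_polys:
  fixes p :: "real \<times> 'a::euclidean_space \<Rightarrow> real"
  assumes "real_polynomial_function p"
  shows "\<exists>k n. \<forall>s (Z :: 'x \<Rightarrow> 'a). (\<lambda>x. p (s x, Z x)) \<in> polys s (\<lambda>b x. Z x \<bullet> b) Basis k n"
  using assms
proof induction
  case (linear f)
  then interpret bounded_linear f .
  have "(\<lambda>x. f (s x, Z x)) \<in> polys s (\<lambda>b x. Z x \<bullet> b) Basis 1 1" for s and Z :: "'x \<Rightarrow> 'a"
  proof -
    have lin: "f (t, y) = f (1, 0) * t + (\<Sum>b\<in>Basis. f (0, b) * (y \<bullet> b))" for t y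
    proof -
      have "(t, y) = t *\<^sub>R (1, 0) + (\<Sum>b\<in>Basis. (y \<bullet> b) *\<^sub>R (0, b))"
        by (simp add: prod_eq_iff fst_sum snd_sum euclidean_representation)
      then have "f (t, y) = f (t *\<^sub>R (1, 0) + (\<Sum>b\<in>Basis. (y \<bullet> b) *\<^sub>R (0, b)))" by simp
      also have "\<dots> = f (1, 0) * t + (\<Sum>b\<in>Basis. f (0, b) * (y \<bullet> b))"
        by (simp only: add sum scale) (simp add: mult_ac)
      finally show ?thesis .
    qed
    have unit: "(\<Prod>b\<in>Basis. (y \<bullet> b) ^ (if b = c then 1 else 0)) = y \<bullet> c"
      if "c \<in> Basis" for y c :: 'a
    proof -
      have "(\<Prod>b\<in>Basis. (y \<bullet> b) ^ (if b = c then 1 else 0)) =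
          (\<Prod>b\<in>Basis. if b = c then y \<bullet> b else 1)"
        by (intro prod.cong) auto
      then show ?thesis using that by simp
    qed
    have eq: "(\<lambda>x. f (s x, Z x)) =
        (\<lambda>x. f (1, 0) * pmonom s (\<lambda>b x. Z x \<bullet> b) Basis 1 (\<lambda>_. 0) x) +
        (\<Sum>c\<in>Basis. (\<lambda>x. f (0, c) * pmonom s (\<lambda>b x. Z x \<bullet> b) Basis 0 (\<lambda>b. if b = c then 1 else 0) x))"
      by (rule ext, subst lin) (simp add: pmonom_def sum_fun_apply unit)
    show ?thesis unfolding eq polys_def
      by (intro fs.span_add fs.span_sum fs.span_scale fs.span_base) force+
  qed
  then show ?case by blast
next
  case (const c)
  then show ?case using polys_const by blast
next
  case (add f g)
  let ?P = "\<lambda>k n f. \<forall>s (Z :: 'x \<Rightarrow> 'a). (\<lambda>x. f (s x, Z x)) \<in> polys s (\<lambda>b x. Z x \<bullet> b) Basis k n"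
  obtain k n where 1: "?P k n f" using add.IH(1) by (elim exE)
  obtain k' n' where 2: "?P k' n' g" using add.IH(2) by (elim exE)
  have "(\<lambda>x. f (s x, Z x)) + (\<lambda>x. g (s x, Z x)) \<in> polys s (\<lambda>b (x::'x). Z x \<bullet> b) Basis (max k k') (max n n')"
    for s and Z :: "'x \<Rightarrow> 'a"
    using 1[rule_format, of s Z] 2[rule_format, of s Z]
    by (intro polys_add subsetD[OF polys_mono[OF max.cobounded1 max.cobounded1]]
        subsetD[OF polys_mono[OF max.cobounded2 max.cobounded2]])
  then have "?P (max k k') (max n n') (\<lambda>x. f x + g x)" by (simp only: plus_fun_def) simp
  then show ?case by (intro exI)
next
  case (mult f g)
  let ?P = "\<lambda>k n f. \<forall>s (Z :: 'x \<Rightarrow> 'a). (\<lambda>x. f (s x, Z x)) \<in> polys s (\<lambda>b x. Z x \<bullet> b) Basis k n"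
  obtain k n where 1: "?P k n f" using mult.IH(1) by (elim exE)
  obtain k' n' where 2: "?P k' n' g" using mult.IH(2) by (elim exE)
  have "(\<lambda>x. f (s x, Z x)) * (\<lambda>x. g (s x, Z x)) \<in> polys s (\<lambda>b (x::'x). Z x \<bullet> b) Basis (k + k') (n + n')"
    for s and Z :: "'x \<Rightarrow> 'a"
    by (rule polys_mult[OF 1[rule_format, of s Z] 2[rule_format, of s Z]])
  then have "?P (k + k') (n + n') (\<lambda>x. f x * g x)" by (simp only: times_fun_def) simp
  then show ?case by (intro exI)
qed

section \<open>Algebraic functions of one variable near zero\<close>

lemma polys_sum:
  assumes "finite J" "\<And>j. j \<in> J \<Longrightarrow> \<exists>k. F j \<in> polys s z B k n"
  shows "\<exists>k. (\<lambda>x. \<Sum>j\<in>J. F j x) \<in> polys s z B k n"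
  using assms
proof (induction J rule: finite_induct)
  case empty
  show ?case unfolding sum.empty by (rule exI, rule polys_const)
next
  case (insert j J)
  obtain k where k: "F j \<in> polys s z B k n" using insert.prems by blast
  obtain k' where k': "(\<lambda>x. \<Sum>j\<in>J. F j x) \<in> polys s z B k' n" using insert by blast
  have "F j + (\<lambda>x. \<Sum>j\<in>J. F j x) \<in> polys s z B (max k k') n"
    using k k' by (intro polys_add subsetD[OF polys_mono[OF max.cobounded1 order_refl]]
        subsetD[OF polys_mono[OF max.cobounded2 order_refl]])
  then show ?case using insert by (auto simp: plus_fun_def)
qed

lemma polys_poly: "\<exists>k. (\<lambda>x. poly a (s x)) \<in> polys s z B k 0"
proof -
  have "(\<lambda>x. coeff a i * s x ^ i) \<in> polys s z B i 0" for i
    using polys_scale[OF polys_pmonom[of i i "\<lambda>_. 0" B 0 s z], of "coeff a i"] by (simp add: pmonom_def)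
  then show ?thesis
    unfolding poly_altdef by (intro polys_sum) auto
qed

lemma polys_coord_power:
  assumes "finite B" "b \<in> B"
  shows "(\<lambda>x. z b x ^ j) \<in> polys s z B 0 j"
proof -
  have "(\<Prod>c\<in>B. z c x ^ (if c = b then j else 0)) = z b x ^ j" for x
  proof -
    have "(\<Prod>c\<in>B. z c x ^ (if c = b then j else 0)) = (\<Prod>c\<in>B. if c = b then z c x ^ j else 1)"
      by (intro prod.cong) auto
    then show ?thesis using assms by simp
  qed
  then have "(\<lambda>x. z b x ^ j) = pmonom s z B 0 (\<lambda>c. if c = b then j else 0)"
    by (simp add: pmonom_def)
  then show ?thesis using assms polys_pmonom[of 0 0 "\<lambda>c. if c = b then j else 0" B j s z] by simp
qed

lemma poly_nonzero_near_0:
  assumes "(a :: real poly) \<noteq> 0"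
  shows "\<exists>\<epsilon>>0. \<forall>s\<in>{0<..<\<epsilon>}. poly a s \<noteq> 0"
proof -
  have "finite {s. poly a s = 0}" by (rule poly_roots_finite[OF assms])
  then obtain d where d: "d > 0" "\<forall>x\<in>{s. poly a s = 0}. x \<noteq> 0 \<longrightarrow> d \<le> dist 0 x"
    using finite_set_avoid by metis
  show ?thesis
    using d by (intro exI[of _ d]) (auto simp: dist_real_def)
qed

lemma finite_common_threshold:
  assumes "finite A" "\<And>a. a \<in> A \<Longrightarrow> \<exists>\<delta>>0. R a \<delta>"
    and mono: "\<And>a \<delta> \<delta>'. a \<in> A \<Longrightarrow> R a \<delta> \<Longrightarrow> 0 < \<delta>' \<Longrightarrow> \<delta>' \<le> \<delta> \<Longrightarrow> R a \<delta>'"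
  shows "\<exists>\<delta>>0::real. \<forall>a\<in>A. R a \<delta>"
  using assms
proof (induction A rule: finite_induct)
  case empty
  then show ?case by (auto intro: exI[of _ 1])
next
  case (insert a A)
  have "\<exists>\<delta>>0. \<forall>a\<in>A. R a \<delta>"
    by (rule insert.IH) (use insert.prems in blast)+
  then obtain \<delta> where \<delta>: "\<delta> > 0" "\<forall>a\<in>A. R a \<delta>" by blast
  obtain \<delta>' where \<delta>': "\<delta>' > 0" "R a \<delta>'" using insert by blast
  have "\<forall>c\<in>insert a A. R c (min \<delta> \<delta>')"
  proof
    fix c assume c: "c \<in> insert a A"
    then show "R c (min \<delta> \<delta>')"
      using insert.prems(2)[OF c, of \<delta> "min \<delta> \<delta>'"] insert.prems(2)[OF c, of \<delta>' "min \<delta> \<delta>'"] \<delta> \<delta>' by auto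
  qed
  then show ?case using \<delta> \<delta>' by (intro exI[of _ "min \<delta> \<delta>'"]) auto
qed

text \<open>Continuity is included because a function that merely satisfies the polynomial equation
  could jump between its roots and would have no definite sign near zero.\<close>

definition algebraic_on :: "real \<Rightarrow> (real \<Rightarrow> real) \<Rightarrow> bool" where
  "algebraic_on \<epsilon> u \<longleftrightarrow> continuous_on {0<..<\<epsilon>} u \<and> (\<exists>Q. Q \<noteq> 0 \<and> (\<forall>s\<in>{0<..<\<epsilon>}. bieval Q s (u s) = 0))"

lemma algebraic_on_mono: "algebraic_on \<epsilon> u \<Longrightarrow> \<delta> \<le> \<epsilon> \<Longrightarrow> algebraic_on \<delta> u"
  unfolding algebraic_on_def by (auto intro: continuous_on_subset)

lemma algebraic_on_const: "algebraic_on \<epsilon> (\<lambda>_. c)"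
  unfolding algebraic_on_def by (auto intro!: exI[of _ "[:[:-c:], 1:]"])

lemma bieval_at_0: "bieval Q s 0 = poly (coeff Q 0) s"
  by (cases Q) auto

lemma poly_factor_monom:
  assumes "(P :: 'a::idom poly) \<noteq> 0"
  shows "\<exists>k R. P = monom 1 k * R \<and> coeff R 0 \<noteq> 0"
  using assms
proof (induction P)
  case 0
  then show ?case by simp
next
  case (pCons a P)
  show ?case
  proof (cases "a = 0")
    case True
    then obtain k R where "P = monom 1 k * R" "coeff R 0 \<noteq> 0" using pCons by auto
    then have "pCons a P = monom 1 (Suc k) * R \<and> coeff R 0 \<noteq> 0"
      using True by (simp add: monom_Suc)
    then show ?thesis by blast
  next
    case False
    then show ?thesis by (intro exI[of _ 0] exI[of _ "pCons a P"]) simp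
  qed
qed

text \<open>After a power of the outer variable is split off from \<open>Q\<close>, the remaining
  factor \<open>R\<close> has no root \<open>u = 0\<close> for small \<open>s\<close>. The zeros of
  \<open>u\<close> and the zeros of \<open>R\<close> along \<open>u\<close> are then disjoint closed
  sets that cover an interval. By connectedness one of them is empty, so \<open>u\<close> vanishes
  identically or nowhere.\<close>

lemma algebraic_on_sign:
  assumes "algebraic_on \<epsilon> u" "0 < \<epsilon>"
  shows "\<exists>\<delta>. 0 < \<delta> \<and> \<delta> \<le> \<epsilon> \<and> (\<exists>v. \<forall>s\<in>{0<..<\<delta>}. sgn (u s) = v)"
proof -
  obtain Q where Q: "Q \<noteq> 0" "\<forall>s\<in>{0<..<\<epsilon>}. bieval Q s (u s) = 0" and cont: "continuous_on {0<..<\<epsilon>} u"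
    using assms unfolding algebraic_on_def by auto
  obtain k R where R: "Q = monom 1 k * R" "coeff R 0 \<noteq> 0"
    using poly_factor_monom[OF Q(1)] by blast
  obtain \<delta>' where \<delta>': "\<delta>' > 0" "\<forall>s\<in>{0<..<\<delta>'}. poly (coeff R 0) s \<noteq> 0"
    using poly_nonzero_near_0[OF R(2)] by blast
  define \<delta> where "\<delta> = min \<delta>' \<epsilon>"
  define S where "S = {0<..<\<delta>}"
  have \<delta>: "0 < \<delta>" "\<delta> \<le> \<epsilon>" "\<delta> \<le> \<delta>'" using \<delta>' assms by (auto simp: \<delta>_def)
  have conS: "connected S" by (simp add: S_def)
  have contS: "continuous_on S u" using cont \<delta> by (auto simp: S_def intro: continuous_on_subset)
  define g where "g = (\<lambda>s. bieval R s (u s))"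
  have contg: "continuous_on S g" unfolding g_def by (intro continuous_intros contS)
  let ?A = "{s\<in>S. u s = 0}" and ?B = "{s\<in>S. g s = 0}"
  have cl: "closedin (top_of_set S) ?A" "closedin (top_of_set S) ?B"
    using contS contg by (auto intro: continuous_closedin_preimage_constant)
  have cov: "S \<subseteq> ?A \<union> ?B" using Q(2) R(1) \<delta> by (auto simp: S_def g_def)
  have dis: "?A \<inter> ?B = {}" using \<delta>' \<delta> by (auto simp: S_def g_def bieval_at_0)
  have "?A = {} \<or> ?B = {}"
    using conS[unfolded connected_closedin] cl cov dis by blast
  then show ?thesis
  proof
    assume "?B = {}"
    then have "\<forall>s\<in>{0<..<\<delta>}. sgn (u s) = 0" using cov by (auto simp: S_def)
    then show ?thesis using \<delta> by blast
  next
    assume A: "?A = {}"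
    have "connected (u ` S)" using contS conS by (rule connected_continuous_image)
    then have "\<not> (u x < 0 \<and> u y > 0)" if "x \<in> S" "y \<in> S" for x y
      using A that connectedD_interval[of "u ` S" "u x" "u y" 0] by auto
    then have "(\<forall>s\<in>S. u s > 0) \<or> (\<forall>s\<in>S. u s < 0)"
      using A by (metis (mono_tags, lifting) empty_Collect_eq linorder_less_linear)
    then have "\<exists>v. \<forall>s\<in>{0<..<\<delta>}. sgn (u s) = v"
      unfolding S_def by (auto intro: exI[of _ 1] exI[of _ "-1"])
    then show ?thesis using \<delta> by blast
  qed
qed

text \<open>The equations of the coordinates, brought to a common leading coefficient and a common
  degree, are of the form that \<open>elimination\<close> requires.\<close>

lemma algebraic_on_polynomial:
  fixes w :: "real \<Rightarrow> 'a::euclidean_space"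
  assumes "0 < \<epsilon>" and w: "\<And>b. b \<in> Basis \<Longrightarrow> algebraic_on \<epsilon> (\<lambda>s. w s \<bullet> b)"
    and p: "real_polynomial_function p"
  shows "\<exists>\<delta>. 0 < \<delta> \<and> \<delta> \<le> \<epsilon> \<and> algebraic_on \<delta> (\<lambda>s. p (s, w s))"
proof -
  have "\<forall>b\<in>Basis. \<exists>Q. Q \<noteq> 0 \<and> (\<forall>s\<in>{0<..<\<epsilon>}. bieval Q s (w s \<bullet> b) = 0)"
    using w unfolding algebraic_on_def by blast
  then obtain Q where Q: "\<And>b. b \<in> Basis \<Longrightarrow> Q b \<noteq> 0"
    "\<And>b s. b \<in> Basis \<Longrightarrow> s \<in> {0<..<\<epsilon>} \<Longrightarrow> bieval (Q b) s (w s \<bullet> b) = 0"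
    by metis
  define a where "a = (\<Prod>b\<in>Basis. lead_coeff (Q b))"
  have "a \<noteq> 0" using Q(1) by (simp add: a_def)
  then obtain \<delta>' where \<delta>': "\<delta>' > 0" "\<forall>s\<in>{0<..<\<delta>'}. poly a s \<noteq> 0"
    using poly_nonzero_near_0 by blast
  define \<delta> where "\<delta> = min \<delta>' \<epsilon>"
  have \<delta>: "0 < \<delta>" "\<delta> \<le> \<epsilon>" "\<delta> \<le> \<delta>'" using \<delta>' assms by (auto simp: \<delta>_def)
  \<comment> \<open>One exponent above all degrees serves every coordinate: multiplying the equation
    of \<open>z b\<close> by a power of \<open>z b\<close> and by the other leading coefficients
    gives \<open>a * z b ^ d = r b\<close>.\<close>
  define d where "d = Suc (\<Sum>b\<in>Basis. degree (Q b))"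
  \<comment> \<open>\<open>elimination\<close> asks for its equations at every index, so indices
    outside the interval are sent to its midpoint.\<close>
  define s where "s = (\<lambda>x. if x \<in> {0<..<\<delta>} then x else \<delta> / 2)"
  have s: "s x \<in> {0<..<\<delta>}" for x using \<delta> by (simp add: s_def)
  define z where "z = (\<lambda>b x. w (s x) \<bullet> b)"
  define r where "r = (\<lambda>b x. poly (\<Prod>c\<in>Basis - {b}. lead_coeff (Q c)) (s x) *
      (\<Sum>j<degree (Q b). poly (- coeff (Q b) j) (s x) * z b x ^ (j + d - degree (Q b))))"
  have dQ: "degree (Q b) < d" if "b \<in> Basis" for b
    unfolding d_def less_Suc_eq_le by (rule member_le_sum[OF that]) auto
  have eq: "poly a (s x) * z b x ^ d = r b x" if b: "b \<in> Basis" for b x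
  proof -
    let ?D = "degree (Q b)"
    have "0 = bieval (Q b) (s x) (z b x)" using Q(2)[OF b, of "s x"] s[of x] \<delta> by (simp add: z_def)
    also have "\<dots> = (\<Sum>j<Suc ?D. poly (coeff (Q b) j) (s x) * z b x ^ j)"
      by (simp only: bieval_altdef lessThan_Suc_atMost)
    finally have lead: "poly (lead_coeff (Q b)) (s x) * z b x ^ ?D
      = (\<Sum>j<?D. poly (- coeff (Q b) j) (s x) * z b x ^ j)"
      by (simp add: sum_negf)
    have expo: "z b x ^ j * z b x ^ (d - ?D) = z b x ^ (j + d - ?D)" for j
      using dQ[OF b] by (subst power_add[symmetric]) simp
    have "poly a (s x) = poly (\<Prod>c\<in>Basis - {b}. lead_coeff (Q c)) (s x) * poly (lead_coeff (Q b)) (s x)"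
      using b by (simp add: a_def prod.remove[of Basis b])
    moreover have "z b x ^ d = z b x ^ ?D * z b x ^ (d - ?D)"
      using expo[of ?D] by simp
    ultimately have "poly a (s x) * z b x ^ d = poly (\<Prod>c\<in>Basis - {b}. lead_coeff (Q c)) (s x) *
        (poly (lead_coeff (Q b)) (s x) * z b x ^ ?D * z b x ^ (d - ?D))"
      by (simp only: mult.assoc)
    also have "poly (lead_coeff (Q b)) (s x) * z b x ^ ?D * z b x ^ (d - ?D)
      = (\<Sum>j<?D. poly (- coeff (Q b) j) (s x) * z b x ^ (j + d - ?D))"
      unfolding lead sum_distrib_right by (simp only: mult.assoc expo)
    finally show ?thesis unfolding r_def .
  qed
  have "\<exists>e. r b \<in> polys s z Basis e (d - 1)" if b: "b \<in> Basis" for b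
  proof -
    have "\<exists>k. (\<lambda>x. poly (- coeff (Q b) j) (s x) * z b x ^ (j + d - degree (Q b))) \<in> polys s z Basis k (d - 1)"
      if "j \<in> {..<degree (Q b)}" for j
    proof -
      obtain k where k: "(\<lambda>x. poly (- coeff (Q b) j) (s x)) \<in> polys s z Basis k 0"
        using polys_poly by blast
      have "(\<lambda>x. z b x ^ (j + d - degree (Q b))) \<in> polys s z Basis 0 (j + d - degree (Q b))"
        using b by (intro polys_coord_power) auto
      from polys_mult[OF k this]
      have "(\<lambda>x. poly (- coeff (Q b) j) (s x) * z b x ^ (j + d - degree (Q b)))
          \<in> polys s z Basis k (j + d - degree (Q b))"
        unfolding times_fun_def by simp
      moreover have "j + d - degree (Q b) \<le> d - 1" using that dQ[OF b] by auto
      ultimately show ?thesis using polys_mono[OF order_refl] by blast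
    qed
    then obtain k where k: "(\<lambda>x. \<Sum>j<degree (Q b). poly (- coeff (Q b) j) (s x) * z b x ^ (j + d - degree (Q b))) \<in> polys s z Basis k (d - 1)"
      using polys_sum[OF finite_lessThan, of "degree (Q b)" "\<lambda>j x. poly (- coeff (Q b) j) (s x) * z b x ^ (j + d - degree (Q b))"] by blast
    obtain k' where k': "(\<lambda>x. poly (\<Prod>c\<in>Basis - {b}. lead_coeff (Q c)) (s x)) \<in> polys s z Basis k' 0"
      using polys_poly by blast
    from polys_mult[OF k' k] show ?thesis unfolding r_def times_fun_def by auto
  qed
  then obtain e' where e': "\<And>b. b \<in> Basis \<Longrightarrow> r b \<in> polys s z Basis (e' b) (d - 1)" by metis
  define e where "e = Max (e' ` Basis)"
  have e: "r b \<in> polys s z Basis e (d - 1)" if "b \<in> Basis" for b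
    using e'[OF that] polys_mono[of "e' b" e "d - 1" "d - 1" s z Basis] that by (auto simp: e_def)
  obtain k N where "\<forall>s (Z :: real \<Rightarrow> 'a). (\<lambda>x. p (s x, Z x)) \<in> polys s (\<lambda>b x. Z x \<bullet> b) Basis k N"
    using polynomial_in_polys[OF p] by (elim exE)
  then have F: "(\<lambda>x. p (s x, w (s x))) \<in> polys s z Basis k N" unfolding z_def by (elim allE)
  obtain R where R: "R \<noteq> 0" "\<And>x. bieval R (s x) (p (s x, w (s x))) = 0"
  proof (rule elimination[OF finite_Basis _ e eq F])
    show "d - 1 < d" by (simp add: d_def)
    show "poly a (s x) \<noteq> 0" for x using \<delta>' \<delta> s[of x] by auto
  qed auto
  have "bieval R x (p (x, w x)) = 0" if "x \<in> {0<..<\<delta>}" for x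
    using R(2)[of x] that by (simp add: s_def)
  moreover have "continuous_on {0<..<\<delta>} (\<lambda>s. p (s, w s))"
  proof -
    have "continuous_on {0<..<\<epsilon>} w"
      using w unfolding algebraic_on_def by (subst continuous_on_componentwise) auto
    then have 1: "continuous_on {0<..<\<delta>} (\<lambda>s. (s, w s))"
      using \<delta> by (intro continuous_intros) (auto intro: continuous_on_subset)
    have 2: "continuous_on UNIV p"
      using p by (intro continuous_on_polymonial_function) (simp add: real_polynomial_function_eq)
    show ?thesis by (rule continuous_on_compose2[OF 2 1]) simp
  qed
  ultimately show ?thesis using R(1) \<delta> unfolding algebraic_on_def by blast
qed

section \<open>Continuous branches of the roots of a bivariate polynomial\<close>

lemma continuous_connected_zero:
  fixes f :: "'a::topological_space \<Rightarrow> real"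
  assumes "connected S" "continuous_on S f" "x \<in> S" "y \<in> S" "f x \<le> 0" "0 \<le> f y"
  shows "\<exists>z\<in>S. f z = 0"
proof -
  have "connected (f ` S)" using assms by (intro connected_continuous_image)
  then have "0 \<in> f ` S"
    using assms connectedD_interval[of "f ` S" "f x" "f y" 0] by auto
  then show ?thesis by force
qed

lemma continuous_on_bieval_right: "continuous_on A (bieval Q s)"
  by (rule continuous_on_bieval[OF continuous_on_const continuous_on_id])

lemma bieval_rolle:
  assumes "a < b" "bieval Q s a = 0" "bieval Q s b = 0"
  shows "\<exists>c. a < c \<and> c < b \<and> bieval (pderiv Q) s c = 0"
proof -
  have "\<exists>c. a < c \<and> c < b \<and> bieval Q s b - bieval Q s a = (b - a) * bieval (pderiv Q) s c"
    using assms(1) by (intro MVT2) (auto intro: has_field_derivative_bieval)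
  then show ?thesis using assms by auto
qed

text \<open>By the mean value theorem the end values are multiples, of opposite sign, of the
  derivative at two interior points, and the derivative has the same sign at both since it has no
  zero between them.\<close>

lemma bieval_sign_change:
  assumes "a < u" "u < b" "bieval Q s u = 0"
    and nz: "\<And>c. a < c \<Longrightarrow> c < b \<Longrightarrow> bieval (pderiv Q) s c \<noteq> 0"
  shows "bieval Q s a * bieval Q s b < 0"
proof -
  have "\<exists>c. a < c \<and> c < u \<and> bieval Q s u - bieval Q s a = (u - a) * bieval (pderiv Q) s c"
    using assms(1) by (intro MVT2) (auto intro: has_field_derivative_bieval)
  then obtain c where c: "a < c" "c < u" "bieval Q s a = - ((u - a) * bieval (pderiv Q) s c)"
    using assms(3) by auto
  have "\<exists>c. u < c \<and> c < b \<and> bieval Q s b - bieval Q s u = (b - u) * bieval (pderiv Q) s c"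
    using assms(2) by (intro MVT2) (auto intro: has_field_derivative_bieval)
  then obtain d where d: "u < d" "d < b" "bieval Q s b = (b - u) * bieval (pderiv Q) s d"
    using assms(3) by auto
  have "0 < bieval (pderiv Q) s c * bieval (pderiv Q) s d"
  proof (rule ccontr)
    assume *: "\<not> ?thesis"
    have "bieval (pderiv Q) s c \<noteq> 0" "bieval (pderiv Q) s d \<noteq> 0"
      using nz c d by auto
    then have "bieval (pderiv Q) s c < 0 \<and> 0 < bieval (pderiv Q) s d \<or>
        bieval (pderiv Q) s d < 0 \<and> 0 < bieval (pderiv Q) s c"
      using * by (auto simp: zero_less_mult_iff not_less mult_le_0_iff)
    then have "\<exists>v\<in>{c..d}. bieval (pderiv Q) s v = 0"
      using continuous_connected_zero[of "{c..d}" "bieval (pderiv Q) s" c d]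
        continuous_connected_zero[of "{c..d}" "bieval (pderiv Q) s" d c] c d
      by (auto simp: continuous_on_bieval_right)
    then show False using nz c d by force
  qed
  then have "0 < (u - a) * (b - u) * (bieval (pderiv Q) s c * bieval (pderiv Q) s d)"
    using assms by simp
  then show ?thesis by (simp add: c d algebra_simps)
qed

text \<open>The signs of \<open>Q\<close> slightly below and slightly above \<open>r s0\<close>
  persist for nearby \<open>s\<close>. This forces a root between these two heights, and uniqueness
  identifies it with \<open>r s\<close>.\<close>

lemma root_branch_aux:
  fixes \<sigma> \<tau> r :: "real \<Rightarrow> real"
  assumes S: "open S" and \<sigma>: "continuous_on S \<sigma>" and \<tau>: "continuous_on S \<tau>"
    and r: "\<And>s. s \<in> S \<Longrightarrow> \<sigma> s < r s \<and> r s < \<tau> s \<and> bieval Q s (r s) = 0"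
    and uniq: "\<And>s u. s \<in> S \<Longrightarrow> \<sigma> s < u \<Longrightarrow> u < \<tau> s \<Longrightarrow> bieval Q s u = 0 \<Longrightarrow> u = r s"
    and neg: "\<And>s. s \<in> S \<Longrightarrow> bieval Q s (\<sigma> s) < 0" and pos: "\<And>s. s \<in> S \<Longrightarrow> 0 < bieval Q s (\<tau> s)"
  shows "continuous_on S r"
proof -
  have lower: "bieval Q s u < 0" if "s \<in> S" "\<sigma> s < u" "u < r s" for s u
  proof (rule ccontr)
    assume "\<not> ?thesis"
    moreover have "bieval Q s u \<noteq> 0" using uniq[of s u] r[of s] that by auto
    ultimately have "bieval Q s u > 0" by simp
    then have "\<exists>x. \<sigma> s \<le> x \<and> x \<le> u \<and> bieval Q s x = 0"
      using neg[OF that(1)] that by (intro IVT') (auto intro!: continuous_intros less_imp_le)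
    then obtain x where x: "\<sigma> s \<le> x" "x \<le> u" "bieval Q s x = 0" by auto
    have "x \<noteq> \<sigma> s" using neg[OF that(1)] x by auto
    then show False using uniq[of s x] x that r[of s] by auto
  qed
  have upper: "0 < bieval Q s u" if "s \<in> S" "r s < u" "u < \<tau> s" for s u
  proof (rule ccontr)
    assume "\<not> ?thesis"
    moreover have "bieval Q s u \<noteq> 0" using uniq[of s u] r[of s] that by auto
    ultimately have "bieval Q s u < 0" by simp
    then have "\<exists>x. u \<le> x \<and> x \<le> \<tau> s \<and> bieval Q s x = 0"
      using pos[OF that(1)] that by (intro IVT') (auto intro!: continuous_intros less_imp_le)
    then obtain x where x: "u \<le> x" "x \<le> \<tau> s" "bieval Q s x = 0" by auto
    have "x \<noteq> \<tau> s" using pos[OF that(1)] x by auto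
    then show False using uniq[of s x] x that r[of s] by auto
  qed
  have "continuous (at s0) r" if s0: "s0 \<in> S" for s0
    unfolding continuous_at tendsto_iff dist_real_def
  proof (intro allI impI)
    fix e :: real assume "0 < e"
    define d where "d = min (e / 2) (min ((r s0 - \<sigma> s0) / 2) ((\<tau> s0 - r s0) / 2))"
    have d: "0 < d" "d < e" "\<sigma> s0 < r s0 - d" "r s0 + d < \<tau> s0"
      using \<open>0 < e\<close> r[OF s0] by (auto simp: d_def min_def field_simps)
    have ev: "\<forall>\<^sub>F s in at s0. s \<in> S" using S s0 by (rule eventually_at_in_open')
    have tend: "(\<sigma> \<longlongrightarrow> \<sigma> s0) (at s0)" "(\<tau> \<longlongrightarrow> \<tau> s0) (at s0)"
      using \<sigma> \<tau> S s0 by (auto simp: continuous_on_eq_continuous_at continuous_at)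
    have "((\<lambda>s. bieval Q s c) \<longlongrightarrow> bieval Q s0 c) (at s0)" for c
    proof -
      have "continuous_on UNIV (\<lambda>s. bieval Q s c)" by (intro continuous_intros)
      then show ?thesis by (simp add: continuous_on_eq_continuous_at continuous_at)
    qed
    then have "\<forall>\<^sub>F s in at s0. bieval Q s (r s0 - d) < 0" "\<forall>\<^sub>F s in at s0. 0 < bieval Q s (r s0 + d)"
      using lower[OF s0, of "r s0 - d"] upper[OF s0, of "r s0 + d"] d
      by (intro order_tendstoD(2) order_tendstoD(1); simp)+
    moreover have "\<forall>\<^sub>F s in at s0. \<sigma> s < r s0 - d" "\<forall>\<^sub>F s in at s0. r s0 + d < \<tau> s"
      using order_tendstoD(2)[OF tend(1) d(3)] order_tendstoD(1)[OF tend(2) d(4)] by auto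
    ultimately show "\<forall>\<^sub>F s in at s0. \<bar>r s - r s0\<bar> < e"
      using ev
    proof eventually_elim
      case (elim s)
      then have "\<exists>x. r s0 - d \<le> x \<and> x \<le> r s0 + d \<and> bieval Q s x = 0"
        using d by (intro IVT') (auto intro!: continuous_intros less_imp_le)
      then obtain x where x: "r s0 - d \<le> x" "x \<le> r s0 + d" "bieval Q s x = 0" by auto
      then have "x = r s" using uniq[of s x] elim by auto
      then show ?case using x d by auto
    qed
  qed
  then show ?thesis by (simp add: continuous_at_imp_continuous_on)
qed

text \<open>The sign change gives a root, and Rolle's theorem makes it unique. The sign of
  \<open>Q\<close> along \<open>\<sigma>\<close> is constant by connectedness, so the continuity
  argument applies to \<open>Q\<close> or to \<open>- Q\<close>.\<close>

lemma root_branch: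
  fixes \<sigma> \<tau> :: "real \<Rightarrow> real"
  assumes \<sigma>: "continuous_on {0<..<\<delta>} \<sigma>" and \<tau>: "continuous_on {0<..<\<delta>} \<tau>"
    and less: "\<And>s. s \<in> {0<..<\<delta>} \<Longrightarrow> \<sigma> s < \<tau> s"
    and change: "\<And>s. s \<in> {0<..<\<delta>} \<Longrightarrow> bieval Q s (\<sigma> s) * bieval Q s (\<tau> s) < 0"
    and nz: "\<And>s c. s \<in> {0<..<\<delta>} \<Longrightarrow> \<sigma> s < c \<Longrightarrow> c < \<tau> s \<Longrightarrow> bieval (pderiv Q) s c \<noteq> 0"
  obtains r where "continuous_on {0<..<\<delta>} r"
    "\<And>s. s \<in> {0<..<\<delta>} \<Longrightarrow> \<sigma> s < r s \<and> r s < \<tau> s \<and> bieval Q s (r s) = 0"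
    "\<And>s u. s \<in> {0<..<\<delta>} \<Longrightarrow> \<sigma> s < u \<Longrightarrow> u < \<tau> s \<Longrightarrow> bieval Q s u = 0 \<Longrightarrow> u = r s"
proof -
  let ?S = "{0<..<\<delta>}"
  have uniq: "u = v" if uv: "s \<in> ?S" "\<sigma> s < u" "u < \<tau> s" "bieval Q s u = 0" "\<sigma> s < v" "v < \<tau> s" "bieval Q s v = 0" for s u v
  proof (rule ccontr)
    assume "u \<noteq> v"
    then consider "u < v" | "v < u" by linarith
    then show False
    proof cases
      case 1
      then obtain c where "u < c" "c < v" "bieval (pderiv Q) s c = 0" using bieval_rolle uv by blast
      then show ?thesis using nz[OF uv(1), of c] uv by simp
    next
      case 2
      then obtain c where "v < c" "c < u" "bieval (pderiv Q) s c = 0" using bieval_rolle uv by blast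
      then show ?thesis using nz[OF uv(1), of c] uv by simp
    qed
  qed
  have "\<exists>u. \<sigma> s < u \<and> u < \<tau> s \<and> bieval Q s u = 0" if s: "s \<in> ?S" for s
  proof -
    have "bieval Q s (\<sigma> s) < 0 \<and> 0 < bieval Q s (\<tau> s) \<or> bieval Q s (\<tau> s) < 0 \<and> 0 < bieval Q s (\<sigma> s)"
      using change[OF s] by (auto simp: mult_less_0_iff)
    then have "\<exists>u\<in>{\<sigma> s..\<tau> s}. bieval Q s u = 0"
      using continuous_connected_zero[of "{\<sigma> s..\<tau> s}" "bieval Q s" "\<sigma> s" "\<tau> s"]
        continuous_connected_zero[of "{\<sigma> s..\<tau> s}" "bieval Q s" "\<tau> s" "\<sigma> s"] less[OF s]
      by (auto simp: continuous_on_bieval_right)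
    then obtain u where "\<sigma> s \<le> u" "u \<le> \<tau> s" "bieval Q s u = 0" by auto
    moreover have "u \<noteq> \<sigma> s" "u \<noteq> \<tau> s" using change[OF s] calculation by auto
    ultimately show ?thesis by force
  qed
  then obtain r where r: "\<And>s. s \<in> ?S \<Longrightarrow> \<sigma> s < r s \<and> r s < \<tau> s \<and> bieval Q s (r s) = 0"
    by metis
  have uniq': "u = r s" if "s \<in> ?S" "\<sigma> s < u" "u < \<tau> s" "bieval Q s u = 0" for s u
    using uniq[of s u "r s"] that r[of s] by auto
  have sgn\<sigma>: "(\<forall>s\<in>?S. bieval Q s (\<sigma> s) < 0) \<or> (\<forall>s\<in>?S. 0 < bieval Q s (\<sigma> s))"
  proof (rule ccontr)
    assume "\<not> ?thesis"
    then obtain s t where st: "s \<in> ?S" "t \<in> ?S" "bieval Q s (\<sigma> s) \<ge> 0" "bieval Q t (\<sigma> t) \<le> 0"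
      by (auto simp: not_less)
    have "\<exists>s\<in>?S. bieval Q s (\<sigma> s) = 0"
      using \<sigma> st by (intro continuous_connected_zero[of ?S _ t s] continuous_intros) auto
    then show False using change by force
  qed
  have "continuous_on ?S r"
    using sgn\<sigma>
  proof
    assume neg: "\<forall>s\<in>?S. bieval Q s (\<sigma> s) < 0"
    then have "\<forall>s\<in>?S. 0 < bieval Q s (\<tau> s)"
      using change by (meson mult_less_0_iff not_less_iff_gr_or_eq)
    with neg show ?thesis
      by (intro root_branch_aux[OF _ \<sigma> \<tau> r uniq']) auto
  next
    assume pos: "\<forall>s\<in>?S. 0 < bieval Q s (\<sigma> s)"
    then have "\<forall>s\<in>?S. bieval Q s (\<tau> s) < 0"
      using change by (meson mult_less_0_iff not_less_iff_gr_or_eq)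
    with pos show ?thesis
      by (intro root_branch_aux[OF _ \<sigma> \<tau>, of r "- Q"]) (auto simp: r uniq')
  qed
  show ?thesis by (rule that[OF \<open>continuous_on ?S r\<close> r uniq'])
qed

text \<open>Induction on the degree in \<open>u\<close>. The branches of \<open>pderiv Q\<close> and
  the lines \<open>u = B\<close> and \<open>u = - B\<close> cut the strip into gaps, and in each gap
  a root is unique. For small \<open>s\<close> neither the order of these curves nor the signs of
  \<open>Q\<close> along them change, so the gaps that contain a root are the same for all
  \<open>s\<close>.\<close>

lemma algebraic_branches:
  assumes "Q \<noteq> 0" "0 < B"
  shows "\<exists>\<epsilon>>0. \<exists>\<Phi>. finite \<Phi> \<and>
    (\<forall>\<rho>\<in>\<Phi>. continuous_on {0<..<\<epsilon>} \<rho> \<and> (\<forall>s\<in>{0<..<\<epsilon>}. bieval Q s (\<rho> s) = 0)) \<and>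
    (\<forall>s\<in>{0<..<\<epsilon>}. \<forall>u. \<bar>u\<bar> \<le> B \<longrightarrow> bieval Q s u = 0 \<longrightarrow> (\<exists>\<rho>\<in>\<Phi>. u = \<rho> s))"
  using assms(1)
proof (induction "degree Q" arbitrary: Q)
  case 0
  then obtain a where a: "Q = [:a:]" "a \<noteq> 0" by (metis degree_eq_zeroE pCons_0_0)
  obtain \<epsilon> where "\<epsilon> > 0" "\<forall>s\<in>{0<..<\<epsilon>}. poly a s \<noteq> 0" using poly_nonzero_near_0[OF a(2)] by blast
  then show ?case using a by (intro exI[of _ \<epsilon>]) auto
next
  case (Suc n)
  have "degree (pderiv Q) = n" "pderiv Q \<noteq> 0"
    using Suc.hyps(2) by (auto simp: degree_pderiv pderiv_eq_0_iff)
  from Suc.hyps(1)[OF this(1)[symmetric] this(2)] obtain \<epsilon> \<Phi> where \<epsilon>: "\<epsilon> > 0" and fin: "finite \<Phi>"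
    and zeros: "\<forall>\<rho>\<in>\<Phi>. continuous_on {0<..<\<epsilon>} \<rho> \<and> (\<forall>s\<in>{0<..<\<epsilon>}. bieval (pderiv Q) s (\<rho> s) = 0)"
    and cover: "\<forall>s\<in>{0<..<\<epsilon>}. \<forall>u. \<bar>u\<bar> \<le> B \<longrightarrow> bieval (pderiv Q) s u = 0 \<longrightarrow> (\<exists>\<rho>\<in>\<Phi>. u = \<rho> s)"
    by (elim exE conjE)
  have \<Phi>: "\<And>\<rho>. \<rho> \<in> \<Phi> \<Longrightarrow> continuous_on {0<..<\<epsilon>} \<rho>"
      "\<And>\<rho> s. \<rho> \<in> \<Phi> \<Longrightarrow> s \<in> {0<..<\<epsilon>} \<Longrightarrow> bieval (pderiv Q) s (\<rho> s) = 0"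
      "\<And>s u. s \<in> {0<..<\<epsilon>} \<Longrightarrow> \<bar>u\<bar> \<le> B \<Longrightarrow> bieval (pderiv Q) s u = 0 \<Longrightarrow> \<exists>\<rho>\<in>\<Phi>. u = \<rho> s"
    using zeros cover by simp_all
  define \<Psi> where "\<Psi> = insert (\<lambda>_. B) (insert (\<lambda>_. - B) \<Phi>)"
  have fin\<Psi>: "finite \<Psi>" using fin by (simp add: \<Psi>_def)
  have alg: "algebraic_on \<epsilon> \<rho>" if "\<rho> \<in> \<Psi>" for \<rho>
    using that \<Phi>(1,2) \<open>pderiv Q \<noteq> 0\<close> algebraic_on_const unfolding \<Psi>_def algebraic_on_def by blast
  let ?const = "\<lambda>u \<delta>. \<delta> \<le> \<epsilon> \<and> (\<exists>v. \<forall>s\<in>{0<..<\<delta>}. sgn (u s :: real) = v)"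
  have const_mono: "?const u \<delta>'" if u: "?const u \<delta>" "0 < \<delta>'" "\<delta>' \<le> \<delta>" for u \<delta> \<delta>'
  proof -
    obtain v where "\<forall>s\<in>{0<..<\<delta>}. sgn (u s) = v" using u by blast
    then have "\<forall>s\<in>{0<..<\<delta>'}. sgn (u s) = v" using u by auto
    then show ?thesis using u by auto
  qed
  have "\<exists>\<delta>>0. \<forall>p\<in>\<Psi> \<times> \<Psi>. ?const (\<lambda>s. fst p s - snd p s) \<delta>"
  proof (rule finite_common_threshold)
    fix p assume p: "p \<in> \<Psi> \<times> \<Psi>"
    have "\<exists>\<delta>. 0 < \<delta> \<and> \<delta> \<le> \<epsilon> \<and> algebraic_on \<delta> (\<lambda>s. (\<lambda>(s, y). fst y - snd y) (s, (fst p s, snd p s)))"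
    proof (rule algebraic_on_polynomial[OF \<epsilon>])
      show "algebraic_on \<epsilon> (\<lambda>s. (fst p s, snd p s) \<bullet> b)" if "b \<in> Basis" for b :: "real \<times> real"
        using p alg that by (auto simp: Basis_prod_def)
      have "real_polynomial_function (\<lambda>x::real \<times> real \<times> real. fst (snd x) - snd (snd x))"
        by (intro real_polynomial_function_diff real_polynomial_function.intros(1) bounded_linear_intros)
      then show "real_polynomial_function (\<lambda>(s::real, y::real \<times> real). fst y - snd y)"
        by (simp add: case_prod_unfold)
    qed
    then obtain \<delta> where \<delta>: "0 < \<delta>" "\<delta> \<le> \<epsilon>" "algebraic_on \<delta> (\<lambda>s. fst p s - snd p s)" by auto
    then show "\<exists>\<delta>>0. ?const (\<lambda>s. fst p s - snd p s) \<delta>"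
      using algebraic_on_sign[OF \<delta>(3,1)] by (meson order_trans)
  qed (simp add: fin\<Psi>, (rule const_mono; assumption))
  then obtain \<delta>1 where \<delta>1: "\<delta>1 > 0" "\<And>\<sigma> \<tau>. \<sigma> \<in> \<Psi> \<Longrightarrow> \<tau> \<in> \<Psi> \<Longrightarrow> ?const (\<lambda>s. \<sigma> s - \<tau> s) \<delta>1" by auto
  have "\<exists>\<delta>>0. \<forall>\<sigma>\<in>\<Psi>. ?const (\<lambda>s. bieval Q s (\<sigma> s)) \<delta>"
  proof (rule finite_common_threshold)
    fix \<sigma> assume p: "\<sigma> \<in> \<Psi>"
    have "\<exists>\<delta>. 0 < \<delta> \<and> \<delta> \<le> \<epsilon> \<and> algebraic_on \<delta> (\<lambda>s. (\<lambda>y. bieval Q (fst y) (snd y)) (s, \<sigma> s))"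
    proof (rule algebraic_on_polynomial[OF \<epsilon>])
      show "algebraic_on \<epsilon> (\<lambda>s. \<sigma> s \<bullet> b)" if "b \<in> Basis" for b
        using p alg that by auto
      show "real_polynomial_function (\<lambda>y. bieval Q (fst y) (snd y))"
        unfolding bieval_altdef poly_altdef
        by (intro real_polynomial_function_sum real_polynomial_function.intros(4) real_polynomial_function_power
           real_polynomial_function.intros(2) real_polynomial_function.intros(1) bounded_linear_intros) auto
    qed
    then obtain \<delta> where \<delta>: "0 < \<delta>" "\<delta> \<le> \<epsilon>" "algebraic_on \<delta> (\<lambda>s. bieval Q s (\<sigma> s))" by auto
    then show "\<exists>\<delta>>0. ?const (\<lambda>s. bieval Q s (\<sigma> s)) \<delta>"
      using algebraic_on_sign[OF \<delta>(3,1)] by (meson order_trans)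
  qed (simp add: fin\<Psi>, (rule const_mono; assumption))
  then obtain \<delta>2 where \<delta>2: "\<delta>2 > 0" "\<And>\<sigma>. \<sigma> \<in> \<Psi> \<Longrightarrow> ?const (\<lambda>s. bieval Q s (\<sigma> s)) \<delta>2" by auto
  define \<delta> where "\<delta> = min \<delta>1 \<delta>2"
  have "(\<lambda>_. B) \<in> \<Psi>" by (simp add: \<Psi>_def)
  then have "\<delta>2 \<le> \<epsilon>" using \<delta>2(2) by blast
  then have \<delta>: "\<delta> > 0" "\<delta> \<le> \<epsilon>" using \<delta>1(1) \<delta>2(1) by (auto simp: \<delta>_def)
  have less_iff: "\<sigma> s < \<tau> s \<longleftrightarrow> \<sigma> t < \<tau> t"
    if "\<sigma> \<in> \<Psi>" "\<tau> \<in> \<Psi>" "s \<in> {0<..<\<delta>}" "t \<in> {0<..<\<delta>}" for \<sigma> \<tau> s t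
  proof -
    have "sgn (\<sigma> s - \<tau> s) = sgn (\<sigma> t - \<tau> t)"
      using \<delta>1(2)[OF that(1,2)] that by (auto simp: \<delta>_def)
    then show ?thesis by (auto simp: sgn_if split: if_splits)
  qed
  have sgn_eq: "sgn (bieval Q s (\<sigma> s)) = sgn (bieval Q t (\<sigma> t))"
    if "\<sigma> \<in> \<Psi>" "s \<in> {0<..<\<delta>}" "t \<in> {0<..<\<delta>}" for \<sigma> s t
    using \<delta>2(2)[OF that(1)] that by (auto simp: \<delta>_def)
  \<comment> \<open>Neighbouring curves between which \<open>Q\<close> changes sign. By
    \<open>good_iff\<close> this does not depend on \<open>s\<close>, so it may be tested at the
    single point \<open>s0\<close>.\<close>
  define good where "good = (\<lambda>\<sigma> \<tau> s. \<sigma> s < \<tau> s \<and> - B \<le> \<sigma> s \<and> \<tau> s \<le> B \<and>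
      bieval Q s (\<sigma> s) * bieval Q s (\<tau> s) < 0 \<and> (\<forall>\<rho>\<in>\<Psi>. \<not> (\<sigma> s < \<rho> s \<and> \<rho> s < \<tau> s)))"
  have good_iff: "good \<sigma> \<tau> s \<longleftrightarrow> good \<sigma> \<tau> t"
    if "\<sigma> \<in> \<Psi>" "\<tau> \<in> \<Psi>" "s \<in> {0<..<\<delta>}" "t \<in> {0<..<\<delta>}" for \<sigma> \<tau> s t
  proof -
    have "(\<lambda>_. B) \<in> \<Psi>" "(\<lambda>_. - B) \<in> \<Psi>" by (auto simp: \<Psi>_def)
    then have "- B \<le> \<sigma> s \<longleftrightarrow> - B \<le> \<sigma> t" "\<tau> s \<le> B \<longleftrightarrow> \<tau> t \<le> B"
      using less_iff[OF that(1), of "\<lambda>_. - B" s t] less_iff[of "\<lambda>_. B" \<tau> s t] that by (auto simp flip: not_less)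
    moreover have "\<sigma> s < \<tau> s \<longleftrightarrow> \<sigma> t < \<tau> t" using less_iff that by blast
    moreover have "(\<forall>\<rho>\<in>\<Psi>. \<not> (\<sigma> s < \<rho> s \<and> \<rho> s < \<tau> s)) \<longleftrightarrow> (\<forall>\<rho>\<in>\<Psi>. \<not> (\<sigma> t < \<rho> t \<and> \<rho> t < \<tau> t))"
      using less_iff that by blast
    moreover have "bieval Q s (\<sigma> s) * bieval Q s (\<tau> s) < 0 \<longleftrightarrow> bieval Q t (\<sigma> t) * bieval Q t (\<tau> t) < 0"
    proof -
      have "sgn (bieval Q s (\<sigma> s) * bieval Q s (\<tau> s)) = sgn (bieval Q t (\<sigma> t) * bieval Q t (\<tau> t))"
        using sgn_eq[OF that(1) that(3,4)] sgn_eq[OF that(2) that(3,4)] by (simp add: sgn_mult)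
      then show ?thesis by (metis sgn_less)
    qed
    ultimately show ?thesis unfolding good_def by simp
  qed
  define s0 where "s0 = \<delta> / 2"
  have s0: "s0 \<in> {0<..<\<delta>}" using \<delta> by (simp add: s0_def)
  have cont: "continuous_on {0<..<\<delta>} \<sigma>" if "\<sigma> \<in> \<Psi>" for \<sigma>
    using algebraic_on_mono[OF alg[OF that] \<delta>(2)] by (simp add: algebraic_on_def)
  define branch where "branch = (\<lambda>\<sigma> \<tau> r. continuous_on {0<..<\<delta>} r \<and> (\<forall>s\<in>{0<..<\<delta>}. bieval Q s (r s) = 0) \<and>
      (\<forall>s\<in>{0<..<\<delta>}. \<forall>u. \<sigma> s < u \<longrightarrow> u < \<tau> s \<longrightarrow> bieval Q s u = 0 \<longrightarrow> u = r s))"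
  have "\<exists>r. branch \<sigma> \<tau> r"
    if \<sigma>\<tau>: "\<sigma> \<in> \<Psi>" "\<tau> \<in> \<Psi>" "good \<sigma> \<tau> s0" for \<sigma> \<tau>
  proof -
    have good: "good \<sigma> \<tau> s" if "s \<in> {0<..<\<delta>}" for s
      using good_iff[OF \<sigma>\<tau>(1,2) s0 that] \<sigma>\<tau>(3) by simp
    obtain r where "continuous_on {0<..<\<delta>} r"
      "\<And>s. s \<in> {0<..<\<delta>} \<Longrightarrow> \<sigma> s < r s \<and> r s < \<tau> s \<and> bieval Q s (r s) = 0"
      "\<And>s u. s \<in> {0<..<\<delta>} \<Longrightarrow> \<sigma> s < u \<Longrightarrow> u < \<tau> s \<Longrightarrow> bieval Q s u = 0 \<Longrightarrow> u = r s"
    proof (rule root_branch[OF cont[OF \<sigma>\<tau>(1)] cont[OF \<sigma>\<tau>(2)]])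
      show "\<sigma> s < \<tau> s" "bieval Q s (\<sigma> s) * bieval Q s (\<tau> s) < 0" if "s \<in> {0<..<\<delta>}" for s
        using good[OF that] by (auto simp: good_def)
      show "bieval (pderiv Q) s c \<noteq> 0" if c: "s \<in> {0<..<\<delta>}" "\<sigma> s < c" "c < \<tau> s" for s c
      proof
        assume 0: "bieval (pderiv Q) s c = 0"
        have "\<bar>c\<bar> \<le> B" "s \<in> {0<..<\<epsilon>}"
          using good[OF c(1)] c \<delta> by (auto simp: good_def)
        then obtain \<rho> where "\<rho> \<in> \<Phi>" "c = \<rho> s"
          using \<Phi>(3) 0 by blast
        then show False using good[OF c(1)] c by (auto simp: good_def \<Psi>_def)
      qed
    qed blast
    then show ?thesis unfolding branch_def by (intro exI[of _ r]) auto
  qed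
  then obtain r where "\<And>\<sigma> \<tau>. \<sigma> \<in> \<Psi> \<Longrightarrow> \<tau> \<in> \<Psi> \<Longrightarrow> good \<sigma> \<tau> s0 \<Longrightarrow> branch \<sigma> \<tau> (r \<sigma> \<tau>)"
    by metis
  note r = this[unfolded branch_def]
  \<comment> \<open>A root either lies on a cutting curve, along which \<open>Q\<close> then
    vanishes identically, or in the interior of a good gap.\<close>
  define \<Omega> where "\<Omega> = {\<sigma>\<in>\<Psi>. bieval Q s0 (\<sigma> s0) = 0} \<union>
    (\<lambda>p. r (fst p) (snd p)) ` {p\<in>\<Psi> \<times> \<Psi>. good (fst p) (snd p) s0}"
  have "finite \<Omega>" unfolding \<Omega>_def using fin\<Psi> by simp
  moreover have "continuous_on {0<..<\<delta>} \<rho> \<and> (\<forall>s\<in>{0<..<\<delta>}. bieval Q s (\<rho> s) = 0)" if "\<rho> \<in> \<Omega>" for \<rho>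
  proof -
    consider "\<rho> \<in> \<Psi>" "bieval Q s0 (\<rho> s0) = 0" | \<sigma> \<tau> where "\<sigma> \<in> \<Psi>" "\<tau> \<in> \<Psi>" "good \<sigma> \<tau> s0" "\<rho> = r \<sigma> \<tau>"
      using \<open>\<rho> \<in> \<Omega>\<close> unfolding \<Omega>_def by auto
    then show ?thesis
    proof cases
      case 1
      then have "sgn (bieval Q s (\<rho> s)) = 0" if "s \<in> {0<..<\<delta>}" for s
        using sgn_eq[OF 1(1) that s0] by simp
      then show ?thesis using cont[OF 1(1)] by (auto simp: sgn_zero_iff)
    next
      case 2
      then show ?thesis using r by blast
    qed
  qed
  moreover have "\<exists>\<rho>\<in>\<Omega>. u = \<rho> s" if s: "s \<in> {0<..<\<delta>}" and u: "\<bar>u\<bar> \<le> B" "bieval Q s u = 0" for s u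
  proof (cases "\<exists>\<sigma>\<in>\<Psi>. u = \<sigma> s")
    case True
    then obtain \<sigma> where \<sigma>: "\<sigma> \<in> \<Psi>" "u = \<sigma> s" by blast
    have "sgn (bieval Q s0 (\<sigma> s0)) = 0" using sgn_eq[OF \<sigma>(1) s0 s] u \<sigma> by simp
    then have "\<sigma> \<in> \<Omega>" using \<sigma> by (simp add: \<Omega>_def sgn_zero_iff)
    then show ?thesis using \<sigma> by blast
  next
    case False
    let ?L = "{\<sigma>\<in>\<Psi>. \<sigma> s < u}" and ?U = "{\<sigma>\<in>\<Psi>. u < \<sigma> s}"
    have "u \<noteq> B" "u \<noteq> - B" using False by (auto simp: \<Psi>_def)
    then have "(\<lambda>_. - B) \<in> ?L" "(\<lambda>_. B) \<in> ?U" using u by (auto simp: \<Psi>_def)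
    then have LU: "?L \<noteq> {}" "?U \<noteq> {}" by blast+
    \<comment> \<open>The nearest curves below and above \<open>u\<close> bound the gap that
      contains \<open>u\<close>; the lines at \<open>B\<close> and \<open>- B\<close> guarantee that
      both exist.\<close>
    define \<sigma> where "\<sigma> = arg_min_on (\<lambda>\<sigma>. - \<sigma> s) ?L"
    define \<tau> where "\<tau> = arg_min_on (\<lambda>\<sigma>. \<sigma> s) ?U"
    have \<sigma>: "\<sigma> \<in> ?L" "\<And>\<rho>. \<rho> \<in> ?L \<Longrightarrow> \<rho> s \<le> \<sigma> s"
      using arg_min_if_finite[of ?L "\<lambda>\<sigma>. - \<sigma> s"] fin\<Psi> LU unfolding \<sigma>_def by (auto simp: not_less)
    have \<tau>: "\<tau> \<in> ?U" "\<And>\<rho>. \<rho> \<in> ?U \<Longrightarrow> \<tau> s \<le> \<rho> s"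
      using arg_min_if_finite[of ?U "\<lambda>\<sigma>. \<sigma> s"] fin\<Psi> LU unfolding \<tau>_def by (auto simp: not_less)
    have B: "- B \<le> \<sigma> s" "\<tau> s \<le> B"
      using \<sigma>(2) \<tau>(2) \<open>(\<lambda>_. - B) \<in> ?L\<close> \<open>(\<lambda>_. B) \<in> ?U\<close> by blast+
    have gap: "\<not> (\<sigma> s < \<rho> s \<and> \<rho> s < \<tau> s)" if "\<rho> \<in> \<Psi>" for \<rho>
    proof
      assume a: "\<sigma> s < \<rho> s \<and> \<rho> s < \<tau> s"
      have "\<rho> s \<noteq> u" using False that by blast
      then show False using \<sigma>(2)[of \<rho>] \<tau>(2)[of \<rho>] that a by force
    qed
    have "bieval Q s (\<sigma> s) * bieval Q s (\<tau> s) < 0"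
    proof (rule bieval_sign_change[of _ u])
      show "\<sigma> s < u" "u < \<tau> s" using \<sigma> \<tau> by auto
      show "bieval (pderiv Q) s c \<noteq> 0" if c: "\<sigma> s < c" "c < \<tau> s" for c
      proof
        assume 0: "bieval (pderiv Q) s c = 0"
        have "\<bar>c\<bar> \<le> B" "s \<in> {0<..<\<epsilon>}" using s \<delta> B c by auto
        then obtain \<rho> where "\<rho> \<in> \<Phi>" "c = \<rho> s"
          using \<Phi>(3) 0 by blast
        then show False using gap[of \<rho>] c by (auto simp: \<Psi>_def)
      qed
    qed (rule u)
    then have "good \<sigma> \<tau> s" using \<sigma> \<tau> B gap unfolding good_def by auto
    then have g: "good \<sigma> \<tau> s0" using good_iff[of \<sigma> \<tau> s s0] \<sigma>(1) \<tau>(1) s s0 by simp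
    have "u = r \<sigma> \<tau> s"
      using r[OF _ _ g] \<sigma>(1) \<tau>(1) s u(2) by simp
    moreover have "r \<sigma> \<tau> \<in> \<Omega>"
      unfolding \<Omega>_def using g \<sigma>(1) \<tau>(1) by (intro UnI2 image_eqI[of _ _ "(\<sigma>, \<tau>)"]) auto
    ultimately show ?thesis by blast
  qed
  ultimately show ?case using \<delta>(1) by (intro exI[of _ \<delta>] exI[of _ \<Omega>] conjI) simp_all
qed

text \<open>At a zero two of the monomials must be of comparable size, and this determines
  the exponent \<open>q\<close> up to finitely many choices.\<close>

lemma bieval_root_exponents:
  assumes "Q \<noteq> 0"
  shows "\<exists>E K. \<exists>\<epsilon>>0. finite (E :: real set) \<and>
    (\<forall>s\<in>{0<..<\<epsilon>}. \<forall>u>0. bieval Q s u = 0 \<longrightarrow> (\<exists>q\<in>E. \<bar>ln u - q * ln s\<bar> \<le> K))"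
proof -
  define c where "c = (\<lambda>p. coeff (coeff Q (fst p)) (snd p))"
  define J where "J = {p \<in> Sigma {..degree Q} (\<lambda>j. {..degree (coeff Q j)}). c p \<noteq> 0}"
  have finJ: "finite J" unfolding J_def by auto
  define T where "T = (\<lambda>s u p. c p * s ^ snd p * u ^ fst p)"
  have sumT: "bieval Q s u = (\<Sum>p\<in>J. T s u p)" for s u
  proof -
    have "bieval Q s u = (\<Sum>j\<le>degree Q. \<Sum>i\<le>degree (coeff Q j). T s u (j, i))"
      by (simp add: bieval_altdef poly_altdef T_def c_def sum_distrib_right)
    also have "\<dots> = (\<Sum>p\<in>Sigma {..degree Q} (\<lambda>j. {..degree (coeff Q j)}). T s u p)"
      by (subst sum.Sigma) auto
    also have "\<dots> = (\<Sum>p\<in>J. T s u p)"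
      by (intro sum.mono_neutral_right) (auto simp: J_def T_def)
    finally show ?thesis .
  qed
  have "(degree Q, degree (lead_coeff Q)) \<in> J"
    using assms by (auto simp: J_def c_def)
  then have J: "J \<noteq> {}" by blast
  define M where "M = (\<Sum>p\<in>J. \<bar>ln \<bar>c p\<bar>\<bar>)"
  have M: "\<bar>ln \<bar>c p\<bar>\<bar> \<le> M" if "p \<in> J" for p
    unfolding M_def using finJ that by (intro member_le_sum) auto
  \<comment> \<open>The largest monomial is at most \<open>card J\<close> times another one, and
    each of the two coefficients contributes at most \<open>M\<close> to the difference of the
    logarithms.\<close>
  define K where "K = ln (card J) + 2 * M"
  have cardJ: "1 \<le> real (card J)" using J finJ by (simp add: Suc_le_eq card_gt_0_iff)
  have "0 \<le> M" unfolding M_def by (intro sum_nonneg) auto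
  then have K: "0 \<le> K" using cardJ by (simp add: K_def)
  \<comment> \<open>Pairs with the same degree in \<open>u\<close> contribute 0 through division by
    zero; this merely enlarges the finite set \<open>E\<close>.\<close>
  define E where "E = (\<lambda>(p,p'). (real (snd p') - real (snd p)) / (real (fst p) - real (fst p'))) ` (J \<times> J)"
  \<comment> \<open>For smaller \<open>s\<close> one has \<open>ln s < - K - 1\<close>, so two
    comparable monomials cannot have the same degree in \<open>u\<close> and differ in the power of
    \<open>s\<close>.\<close>
  define \<epsilon> where "\<epsilon> = exp (- K - 1)"
  have "\<exists>q\<in>E. \<bar>ln u - q * ln s\<bar> \<le> K" if s: "0 < s" "s < \<epsilon>" and u: "0 < u" "bieval Q s u = 0" for s u
  proof -
    have Tnz: "T s u p \<noteq> 0" if "p \<in> J" for p using that s u by (auto simp: T_def J_def)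
    have lnT: "ln \<bar>T s u p\<bar> = ln \<bar>c p\<bar> + real (snd p) * ln s + real (fst p) * ln u" if "p \<in> J" for p
      using that s u by (auto simp: T_def J_def abs_mult ln_mult ln_realpow)
    define m where "m = Max ((\<lambda>p. \<bar>T s u p\<bar>) ` J)"
    have "m \<in> (\<lambda>p. \<bar>T s u p\<bar>) ` J" unfolding m_def using finJ J by (intro Max_in) auto
    then obtain p where p: "p \<in> J" "\<bar>T s u p\<bar> = m" by auto
    have max: "\<bar>T s u p'\<bar> \<le> \<bar>T s u p\<bar>" if "p' \<in> J" for p'
      unfolding p(2) m_def using finJ that by (intro Max_ge) auto
    \<comment> \<open>If every other monomial were smaller than the largest one divided by
      \<open>card J\<close>, their sum could not cancel it.\<close>
    have "\<exists>p'\<in>J - {p}. \<bar>T s u p\<bar> \<le> card J * \<bar>T s u p'\<bar>"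
    proof (rule ccontr)
      assume *: "\<not> ?thesis"
      have "\<bar>T s u p\<bar> = \<bar>\<Sum>p'\<in>J - {p}. T s u p'\<bar>"
        using u(2) finJ p(1) by (simp add: sumT sum.remove[of J p])
      also have "\<dots> \<le> (\<Sum>p'\<in>J - {p}. \<bar>T s u p'\<bar>)" by (rule sum_abs)
      also have "\<dots> \<le> (\<Sum>p'\<in>J - {p}. \<bar>T s u p\<bar> / card J)"
        using * cardJ by (intro sum_mono) (auto simp: field_simps not_le less_imp_le)
      also have "\<dots> = (real (card J) - 1) * (\<bar>T s u p\<bar> / card J)"
        using p(1) finJ cardJ by (simp add: of_nat_diff)
      also have "\<dots> < \<bar>T s u p\<bar>"
        using cardJ Tnz[OF p(1)] by (simp add: field_simps)
      finally show False by simp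
    qed
    then obtain p' where p': "p' \<in> J" "p' \<noteq> p" "\<bar>T s u p\<bar> \<le> card J * \<bar>T s u p'\<bar>" by auto
    have "ln \<bar>T s u p\<bar> \<le> ln (card J * \<bar>T s u p'\<bar>)"
      using p' Tnz[OF p(1)] by (subst ln_le_cancel_iff) auto
    also have "\<dots> = ln (card J) + ln \<bar>T s u p'\<bar>"
      using cardJ Tnz[OF p'(1)] by (subst ln_mult) auto
    finally have 1: "ln \<bar>T s u p\<bar> \<le> ln (card J) + ln \<bar>T s u p'\<bar>" .
    have 2: "ln \<bar>T s u p'\<bar> \<le> ln \<bar>T s u p\<bar>"
      using max[OF p'(1)] Tnz[OF p(1)] Tnz[OF p'(1)] by simp
    have "0 \<le> ln (card J)" using cardJ by simp
    then have le: "\<bar>(real (snd p) - real (snd p')) * ln s + (real (fst p) - real (fst p')) * ln u\<bar> \<le> K"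
      using 1 2 M[OF p(1)] M[OF p'(1)] unfolding lnT[OF p(1)] lnT[OF p'(1)] K_def
      by (auto simp: abs_le_iff algebra_simps)
    show ?thesis
    proof (cases "fst p = fst p'")
      case True
      then have "snd p \<noteq> snd p'" using p'(2) by (metis prod_eq_iff)
      then have "1 \<le> \<bar>real (snd p) - real (snd p')\<bar>" by auto
      then have "1 * \<bar>ln s\<bar> \<le> \<bar>real (snd p) - real (snd p')\<bar> * \<bar>ln s\<bar>" by (intro mult_right_mono) auto
      also have "\<dots> \<le> K" using le True by (simp add: abs_mult)
      finally have "\<bar>ln s\<bar> \<le> K" by simp
      moreover have "ln s < - K - 1" using s ln_less_cancel_iff[of s \<epsilon>] by (simp add: \<epsilon>_def)
      ultimately show ?thesis by linarith
    next
      case False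
      define a where "a = real (fst p) - real (fst p')"
      define q where "q = (real (snd p') - real (snd p)) / a"
      have a: "1 \<le> \<bar>a\<bar>" using False by (auto simp: a_def)
      then have "ln u - q * ln s = ((real (snd p) - real (snd p')) * ln s + a * ln u) / a"
        by (simp add: q_def field_simps)
      then have "\<bar>ln u - q * ln s\<bar> \<le> K / \<bar>a\<bar>"
        using le a by (simp add: a_def abs_divide divide_right_mono)
      also have "\<dots> \<le> K" using a K by (simp add: divide_le_eq mult_le_cancel_left1)
      finally have "\<bar>ln u - q * ln s\<bar> \<le> K" .
      moreover have "q \<in> E" using p(1) p'(1) by (force simp: E_def q_def a_def)
      ultimately show ?thesis by blast
    qed
  qed
  moreover have "finite E" using finJ by (simp add: E_def)
  moreover have "\<epsilon> > 0" by (simp add: \<epsilon>_def)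
  ultimately show ?thesis by (intro exI[of _ E] exI[of _ K] exI[of _ \<epsilon>]) auto
qed

text \<open>The number of crossings of a level \<open>c\<close> is bounded by the degree in \<open>s\<close>; integrating over
  \<open>c\<close> bounds the variation.\<close>

lemma bounded_variation_branch:
  assumes "Q \<noteq> 0" and cont: "continuous_on {0<..<\<epsilon>} \<rho>"
    and zero: "\<And>s. s \<in> {0<..<\<epsilon>} \<Longrightarrow> bieval Q s (\<rho> s) = 0"
    and bound: "\<And>s. s \<in> {0<..<\<epsilon>} \<Longrightarrow> \<bar>\<rho> s\<bar> \<le> C"
  shows "\<exists>V. \<forall>n p. (\<forall>i\<le>n. p i \<in> {0<..<\<epsilon>}) \<longrightarrow> (\<forall>i<n. p i < p (Suc i)) \<longrightarrow>
    (\<Sum>i<n. \<bar>\<rho> (p (Suc i)) - \<rho> (p i)\<bar>) \<le> V"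
proof -
  define D where "D = (\<Sum>j\<le>degree Q. degree (coeff Q j))"
  have deg: "degree (poly Q [:c:]) \<le> D" for c
  proof -
    have "degree (coeff Q j * [:c:] ^ j) \<le> D" if "j \<le> degree Q" for j
    proof -
      have "degree (coeff Q j * [:c:] ^ j) \<le> degree (coeff Q j) + degree ([:c:] ^ j)"
        by (rule degree_mult_le)
      also have "degree ([:c:] ^ j) = 0" using degree_power_le[of "[:c:]" j] by simp
      also have "degree (coeff Q j) + 0 \<le> D"
        unfolding D_def add_0_right using that by (intro member_le_sum) auto
      finally show ?thesis .
    qed
    then show ?thesis unfolding poly_altdef by (intro degree_sum_le) auto
  qed
  \<comment> \<open>On these levels the polynomial in \<open>s\<close> vanishes identically and
    gives no bound on the number of crossings. They are finitely many and so do not affect the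
    integral.\<close>
  define N where "N = {c. poly Q [:c:] = 0}"
  have "finite N"
  proof -
    have "finite {x. poly Q x = 0}" by (rule poly_roots_finite[OF assms(1)])
    then have "finite ((\<lambda>c. [:c:]) -` {x. poly Q x = 0})"
      by (rule finite_vimageI) (auto simp: inj_def)
    then show ?thesis by (simp add: N_def vimage_def)
  qed
  have "(\<Sum>i<n. \<bar>\<rho> (p (Suc i)) - \<rho> (p i)\<bar>) \<le> D * (2 * \<bar>C\<bar>)"
    if p: "\<forall>i\<le>n. p i \<in> {0<..<\<epsilon>}" "\<forall>i<n. p i < p (Suc i)" for n p
  proof -
    define lo where "lo = (\<lambda>i. min (\<rho> (p i)) (\<rho> (p (Suc i))))"
    define hi where "hi = (\<lambda>i. max (\<rho> (p i)) (\<rho> (p (Suc i))))"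
    have lohi: "lo i \<le> hi i" "hi i - lo i = \<bar>\<rho> (p (Suc i)) - \<rho> (p i)\<bar>" for i
      by (auto simp: lo_def hi_def min_def max_def)
    have pmono: "p (Suc i) \<le> p j" if "i < j" "j \<le> n" for i j
      using that
    proof (induction j)
      case (Suc j)
      show ?case
      proof (cases "i = j")
        case False
        then have "p (Suc i) \<le> p j" using Suc by simp
        also have "p j \<le> p (Suc j)" using p(2) Suc.prems by (simp add: less_imp_le)
        finally show ?thesis .
      qed simp
    qed simp
    \<comment> \<open>Each interval that contains \<open>c\<close> yields a point where
      \<open>\<rho>\<close> takes the value \<open>c\<close>. The parameter intervals do not
      overlap, so these points are distinct roots of \<open>poly Q [:c:]\<close>.\<close>
    have count: "(\<Sum>i<n. indicator {lo i<..<hi i} c :: real) \<le> real D * (indicator {- \<bar>C\<bar>..\<bar>C\<bar>} c :: real)" if "c \<notin> N" for c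
    proof -
      define I where "I = {i\<in>{..<n}. c \<in> {lo i<..<hi i}}"
      have "\<exists>s. p i < s \<and> s < p (Suc i) \<and> \<rho> s = c" if "i \<in> I" for i
      proof -
        have i: "i < n" "lo i < c" "c < hi i" using that by (auto simp: I_def)
        have sub: "{p i..p (Suc i)} \<subseteq> {0<..<\<epsilon>}" using p(1) i(1) by (force dest: spec[of _ i] spec[of _ "Suc i"])
        have "\<exists>s\<in>{p i..p (Suc i)}. \<rho> s - c = 0"
        proof (cases "\<rho> (p i) < c")
          case True
          then show ?thesis using i p(2) sub cont
            by (intro continuous_connected_zero[of _ _ "p i" "p (Suc i)"] continuous_intros)
              (auto simp: lo_def hi_def intro: continuous_on_subset less_imp_le)
        next
          case False
          then show ?thesis using i p(2) sub cont
            by (intro continuous_connected_zero[of _ _ "p (Suc i)" "p i"] continuous_intros)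
              (auto simp: lo_def hi_def intro: continuous_on_subset less_imp_le)
        qed
        then obtain s where s: "p i \<le> s" "s \<le> p (Suc i)" "\<rho> s = c" by auto
        moreover have "s \<noteq> p i" "s \<noteq> p (Suc i)" using s i by (auto simp: lo_def hi_def)
        ultimately show ?thesis by force
      qed
      then obtain t where t: "\<And>i. i \<in> I \<Longrightarrow> p i < t i \<and> t i < p (Suc i) \<and> \<rho> (t i) = c" by metis
      have "inj_on t I"
      proof (rule inj_onI, rule ccontr)
        fix i j assume ij: "i \<in> I" "j \<in> I" "t i = t j" "i \<noteq> j"
        then consider "i < j" | "j < i" by linarith
        then show False
          using t[OF ij(1)] t[OF ij(2)] pmono[of i j] pmono[of j i] ij by cases (auto simp: I_def)
      qed
      have tin: "t i \<in> {0<..<\<epsilon>}" if "i \<in> I" for i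
      proof -
        have "p i \<in> {0<..<\<epsilon>}" "p (Suc i) \<in> {0<..<\<epsilon>}" using p(1) that by (auto simp: I_def)
        then show ?thesis using t[OF that] by auto
      qed
      have nz: "poly Q [:c:] \<noteq> 0" using that by (simp add: N_def)
      have "t ` I \<subseteq> {s. poly (poly Q [:c:]) s = 0}"
        using zero tin t by (force simp: bieval_def)
      then have "card (t ` I) \<le> card {s. poly (poly Q [:c:]) s = 0}"
        using poly_roots_finite[OF nz] by (intro card_mono) auto
      also have "\<dots> \<le> D" using card_poly_roots_bound[OF nz] deg order_trans by blast
      finally have card: "card I \<le> D" using card_image[OF \<open>inj_on t I\<close>] by simp
      have sum_eq: "(\<Sum>i<n. indicator {lo i<..<hi i} c :: real) = card I"
        unfolding I_def indicator_def by (simp add: sum.If_cases Int_def)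
      show ?thesis
      proof (cases "I = {}")
        case True
        then show ?thesis unfolding sum_eq by simp
      next
        case False
        then obtain i where "i \<in> I" by blast
        then have "\<bar>c\<bar> \<le> \<bar>C\<bar>" using t[of i] tin[of i] bound[of "t i"] by auto
        then show ?thesis unfolding sum_eq using card by (simp add: indicator_def abs_le_iff)
      qed
    qed
    have "(\<Sum>i<n. \<bar>\<rho> (p (Suc i)) - \<rho> (p i)\<bar>) = (\<Sum>i<n. LINT c|lborel. indicator {lo i<..<hi i} c)"
      using lohi by simp
    also have "\<dots> = (LINT c|lborel. (\<Sum>i<n. indicator {lo i<..<hi i} c))"
      by (subst Bochner_Integration.integral_sum) (auto simp: lohi)
    also have "\<dots> \<le> (LINT c|lborel. real D * (indicator {- \<bar>C\<bar>..\<bar>C\<bar>} c :: real))"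
    proof (rule integral_mono_AE)
      have "AE c in lborel. c \<notin> N"
        using \<open>finite N\<close> by (intro AE_not_in finite_imp_null_set_lborel)
      then show "AE c in lborel. (\<Sum>i<n. indicator {lo i<..<hi i} c) \<le> real D * (indicator {- \<bar>C\<bar>..\<bar>C\<bar>} c :: real)"
        using count by auto
    qed (auto simp: lohi)
    also have "\<dots> = D * (2 * \<bar>C\<bar>)" by simp
    finally show ?thesis .
  qed
  then show ?thesis by blast
qed

section \<open>The gradient inequality for polynomials\<close>

lemma polynomial_partials:
  fixes f :: "'a::euclidean_space \<Rightarrow> real"
  assumes "real_polynomial_function f"
  shows "\<exists>g. (\<forall>b\<in>Basis. real_polynomial_function (g b)) \<and>
    (\<forall>z. (f has_derivative (\<lambda>h. \<Sum>b\<in>Basis. g b z * (h \<bullet> b))) (at z))"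
  using assms
proof induction
  case (linear f)
  have eq: "(\<Sum>b\<in>Basis. f b * (h \<bullet> b)) = f h" for h
  proof -
    have "f h = f (\<Sum>b\<in>Basis. (h \<bullet> b) *\<^sub>R b)" by (simp add: euclidean_representation)
    also have "\<dots> = (\<Sum>b\<in>Basis. f b * (h \<bullet> b))"
      using linear by (simp add: linear_sum linear_scale bounded_linear.linear mult.commute)
    finally show ?thesis by simp
  qed
  have "(f has_derivative (\<lambda>h. \<Sum>b\<in>Basis. f b * (h \<bullet> b))) (at z)" for z
    unfolding eq by (rule bounded_linear_imp_has_derivative[OF linear])
  then show ?case by (intro exI[of _ "\<lambda>b z. f b"]) auto
next
  case (const c)
  then show ?case by (intro exI[of _ "\<lambda>b z. 0"]) auto
next
  case (add p q)
  then obtain g h where "\<forall>b\<in>Basis. real_polynomial_function (g b)" "\<forall>b\<in>Basis. real_polynomial_function (h b)"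
    and d: "\<And>z. (p has_derivative (\<lambda>v. \<Sum>b\<in>Basis. g b z * (v \<bullet> b))) (at z)"
      "\<And>z. (q has_derivative (\<lambda>v. \<Sum>b\<in>Basis. h b z * (v \<bullet> b))) (at z)" by blast
  moreover have "((\<lambda>z. p z + q z) has_derivative (\<lambda>v. \<Sum>b\<in>Basis. (g b z + h b z) * (v \<bullet> b))) (at z)" for z
    using has_derivative_add[OF d[of z]] by (simp add: algebra_simps sum.distrib)
  ultimately show ?case by (intro exI[of _ "\<lambda>b z. g b z + h b z"]) auto
next
  case (mult p q)
  then obtain g h where "\<forall>b\<in>Basis. real_polynomial_function (g b)" "\<forall>b\<in>Basis. real_polynomial_function (h b)"
    and d: "\<And>z. (p has_derivative (\<lambda>v. \<Sum>b\<in>Basis. g b z * (v \<bullet> b))) (at z)"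
      "\<And>z. (q has_derivative (\<lambda>v. \<Sum>b\<in>Basis. h b z * (v \<bullet> b))) (at z)" by blast
  moreover have "((\<lambda>z. p z * q z) has_derivative (\<lambda>v. \<Sum>b\<in>Basis. (p z * h b z + g b z * q z) * (v \<bullet> b))) (at z)" for z
  proof -
    have "(\<lambda>v. p z * (\<Sum>b\<in>Basis. h b z * (v \<bullet> b)) + (\<Sum>b\<in>Basis. g b z * (v \<bullet> b)) * q z)
        = (\<lambda>v. \<Sum>b\<in>Basis. (p z * h b z + g b z * q z) * (v \<bullet> b))"
      by (simp add: fun_eq_iff sum_distrib_left sum_distrib_right sum.distrib algebra_simps)
    then show ?thesis using has_derivative_mult[OF d[of z]] by simp
  qed
  ultimately show ?case
    using mult.hyps by (intro exI[of _ "\<lambda>b z. p z * h b z + g b z * q z"])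
      (auto intro!: real_polynomial_function.intros(3,4))
qed

lemma mvt_partials:
  fixes f :: "'a::euclidean_space \<Rightarrow> real"
  assumes d: "\<And>z. (f has_derivative (\<lambda>h. \<Sum>b\<in>Basis. g b z * (h \<bullet> b))) (at z)"
  shows "\<exists>\<xi>\<in>closed_segment x y. f y - f x = (\<Sum>b\<in>Basis. g b \<xi> * ((y - x) \<bullet> b))"
proof -
  define \<phi> where "\<phi> = (\<lambda>\<tau>. f (x + \<tau> *\<^sub>R (y - x)))"
  define \<phi>' where "\<phi>' = (\<lambda>\<tau>. \<Sum>b\<in>Basis. g b (x + \<tau> *\<^sub>R (y - x)) * ((y - x) \<bullet> b))"
  have "(\<phi> has_real_derivative \<phi>' \<tau>) (at \<tau>)" for \<tau>
  proof -
    have "((\<lambda>\<tau>. x + \<tau> *\<^sub>R (y - x)) has_derivative (\<lambda>k. k *\<^sub>R (y - x))) (at \<tau>)"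
      by (auto intro!: derivative_eq_intros)
    from has_derivative_compose[OF this d]
    have "(\<phi> has_derivative (\<lambda>k. \<Sum>b\<in>Basis. g b (x + \<tau> *\<^sub>R (y - x)) * ((k *\<^sub>R (y - x)) \<bullet> b))) (at \<tau>)"
      by (simp add: \<phi>_def)
    moreover have "(\<lambda>k. \<Sum>b\<in>Basis. g b (x + \<tau> *\<^sub>R (y - x)) * ((k *\<^sub>R (y - x)) \<bullet> b)) = (*) (\<phi>' \<tau>)"
      by (simp add: fun_eq_iff \<phi>'_def sum_distrib_left mult_ac)
    ultimately show ?thesis by (simp add: has_field_derivative_def)
  qed
  then have "\<exists>\<tau>. 0 < \<tau> \<and> \<tau> < 1 \<and> \<phi> 1 - \<phi> 0 = (1 - 0) * \<phi>' \<tau>"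
    by (intro MVT2) auto
  then obtain \<tau> where \<tau>: "0 < \<tau>" "\<tau> < 1" "\<phi> 1 - \<phi> 0 = \<phi>' \<tau>" by auto
  have "x + \<tau> *\<^sub>R (y - x) \<in> closed_segment x y"
    using \<tau> by (auto simp: in_segment algebra_simps intro!: exI[of _ \<tau>])
  then show ?thesis using \<tau>(3) by (auto simp: \<phi>_def \<phi>'_def)
qed

text \<open>Along the curve \<open>ln (f (w s))\<close> would have bounded variation, although
  \<open>f (w s)\<close> tends to zero.\<close>

lemma no_slow_algebraic_curve:
  fixes f :: "'a::euclidean_space \<Rightarrow> real" and w :: "real \<Rightarrow> 'a"
  assumes d: "\<And>z. (f has_derivative (\<lambda>h. \<Sum>b\<in>Basis. g b z * (h \<bullet> b))) (at z)"
    and contg: "\<And>b. b \<in> Basis \<Longrightarrow> continuous_on UNIV (g b)"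
    and \<epsilon>: "0 < \<epsilon>" and C: "0 \<le> C"
    and alg: "\<And>b. b \<in> Basis \<Longrightarrow> algebraic_on \<epsilon> (\<lambda>s. w s \<bullet> b)"
    and bound: "\<And>b s. b \<in> Basis \<Longrightarrow> s \<in> {0<..<\<epsilon>} \<Longrightarrow> \<bar>w s \<bullet> b\<bar> \<le> C"
    and slow: "\<And>b s. b \<in> Basis \<Longrightarrow> s \<in> {0<..<\<epsilon>} \<Longrightarrow> \<bar>g b (w s)\<bar> \<le> C * s"
    and near: "\<And>s. s \<in> {0<..<\<epsilon>} \<Longrightarrow> \<bar>f (w s) - s\<bar> \<le> C * s\<^sup>2"
  shows False
proof -
  have "\<forall>b\<in>Basis. \<exists>V. \<forall>n p. (\<forall>i\<le>n. p i \<in> {0<..<\<epsilon>}) \<longrightarrow> (\<forall>i<n. p i < p (Suc i)) \<longrightarrow>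
    (\<Sum>i<n. \<bar>w (p (Suc i)) \<bullet> b - w (p i) \<bullet> b\<bar>) \<le> V"
  proof
    fix b :: 'a assume b: "b \<in> Basis"
    obtain Q where "Q \<noteq> 0" "\<forall>s\<in>{0<..<\<epsilon>}. bieval Q s (w s \<bullet> b) = 0" "continuous_on {0<..<\<epsilon>} (\<lambda>s. w s \<bullet> b)"
      using alg[OF b] unfolding algebraic_on_def by blast
    then show "\<exists>V. \<forall>n p. (\<forall>i\<le>n. p i \<in> {0<..<\<epsilon>}) \<longrightarrow> (\<forall>i<n. p i < p (Suc i)) \<longrightarrow>
        (\<Sum>i<n. \<bar>w (p (Suc i)) \<bullet> b - w (p i) \<bullet> b\<bar>) \<le> V"
      by (intro bounded_variation_branch[of Q \<epsilon> "\<lambda>s. w s \<bullet> b" C]) (use bound[OF b] in simp_all)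
  qed
  from bchoice[OF this] obtain V where "\<forall>b\<in>Basis. \<forall>n p. (\<forall>i\<le>n. p i \<in> {0<..<\<epsilon>}) \<longrightarrow>
    (\<forall>i<n. p i < p (Suc i)) \<longrightarrow> (\<Sum>i<n. \<bar>w (p (Suc i)) \<bullet> b - w (p i) \<bullet> b\<bar>) \<le> V b"
    by (elim exE)
  then have V: "(\<Sum>i<n. \<bar>w (p (Suc i)) \<bullet> b - w (p i) \<bullet> b\<bar>) \<le> V b"
    if "b \<in> Basis" "\<forall>i\<le>n. p i \<in> {0<..<\<epsilon>}" "\<forall>i<n. p i < p (Suc i)" for b n p
    using that by simp
  define W where "W = (\<Sum>b\<in>Basis. V b)"
  have "V b \<ge> 0" if "b \<in> Basis" for b using V[OF that, of 0 "\<lambda>_. \<epsilon> / 2"] \<epsilon> by simp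
  then have W: "0 \<le> W" unfolding W_def by (intro sum_nonneg) auto
  \<comment> \<open>Up to this \<open>t\<close> one has \<open>C * s \<le> 1 / 2\<close>, so that
    \<open>f (w s)\<close> lies between \<open>s / 2\<close> and \<open>2 * s\<close>.\<close>
  define t where "t = min (\<epsilon> / 2) (1 / (2 * C + 1))"
  have t: "0 < t" "t < \<epsilon>" using \<epsilon> C by (auto simp: t_def)
  have val: "s / 2 \<le> f (w s) \<and> f (w s) \<le> 2 * s" if "0 < s" "s \<le> t" for s
  proof -
    have "s \<le> 1 / (2 * C + 1)" using that by (simp add: t_def)
    then have "2 * C * s + s \<le> 1" using C by (simp add: field_simps)
    then have "C * s \<le> 1 / 2" using that by linarith
    then have "C * s * s \<le> 1 / 2 * s" using that by (intro mult_right_mono) auto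
    then have "C * s\<^sup>2 \<le> s / 2" by (simp add: power2_eq_square mult.assoc)
    then show ?thesis using near[of s] that t by (auto simp: abs_le_iff)
  qed
  have main: "ln (f (w t)) - ln (f (w a)) \<le> 2 * (C + 1) * W" if a: "0 < a" "a < t" for a
  proof -
    define R where "R = (\<Sum>b\<in>(Basis::'a set). C)"
    have norm_w: "norm (w s) \<le> R" if "s \<in> {0<..<\<epsilon>}" for s
    proof -
      have "norm (w s) \<le> (\<Sum>b\<in>Basis. \<bar>w s \<bullet> b\<bar>)" by (rule norm_le_l1)
      also have "\<dots> \<le> R" unfolding R_def using bound that by (intro sum_mono) auto
      finally show ?thesis .
    qed
    \<comment> \<open>The mean value theorem is applied on chords, whose points need not lie on the
      curve. On a fine partition the gradient at such a point differs by less than \<open>a\<close>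
      from its value on the curve; since \<open>a \<le> p i\<close>, the bound
      \<open>C * p i\<close> only grows to \<open>(C + 1) * p i\<close>.\<close>
    have "\<exists>\<delta>>0. \<forall>b\<in>Basis. \<forall>x\<in>cball 0 R. \<forall>y\<in>cball 0 R. dist x y < \<delta> \<longrightarrow> dist (g b x) (g b y) < a"
    proof (rule finite_common_threshold)
      fix b :: 'a assume "b \<in> Basis"
      then have "uniformly_continuous_on (cball 0 R) (g b)"
        using contg by (intro compact_uniformly_continuous) (auto intro: continuous_on_subset)
      then show "\<exists>\<delta>>0. \<forall>x\<in>cball 0 R. \<forall>y\<in>cball 0 R. dist x y < \<delta> \<longrightarrow> dist (g b x) (g b y) < a"
        using a unfolding uniformly_continuous_on_def by (metis dist_commute)
    qed auto
    then obtain \<delta> where \<delta>: "0 < \<delta>" "\<And>b x y. b \<in> Basis \<Longrightarrow> x \<in> cball 0 R \<Longrightarrow> y \<in> cball 0 R \<Longrightarrow> dist x y < \<delta> \<Longrightarrow> dist (g b x) (g b y) < a"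
      by blast
    have "continuous_on {0<..<\<epsilon>} w"
      using alg unfolding algebraic_on_def by (subst continuous_on_componentwise) auto
    then have "uniformly_continuous_on {a..t} w"
      using a t by (intro compact_uniformly_continuous) (auto intro: continuous_on_subset)
    then obtain \<eta> where \<eta>: "0 < \<eta>" "\<And>x y. x \<in> {a..t} \<Longrightarrow> y \<in> {a..t} \<Longrightarrow> dist x y < \<eta> \<Longrightarrow> dist (w x) (w y) < \<delta>"
      using \<delta>(1) unfolding uniformly_continuous_on_def by metis
    obtain n :: nat where n: "(t - a) / \<eta> < real n" using reals_Archimedean2 by blast
    have n0: "0 < real n" using n a \<eta> divide_pos_pos[of "t - a" \<eta>] by linarith
    define p where "p = (\<lambda>i. a + real i * ((t - a) / n))"
    have p: "p 0 = a" "p n = t" using n0 by (auto simp: p_def)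
    have step: "p (Suc i) - p i = (t - a) / n" for i
      unfolding p_def of_nat_Suc distrib_right by linarith
    have stepp: "0 < (t - a) / n" "(t - a) / n < \<eta>" using n n0 a \<eta> by (auto simp: field_simps)
    have pin: "a \<le> p i" "p i \<le> t" if "i \<le> n" for i
    proof -
      have "0 \<le> real i * ((t - a) / n)" using stepp by (intro mult_nonneg_nonneg) auto
      then show "a \<le> p i" by (simp add: p_def)
      have "real i * ((t - a) / n) \<le> real n * ((t - a) / n)" using that stepp by (intro mult_right_mono) auto
      then show "p i \<le> t" using n0 by (simp add: p_def)
    qed
    have "ln (f (w (p (Suc i)))) - ln (f (w (p i))) \<le>
        2 * (C + 1) * (\<Sum>b\<in>Basis. \<bar>w (p (Suc i)) \<bullet> b - w (p i) \<bullet> b\<bar>)" if i: "i < n" for i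
    proof -
      let ?x = "w (p i)" and ?y = "w (p (Suc i))"
      have pi: "a \<le> p i" "p i \<le> t" "a \<le> p (Suc i)" "p (Suc i) \<le> t" using pin[of i] pin[of "Suc i"] i by auto
      have pe: "p i \<in> {0<..<\<epsilon>}" "p (Suc i) \<in> {0<..<\<epsilon>}" using pi a t by auto
      have pos: "0 < f ?x" "0 < f ?y" "p i / 2 \<le> f ?x" using val[of "p i"] val[of "p (Suc i)"] pi a by auto
      obtain \<xi> where \<xi>: "\<xi> \<in> closed_segment ?x ?y" "f ?y - f ?x = (\<Sum>b\<in>Basis. g b \<xi> * ((?y - ?x) \<bullet> b))"
        using mvt_partials[OF d] by blast
      have "\<xi> \<in> cball 0 R"
        using \<xi>(1) norm_w[OF pe(1)] norm_w[OF pe(2)] closed_segment_subset[of ?x "cball 0 R" ?y] by auto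
      have "dist ?x ?y < \<delta>" using \<eta>(2)[of "p i" "p (Suc i)"] pi step[of i] stepp by (auto simp: dist_real_def)
      moreover have "dist ?x \<xi> \<le> dist ?x ?y" using segment_bound1[OF \<xi>(1)] by (simp add: dist_norm norm_minus_commute)
      ultimately have dist: "dist ?x \<xi> < \<delta>" by simp
      have gb: "\<bar>g b \<xi>\<bar> \<le> (C + 1) * p i" if b: "b \<in> Basis" for b
      proof -
        have "dist (g b ?x) (g b \<xi>) < a"
          using \<delta>(2)[OF b _ \<open>\<xi> \<in> cball 0 R\<close> dist] norm_w[OF pe(1)] by auto
        then have "\<bar>g b \<xi>\<bar> \<le> \<bar>g b ?x\<bar> + a" by (auto simp: dist_real_def)
        also have "\<dots> \<le> C * p i + p i" using slow[OF b pe(1)] pi by auto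
        finally show ?thesis by (simp add: algebra_simps)
      qed
      have "f ?y - f ?x \<le> (\<Sum>b\<in>Basis. \<bar>g b \<xi>\<bar> * \<bar>(?y - ?x) \<bullet> b\<bar>)"
        unfolding \<xi>(2) by (intro sum_mono) (simp flip: abs_mult)
      also have "\<dots> \<le> (\<Sum>b\<in>Basis. (C + 1) * p i * \<bar>(?y - ?x) \<bullet> b\<bar>)"
        using gb by (intro sum_mono mult_right_mono) auto
      also have "\<dots> = (C + 1) * p i * (\<Sum>b\<in>Basis. \<bar>?y \<bullet> b - ?x \<bullet> b\<bar>)"
        by (simp add: sum_distrib_left inner_diff_left)
      also have "\<dots> \<le> (C + 1) * (2 * f ?x) * (\<Sum>b\<in>Basis. \<bar>?y \<bullet> b - ?x \<bullet> b\<bar>)"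
        using pos C by (intro mult_right_mono mult_left_mono sum_nonneg) auto
      finally have le: "f ?y - f ?x \<le> 2 * (C + 1) * (\<Sum>b\<in>Basis. \<bar>?y \<bullet> b - ?x \<bullet> b\<bar>) * f ?x"
        by (simp only: mult.assoc mult.commute mult.left_commute)
      have "ln (f ?y) - ln (f ?x) = ln (f ?y / f ?x)" using pos by (simp add: ln_div)
      also have "\<dots> \<le> f ?y / f ?x - 1" using pos by (intro ln_le_minus_one) auto
      also have "\<dots> = (f ?y - f ?x) / f ?x" using pos by (simp add: field_simps)
      also have "\<dots> \<le> 2 * (C + 1) * (\<Sum>b\<in>Basis. \<bar>?y \<bullet> b - ?x \<bullet> b\<bar>)" using le pos by (simp add: pos_divide_le_eq)
      finally show ?thesis .
    qed
    then have "(\<Sum>i<n. ln (f (w (p (Suc i)))) - ln (f (w (p i)))) \<le>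
      (\<Sum>i<n. 2 * (C + 1) * (\<Sum>b\<in>Basis. \<bar>w (p (Suc i)) \<bullet> b - w (p i) \<bullet> b\<bar>))"
      by (intro sum_mono) auto
    also have "(\<Sum>i<n. ln (f (w (p (Suc i)))) - ln (f (w (p i)))) = ln (f (w t)) - ln (f (w a))"
      using sum_lessThan_telescope[of "\<lambda>i. ln (f (w (p i)))" n] by (simp only: p)
    also have "(\<Sum>i<n. 2 * (C + 1) * (\<Sum>b\<in>Basis. \<bar>w (p (Suc i)) \<bullet> b - w (p i) \<bullet> b\<bar>))
        = 2 * (C + 1) * (\<Sum>b\<in>Basis. \<Sum>i<n. \<bar>w (p (Suc i)) \<bullet> b - w (p i) \<bullet> b\<bar>)"
      unfolding sum_distrib_left[symmetric] by (subst sum.swap) simp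
    also have "\<dots> \<le> 2 * (C + 1) * W"
    proof (intro mult_left_mono)
      have "p i \<in> {0<..<\<epsilon>}" if "i \<le> n" for i using pin[OF that] a t by auto
      moreover have "p i < p (Suc i)" for i using step[of i] stepp by linarith
      ultimately show "(\<Sum>b\<in>Basis. \<Sum>i<n. \<bar>w (p (Suc i)) \<bullet> b - w (p i) \<bullet> b\<bar>) \<le> W"
        unfolding W_def by (intro sum_mono V) auto
    qed (use C in auto)
    finally show ?thesis .
  qed
  define m where "m = 2 * (C + 1) * W"
  have m: "0 \<le> m" using C W by (simp add: m_def)
  \<comment> \<open>With this choice \<open>ln (2 * a)\<close> falls short of
    \<open>ln (t / 2)\<close> by \<open>m + 1\<close>, more than the total variation
    \<open>m\<close> permits.\<close>
  define a where "a = t / 4 * exp (- (m + 1))"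
  have "exp (- (m + 1)) \<le> 1" using m by simp
  then have "a \<le> t / 4 * 1" unfolding a_def using t by (intro mult_left_mono) auto
  moreover have "0 < a" using t by (simp add: a_def)
  ultimately have a: "0 < a" "a < t" using t by auto
  have "ln (t / 2) \<le> ln (f (w t))" using val[of t] t by (subst ln_le_cancel_iff) auto
  moreover have "ln (f (w a)) \<le> ln (2 * a)" using val[of a] a by (subst ln_le_cancel_iff) auto
  moreover have "ln (2 * a) = ln (t / 2) - (m + 1)"
  proof -
    have eq: "2 * a = t / 2 * exp (- (m + 1))" by (simp add: a_def)
    show ?thesis unfolding eq using t by (subst ln_mult) auto
  qed
  ultimately show False using main[OF a] by (simp add: m_def)
qed

text \<open>The sign is constant near zero, so a single nonnegative value there decides it.\<close>

lemma algebraic_frequently_nonneg: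
  fixes w :: "real \<Rightarrow> 'a::euclidean_space"
  assumes "0 < \<epsilon>" "\<And>b. b \<in> Basis \<Longrightarrow> algebraic_on \<epsilon> (\<lambda>s. w s \<bullet> b)"
    and "real_polynomial_function p" "\<exists>\<^sub>F s in at_right 0. 0 \<le> p (s, w s)"
  shows "\<forall>\<^sub>F s in at_right 0. 0 \<le> p (s, w s)"
proof -
  obtain \<delta>1 where \<delta>1: "0 < \<delta>1" "\<delta>1 \<le> \<epsilon>" "algebraic_on \<delta>1 (\<lambda>s. p (s, w s))"
    using algebraic_on_polynomial[OF assms(1-3)] by blast
  obtain \<delta> v where \<delta>: "0 < \<delta>" "\<And>s. s \<in> {0<..<\<delta>} \<Longrightarrow> sgn (p (s, w s)) = v"
    using algebraic_on_sign[OF \<delta>1(3,1)] by blast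
  have ev: "\<forall>\<^sub>F s in at_right 0. s \<in> {0<..<\<delta>}"
    using \<delta>(1) by (auto simp: eventually_at_right_field)
  obtain s where s: "s \<in> {0<..<\<delta>}" "0 \<le> p (s, w s)"
    using frequently_ex[OF frequently_eventually_conj[OF assms(4) ev]] by auto
  then have "0 \<le> v" using \<delta>(2)[OF s(1)] by (auto simp: sgn_if split: if_splits)
  show ?thesis
    using ev
  proof eventually_elim
    case (elim s)
    then show ?case using \<delta>(2)[of s] \<open>0 \<le> v\<close> by (auto simp: sgn_if split: if_splits)
  qed
qed

text \<open>The minimum \<open>m s\<close> of \<open>H s\<close> bounds the gradient of \<open>f\<close> on the level \<open>s\<close> from below. The top-degree
  penalty in \<open>H\<close> makes the critical point equations eliminable, so that \<open>m s\<close> and the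
  coordinates of the minimizers are algebraic over \<open>s\<close>. If \<open>m s\<close> were \<open>O(s^4)\<close>, the
  minimizers would trace a curve excluded by \<open>no_slow_algebraic_curve\<close>.\<close>

theorem lojasiewicz_gradient:
  fixes f :: "'a::euclidean_space \<Rightarrow> real" and g :: "'a \<Rightarrow> 'a \<Rightarrow> real"
  assumes f: "real_polynomial_function f"
    and g: "\<And>b. b \<in> Basis \<Longrightarrow> real_polynomial_function (g b)"
    and df: "\<And>z. (f has_derivative (\<lambda>h. \<Sum>b\<in>Basis. g b z * (h \<bullet> b))) (at z)"
  shows "\<exists>\<theta> c \<epsilon>. 0 \<le> \<theta> \<and> \<theta> < 2 \<and> 0 < c \<and> 0 < \<epsilon> \<and>
    (\<forall>z. norm z \<le> R \<longrightarrow> 0 < f z \<longrightarrow> f z < \<epsilon> \<longrightarrow> c * f z powr \<theta> \<le> (\<Sum>b\<in>Basis. (g b z)\<^sup>2))"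
proof -
  have "\<forall>c\<in>Basis. \<exists>gg. (\<forall>b\<in>Basis. real_polynomial_function (gg b)) \<and>
    (\<forall>z. (g c has_derivative (\<lambda>h. \<Sum>b\<in>Basis. gg b z * (h \<bullet> b))) (at z))"
    using polynomial_partials[OF g] by blast
  from bchoice[OF this] obtain gg where gg:
    "\<And>b c. b \<in> Basis \<Longrightarrow> c \<in> Basis \<Longrightarrow> real_polynomial_function (gg c b)"
    "\<And>c z. c \<in> Basis \<Longrightarrow> (g c has_derivative (\<lambda>h. \<Sum>b\<in>Basis. gg c b z * (h \<bullet> b))) (at z)"
    by blast
  define S where "S = (\<lambda>z. \<Sum>b\<in>Basis. (g b z)\<^sup>2)"
  \<comment> \<open>Minus the partial derivatives of the first two terms of \<open>H\<close>. A
    critical point of \<open>H s\<close> thus satisfies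
    \<open>2 * D * s ^ 4 * (z \<bullet> b) ^ (2 * D - 1) = r b (s, z)\<close>.\<close>
  define r where "r = (\<lambda>b x. - (2 * (fst x)\<^sup>2 * (\<Sum>c\<in>Basis. g c (snd x) * gg c b (snd x)) +
      2 * (f (snd x) - fst x) * g b (snd x)))"
  have fst_poly: "real_polynomial_function (\<lambda>x::real \<times> 'a. fst x)"
    by (intro real_polynomial_function.intros(1) bounded_linear_intros)
  have snd_poly: "real_polynomial_function (\<lambda>x::real \<times> 'a. p (snd x))" if "real_polynomial_function p" for p
    using real_polynomial_function_compose[OF polynomial_function_bounded_linear[OF bounded_linear_snd] that]
    by (simp add: o_def)
  have r_poly: "real_polynomial_function (r b)" if "b \<in> Basis" for b
    unfolding r_def using that f g gg(1) fst_poly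
    by (intro real_polynomial_function_minus real_polynomial_function.intros(2,3,4) real_polynomial_function_power
        real_polynomial_function_sum real_polynomial_function_diff snd_poly) auto
  have "\<forall>b\<in>Basis. \<exists>kn. \<forall>s (Z :: real \<times> 'a \<Rightarrow> 'a).
      (\<lambda>x. r b (s x, Z x)) \<in> polys s (\<lambda>b x. Z x \<bullet> b) Basis (fst kn) (snd kn)"
  proof
    fix b :: 'a assume "b \<in> Basis"
    from polynomial_in_polys[OF r_poly[OF this]] obtain k n where "\<forall>s (Z :: real \<times> 'a \<Rightarrow> 'a).
      (\<lambda>x. r b (s x, Z x)) \<in> polys s (\<lambda>b x. Z x \<bullet> b) Basis k n" by (elim exE)
    then show "\<exists>kn. \<forall>s (Z :: real \<times> 'a \<Rightarrow> 'a).
      (\<lambda>x. r b (s x, Z x)) \<in> polys s (\<lambda>b x. Z x \<bullet> b) Basis (fst kn) (snd kn)"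
      by (intro exI[of _ "(k, n)"]) simp
  qed
  from bchoice[OF this] obtain kn where kn: "\<forall>b\<in>Basis. \<forall>s (Z :: real \<times> 'a \<Rightarrow> 'a).
      (\<lambda>x. r b (s x, Z x)) \<in> polys s (\<lambda>b x. Z x \<bullet> b) Basis (fst (kn b)) (snd (kn b))" by (elim exE)
  define k where "k = Max ((\<lambda>b. fst (kn b)) ` Basis)"
  define n where "n = Max ((\<lambda>b. snd (kn b)) ` Basis)"
  have r_polys: "(\<lambda>x. r b (s x, Z x)) \<in> polys s (\<lambda>b x. Z x \<bullet> b) Basis k n"
    if b: "b \<in> Basis" for b s and Z :: "real \<times> 'a \<Rightarrow> 'a"
  proof -
    have "fst (kn b) \<le> k" "snd (kn b) \<le> n" using b by (auto simp: k_def n_def)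
    from polys_mono[OF this] show ?thesis using kn[rule_format, OF b, of s Z] by blast
  qed
  \<comment> \<open>With \<open>D = n + 1\<close> the degree \<open>2 * D - 1\<close> of the
    penalty's gradient exceeds the degree bound \<open>n\<close> of \<open>r b\<close>, as
    \<open>elimination\<close> requires.\<close>
  define D where "D = Suc n"
  \<comment> \<open>The weights are such that \<open>H s z = O(s ^ 4)\<close> means gradient
    \<open>O(s)\<close>, \<open>f z - s = O(s ^ 2)\<close> and bounded coordinates of
    \<open>z\<close>. The summand 1 keeps the minimum positive, so that its logarithm can be
    compared with \<open>ln s\<close>.\<close>
  define H where "H = (\<lambda>s z. s\<^sup>2 * S z + (f z - s)\<^sup>2 + s ^ 4 * (1 + (\<Sum>b\<in>Basis. (z \<bullet> b) ^ (2 * D))))"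
  have S_poly: "real_polynomial_function S"
    unfolding S_def using g by (intro real_polynomial_function_sum real_polynomial_function_power) auto
  have H_poly: "real_polynomial_function (\<lambda>x. H (fst x) (snd x))"
    unfolding H_def using f S_poly fst_poly
    by (intro real_polynomial_function.intros(2,3,4) real_polynomial_function_power
        real_polynomial_function_sum real_polynomial_function_diff snd_poly[of "\<lambda>z. z \<bullet> _"] snd_poly)
       (auto intro: real_polynomial_function.intros(1) bounded_linear_intros)
  have S_nonneg: "0 \<le> S z" for z unfolding S_def by (intro sum_nonneg) auto
  have even: "0 \<le> (z \<bullet> b) ^ (2 * D)" for z b :: 'a by (simp add: power_mult)
  have square_deriv: "((\<lambda>z. (u z)\<^sup>2) has_derivative (\<lambda>h. 2 * u z * u' h)) (at z)"
    if "(u has_derivative u') (at z)" for u u' :: "'a \<Rightarrow> real" and z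
    using has_derivative_power[OF that, of 2] by (simp add: mult.commute mult.left_commute)
  have S_deriv: "(S has_derivative (\<lambda>h. \<Sum>c\<in>Basis. 2 * g c z * (\<Sum>b\<in>Basis. gg c b z * (h \<bullet> b)))) (at z)" for z
    unfolding S_def
  proof (rule has_derivative_sum)
    fix c :: 'a assume "c \<in> Basis"
    then show "((\<lambda>z. (g c z)\<^sup>2) has_derivative (\<lambda>h. 2 * g c z * (\<Sum>b\<in>Basis. gg c b z * (h \<bullet> b)))) (at z)"
      by (intro square_deriv gg(2))
  qed
  have pow_deriv: "((\<lambda>z. \<Sum>b\<in>Basis. (z \<bullet> b) ^ (2 * D)) has_derivative
      (\<lambda>h. \<Sum>b\<in>Basis. real (2 * D) * (z \<bullet> b) ^ (2 * D - 1) * (h \<bullet> b))) (at z)" for z :: 'a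
  proof (rule has_derivative_sum)
    fix b :: 'a
    have "((\<lambda>z. (z \<bullet> b) ^ N) has_derivative (\<lambda>h. of_nat N * (h \<bullet> b) * (z \<bullet> b) ^ (N - 1))) (at z)" for N
      by (rule has_derivative_power[OF has_derivative_inner_left[OF has_derivative_ident]])
    then show "((\<lambda>z. (z \<bullet> b) ^ (2 * D)) has_derivative (\<lambda>h. real (2 * D) * (z \<bullet> b) ^ (2 * D - 1) * (h \<bullet> b))) (at z)"
      by (simp only: mult.assoc mult.commute[of "(z \<bullet> b) ^ (2 * D - 1)"])
  qed
  define dH where "dH = (\<lambda>s z h. s\<^sup>2 * (\<Sum>c\<in>Basis. 2 * g c z * (\<Sum>b\<in>Basis. gg c b z * (h \<bullet> b))) +
      2 * (f z - s) * (\<Sum>b\<in>Basis. g b z * (h \<bullet> b)) +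
      s ^ 4 * (\<Sum>b\<in>Basis. real (2 * D) * (z \<bullet> b) ^ (2 * D - 1) * (h \<bullet> b)))"
  have H_deriv: "((H s) has_derivative dH s z) (at z)" for s z
  proof -
    have sq: "((\<lambda>z. (f z - s)\<^sup>2) has_derivative (\<lambda>h. 2 * (f z - s) * (\<Sum>b\<in>Basis. g b z * (h \<bullet> b)))) (at z)"
      using square_deriv[OF has_derivative_diff[OF df[of z] has_derivative_const[of s]]] by simp
    have pen: "((\<lambda>z. 1 + (\<Sum>b\<in>Basis. (z \<bullet> b) ^ (2 * D))) has_derivative
        (\<lambda>h. \<Sum>b\<in>Basis. real (2 * D) * (z \<bullet> b) ^ (2 * D - 1) * (h \<bullet> b))) (at z)"
      using has_derivative_add[OF has_derivative_const pow_deriv] by simp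
    show ?thesis
      unfolding H_def dH_def
      by (intro has_derivative_add has_derivative_mult_right S_deriv sq pen)
  qed
  define V where "V = {x :: real \<times> 'a. 0 < fst x \<and> (\<forall>b\<in>Basis. real (2 * D) * fst x ^ 4 * (snd x \<bullet> b) ^ (2 * D - 1) = r b x)}"
  have crit: "(s, z) \<in> V" if s: "0 < s" and min: "\<And>y. H s z \<le> H s y" for s z
  proof -
    have "dH s z = (\<lambda>h. 0)"
      by (rule differential_zero_maxmin[of z UNIV "H s"]) (use H_deriv min in auto)
    then have 0: "dH s z h = 0" for h by simp
    have pick: "(\<Sum>b\<in>Basis. F b * (c \<bullet> b)) = F c" if "c \<in> Basis" for c and F :: "'a \<Rightarrow> real"
    proof -
      have "(\<Sum>b\<in>Basis. F b * (c \<bullet> b)) = (\<Sum>b\<in>Basis. if b = c then F b else 0)"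
        using that by (intro sum.cong) (auto simp: inner_Basis)
      then show ?thesis using that by simp
    qed
    have "real (2 * D) * s ^ 4 * (z \<bullet> b) ^ (2 * D - 1) = r b (s, z)" if b: "b \<in> Basis" for b
      using 0[of b] unfolding dH_def pick[OF b] r_def by (simp add: sum_distrib_left algebra_simps)
    then show ?thesis using s unfolding V_def by simp
  qed
  have elim: "\<exists>Q. Q \<noteq> 0 \<and> (\<forall>x\<in>V. bieval Q (fst x) (p x) = 0)" if p: "real_polynomial_function p" for p
  proof (cases "V = {}")
    case True
    then show ?thesis by (auto intro: exI[of _ 1])
  next
    case False
    then obtain v0 where v0: "v0 \<in> V" by blast
    \<comment> \<open>The equations must hold at every index, so pairs outside \<open>V\<close> are
      replaced by a fixed element of \<open>V\<close>.\<close>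
    define pt where "pt = (\<lambda>x. if x \<in> V then x else v0)"
    have pt: "pt x \<in> V" for x using v0 by (simp add: pt_def)
    define s where "s = (\<lambda>x. fst (pt x))"
    define Z where "Z = (\<lambda>x. snd (pt x))"
    have s0: "0 < s x" for x using pt[of x] by (simp add: s_def V_def)
    from polynomial_in_polys[OF p] obtain kp np where
      "\<forall>s (Z :: real \<times> 'a \<Rightarrow> 'a). (\<lambda>x. p (s x, Z x)) \<in> polys s (\<lambda>b x. Z x \<bullet> b) Basis kp np" by (elim exE)
    then have F: "(\<lambda>x. p (s x, Z x)) \<in> polys s (\<lambda>b x. Z x \<bullet> b) Basis kp np" by (elim allE)
    obtain Q where Q: "Q \<noteq> 0" "\<And>x. bieval Q (s x) (p (s x, Z x)) = 0"
    proof (rule elimination[OF finite_Basis _ r_polys _ F, where d = "2 * D - 1" and a = "monom (real (2 * D)) 4"])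
      show "n < 2 * D - 1" by (simp add: D_def)
      show "poly (monom (real (2 * D)) 4) (s x) * (Z x \<bullet> b) ^ (2 * D - 1) = r b (s x, Z x)"
        if "b \<in> Basis" for b x
        using pt[of x] that by (simp add: V_def s_def Z_def poly_monom)
      show "poly (monom (real (2 * D)) 4) (s x) \<noteq> 0" for x
        using s0[of x] by (simp add: poly_monom D_def)
    qed auto
    have "bieval Q (fst x) (p x) = 0" if "x \<in> V" for x
      using Q(2)[of x] that by (simp add: s_def Z_def pt_def)
    then show ?thesis using Q(1) by blast
  qed
  have "\<exists>z. \<forall>y. H s z \<le> H s y" if s: "0 < s" for s
  proof -
    \<comment> \<open>Outside this ball some coordinate is at least
      \<open>1 + H s 0 / s ^ 4\<close>, and the penalty on it alone already reaches
      \<open>H s 0\<close>.\<close>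
    define \<rho> where "\<rho> = real DIM('a) * (1 + H s 0 / s ^ 4)"
    have H0: "s ^ 4 \<le> H s 0" using S_nonneg[of 0] s by (simp add: H_def D_def)
    have "0 < s ^ 4" using s by simp
    then have quot: "0 \<le> H s 0 / s ^ 4" using H0 by (intro divide_nonneg_pos) linarith+
    then have "0 < real DIM('a) * (1 + H s 0 / s ^ 4)" by (intro mult_pos_pos add_pos_nonneg) auto
    then have \<rho>: "0 < \<rho>" by (simp only: \<rho>_def)
    have "continuous_on UNIV (H s)"
      by (intro continuous_at_imp_continuous_on ballI has_derivative_continuous[OF H_deriv])
    then have "continuous_on (cball 0 \<rho>) (H s)" by (rule continuous_on_subset) auto
    then obtain z where z: "z \<in> cball 0 \<rho>" "\<And>y. y \<in> cball 0 \<rho> \<Longrightarrow> H s z \<le> H s y"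
      using continuous_attains_inf[of "cball 0 \<rho>" "H s"] \<rho> by auto
    have "H s z \<le> H s y" for y
    proof (cases "y \<in> cball 0 \<rho>")
      case True
      then show ?thesis by (rule z(2))
    next
      case False
      have "\<exists>b\<in>Basis. 1 + H s 0 / s ^ 4 \<le> \<bar>y \<bullet> b\<bar>"
      proof (rule ccontr)
        assume "\<not> ?thesis"
        then have "(\<Sum>b\<in>Basis. \<bar>y \<bullet> b\<bar>) \<le> (\<Sum>b\<in>(Basis::'a set). 1 + H s 0 / s ^ 4)"
          by (intro sum_mono) auto
        then have "norm y \<le> \<rho>" using norm_le_l1[of y] by (simp add: \<rho>_def)
        then show False using False by simp
      qed
      then obtain b where b: "b \<in> Basis" "1 + H s 0 / s ^ 4 \<le> \<bar>y \<bullet> b\<bar>" by blast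
      have "1 \<le> \<bar>y \<bullet> b\<bar>" using b(2) quot by linarith
      then have "\<bar>y \<bullet> b\<bar> ^ 1 \<le> \<bar>y \<bullet> b\<bar> ^ (2 * D)" by (intro power_increasing) (auto simp: D_def)
      then have "H s 0 / s ^ 4 \<le> (y \<bullet> b) ^ (2 * D)" using b(2) by (simp add: power_even_abs)
      also have "\<dots> \<le> (\<Sum>b\<in>Basis. (y \<bullet> b) ^ (2 * D))" using b(1) even by (intro member_le_sum) auto
      finally have "H s 0 \<le> s ^ 4 * (\<Sum>b\<in>Basis. (y \<bullet> b) ^ (2 * D))" using s by (simp add: field_simps)
      also have "\<dots> \<le> H s y"
        using S_nonneg[of y] s by (simp add: H_def distrib_left add_nonneg_nonneg)
      finally show ?thesis using z(2)[of 0] \<rho> by auto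
    qed
    then show ?thesis by blast
  qed
  then obtain zm where zm: "\<And>s y. 0 < s \<Longrightarrow> H s (zm s) \<le> H s y" by metis
  define m where "m = (\<lambda>s. H s (zm s))"
  have inV: "(s, zm s) \<in> V" if "0 < s" for s using crit zm that by blast
  have m_pos: "0 < m s" if "0 < s" for s
    unfolding m_def H_def using that S_nonneg[of "zm s"] even[of "zm s"]
    by (intro add_nonneg_pos add_nonneg_nonneg mult_nonneg_nonneg mult_pos_pos add_pos_nonneg sum_nonneg) auto
  obtain QH where QH: "QH \<noteq> 0" "\<And>x. x \<in> V \<Longrightarrow> bieval QH (fst x) (H (fst x) (snd x)) = 0"
    using elim[OF H_poly] by blast
  obtain E K \<epsilon>0 where E: "finite E" "0 < \<epsilon>0" and EK:
    "\<And>s u. s \<in> {0<..<\<epsilon>0} \<Longrightarrow> 0 < u \<Longrightarrow> bieval QH s u = 0 \<Longrightarrow> \<exists>q\<in>E. \<bar>ln u - q * ln s\<bar> \<le> K"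
    using bieval_root_exponents[OF QH(1)] by blast
  have exponent: "\<exists>q\<in>E. \<bar>ln (m s) - q * ln s\<bar> \<le> K" if "s \<in> {0<..<\<epsilon>0}" for s
    using EK[OF that, of "m s"] QH(2)[OF inV[of s]] m_pos[of s] that by (simp add: m_def)
  \<comment> \<open>The factor \<open>exp K\<close> absorbs the tolerance of
    \<open>exponent\<close>: once \<open>m s\<close> exceeds \<open>exp K * s ^ 4\<close>, the
    exponent \<open>q\<close> found at \<open>s\<close> satisfies
    \<open>4 * ln s < q * ln s\<close>, that is, \<open>q < 4\<close>.\<close>
  have "\<not> (\<exists>\<^sub>F s in at_right 0. m s \<le> exp K * s ^ 4)"
  proof
    assume freq: "\<exists>\<^sub>F s in at_right 0. m s \<le> exp K * s ^ 4"
    define C0 where "C0 = exp K"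
    define B where "B = max 1 C0"
    have B: "0 < B" "1 \<le> B" "C0 \<le> B" by (auto simp: B_def)
    have small: "s\<^sup>2 * S (zm s) \<le> C0 * s ^ 4" "(f (zm s) - s)\<^sup>2 \<le> C0 * s ^ 4"
      "b \<in> Basis \<Longrightarrow> \<bar>zm s \<bullet> b\<bar> \<le> B" if "0 < s" "m s \<le> exp K * s ^ 4" for s b
    proof -
      have le: "s\<^sup>2 * S (zm s) + (f (zm s) - s)\<^sup>2 + s ^ 4 * (1 + (\<Sum>b\<in>Basis. (zm s \<bullet> b) ^ (2 * D))) \<le> C0 * s ^ 4"
        using that by (simp add: m_def H_def C0_def)
      have nn: "0 \<le> s\<^sup>2 * S (zm s)" "0 \<le> s ^ 4 * (1 + (\<Sum>b\<in>Basis. (zm s \<bullet> b) ^ (2 * D)))"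
        using S_nonneg that even by (auto intro!: mult_nonneg_nonneg add_nonneg_nonneg sum_nonneg)
      show "s\<^sup>2 * S (zm s) \<le> C0 * s ^ 4" "(f (zm s) - s)\<^sup>2 \<le> C0 * s ^ 4"
        using le nn zero_le_power2[of "f (zm s) - s"] by linarith+
      assume b: "b \<in> Basis"
      have "s ^ 4 * (1 + (\<Sum>b\<in>Basis. (zm s \<bullet> b) ^ (2 * D))) \<le> C0 * s ^ 4"
        using le nn zero_le_power2[of "f (zm s) - s"] by linarith
      then have "1 + (\<Sum>b\<in>Basis. (zm s \<bullet> b) ^ (2 * D)) \<le> C0" using that by (simp add: mult.commute)
      moreover have "(zm s \<bullet> b) ^ (2 * D) \<le> (\<Sum>b\<in>Basis. (zm s \<bullet> b) ^ (2 * D))"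
        using b even by (intro member_le_sum) auto
      ultimately have le2: "\<bar>zm s \<bullet> b\<bar> ^ (2 * D) \<le> C0" by (simp add: power_even_abs)
      show "\<bar>zm s \<bullet> b\<bar> \<le> B"
      proof (cases "1 \<le> \<bar>zm s \<bullet> b\<bar>")
        case True
        then have "\<bar>zm s \<bullet> b\<bar> ^ 1 \<le> \<bar>zm s \<bullet> b\<bar> ^ (2 * D)" by (intro power_increasing) (auto simp: D_def)
        then show ?thesis using le2 B by simp
      qed (use B in auto)
    qed
    have "\<forall>b\<in>Basis. \<exists>Qb. Qb \<noteq> 0 \<and> (\<forall>x\<in>V. bieval Qb (fst x) (snd x \<bullet> b) = 0)"
      using elim[OF snd_poly[OF real_polynomial_function.intros(1)[OF bounded_linear_inner_left]]] by blast
    from bchoice[OF this] obtain Qb where Qb: "\<And>b. b \<in> Basis \<Longrightarrow> Qb b \<noteq> 0"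
      "\<And>b x. b \<in> Basis \<Longrightarrow> x \<in> V \<Longrightarrow> bieval (Qb b) (fst x) (snd x \<bullet> b) = 0" by blast
    define branches where "branches = (\<lambda>b \<epsilon> \<Phi>. finite \<Phi> \<and>
      (\<forall>\<rho>\<in>\<Phi>. continuous_on {0<..<\<epsilon>} \<rho> \<and> (\<forall>s\<in>{0<..<\<epsilon>}. bieval (Qb b) s (\<rho> s) = 0)) \<and>
      (\<forall>s\<in>{0<..<\<epsilon>}. \<forall>u. \<bar>u\<bar> \<le> B \<longrightarrow> bieval (Qb b) s u = 0 \<longrightarrow> (\<exists>\<rho>\<in>\<Phi>. u = \<rho> s)))"
    have "\<exists>\<epsilon>>0. \<forall>b\<in>Basis. \<exists>\<Phi>. branches b \<epsilon> \<Phi>"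
    proof (rule finite_common_threshold)
      show "\<exists>\<epsilon>>0. \<exists>\<Phi>. branches b \<epsilon> \<Phi>" if "b \<in> Basis" for b
        unfolding branches_def by (rule algebraic_branches[OF Qb(1)[OF that] B(1)])
      fix b :: 'a and \<delta> \<delta>' :: real
      assume "\<exists>\<Phi>. branches b \<delta> \<Phi>" and le: "\<delta>' \<le> \<delta>"
      then obtain \<Phi> where \<Phi>: "branches b \<delta> \<Phi>" by blast
      have sub: "{0<..<\<delta>'} \<subseteq> {0<..<\<delta>}" using le by auto
      have "branches b \<delta>' \<Phi>"
        unfolding branches_def
      proof (intro conjI ballI)
        show "finite \<Phi>" using \<Phi> by (simp add: branches_def)
        show "continuous_on {0<..<\<delta>'} \<rho>" if "\<rho> \<in> \<Phi>" for \<rho>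
          using \<Phi> that by (intro continuous_on_subset[OF _ sub]) (simp add: branches_def)
        show "bieval (Qb b) s (\<rho> s) = 0" if "\<rho> \<in> \<Phi>" "s \<in> {0<..<\<delta>'}" for \<rho> s
          using \<Phi> that le by (simp add: branches_def)
        show "\<forall>u. \<bar>u\<bar> \<le> B \<longrightarrow> bieval (Qb b) s u = 0 \<longrightarrow> (\<exists>\<rho>\<in>\<Phi>. u = \<rho> s)" if "s \<in> {0<..<\<delta>'}" for s
          using \<Phi> that le by (simp add: branches_def)
      qed
      then show "\<exists>\<Phi>. branches b \<delta>' \<Phi>" by blast
    qed auto
    then obtain \<epsilon> where \<epsilon>: "0 < \<epsilon>" and ex: "\<forall>b\<in>Basis. \<exists>\<Phi>. branches b \<epsilon> \<Phi>" by blast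
    from bchoice[OF ex] obtain \<Phi> where \<Phi>: "\<And>b. b \<in> Basis \<Longrightarrow> branches b \<epsilon> (\<Phi> b)" by blast
    have ev\<epsilon>: "\<forall>\<^sub>F s in at_right 0. s \<in> {0<..<\<epsilon>}"
      using \<epsilon> by (auto simp: eventually_at_right_field)
    have freq2: "\<exists>\<^sub>F s in at_right 0. s \<in> {0<..<\<epsilon>} \<and> m s \<le> exp K * s ^ 4"
      by (rule frequently_eventually_conj[OF freq ev\<epsilon>])
    have "\<exists>\<rho>\<in>Pi\<^sub>E Basis \<Phi>. \<forall>b\<in>Basis. zm s \<bullet> b = \<rho> b s" if s: "s \<in> {0<..<\<epsilon>} \<and> m s \<le> exp K * s ^ 4" for s
    proof -
      have "\<exists>\<rho>\<in>\<Phi> b. zm s \<bullet> b = \<rho> s" if b: "b \<in> Basis" for b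
        using \<Phi>[OF b] small(3)[of s b] Qb(2)[OF b inV[of s]] b s
        unfolding branches_def by simp
      then obtain \<rho> where \<rho>: "\<And>b. b \<in> Basis \<Longrightarrow> \<rho> b \<in> \<Phi> b \<and> zm s \<bullet> b = \<rho> b s" by metis
      then show ?thesis by (intro bexI[of _ "restrict \<rho> Basis"]) auto
    qed
    then have ex_branch: "\<exists>\<^sub>F s in at_right 0. \<exists>\<rho>\<in>Pi\<^sub>E Basis \<Phi>. s \<in> {0<..<\<epsilon>} \<and> m s \<le> exp K * s ^ 4 \<and> (\<forall>b\<in>Basis. zm s \<bullet> b = \<rho> b s)"
      by (intro frequently_elim1[OF freq2]) blast
    have "finite (Pi\<^sub>E Basis \<Phi>)"
      using \<Phi> by (intro finite_PiE) (auto simp: branches_def)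
    \<comment> \<open>The curve \<open>w\<close> follows this combination of branches also at those
      \<open>s\<close> where the minimizer lies elsewhere.\<close>
    from frequently_bex_finite[OF this ex_branch] obtain \<rho> where \<rho>: "\<rho> \<in> Pi\<^sub>E Basis \<Phi>" and freq3:
      "\<exists>\<^sub>F s in at_right 0. s \<in> {0<..<\<epsilon>} \<and> m s \<le> exp K * s ^ 4 \<and> (\<forall>b\<in>Basis. zm s \<bullet> b = \<rho> b s)"
      by (elim bexE)
    define w where "w = (\<lambda>s. \<Sum>b\<in>Basis. \<rho> b s *\<^sub>R b)"
    have wb: "w s \<bullet> b = \<rho> b s" if "b \<in> Basis" for s b using that by (simp add: w_def)
    have alg: "algebraic_on \<epsilon> (\<lambda>s. w s \<bullet> b)" if b: "b \<in> Basis" for b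
    proof -
      have "\<rho> b \<in> \<Phi> b" using \<rho> b by blast
      then show ?thesis
        using \<Phi>[OF b] Qb(1)[OF b] unfolding algebraic_on_def branches_def wb[OF b] by blast
    qed
    have freq4: "\<exists>\<^sub>F s in at_right 0. 0 < s \<and> m s \<le> exp K * s ^ 4 \<and> w s = zm s"
      using freq3
    proof (rule frequently_elim1)
      fix s assume a: "s \<in> {0<..<\<epsilon>} \<and> m s \<le> exp K * s ^ 4 \<and> (\<forall>b\<in>Basis. zm s \<bullet> b = \<rho> b s)"
      then have "w s = zm s" by (intro euclidean_eqI[of "w s"]) (simp add: wb)
      then show "0 < s \<and> m s \<le> exp K * s ^ 4 \<and> w s = zm s" using a by simp
    qed
    \<comment> \<open>The estimates in \<open>small\<close> hold wherever \<open>w s = zm s\<close>.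
      Written with squares instead of absolute values they are polynomial in \<open>s\<close> and
      \<open>w s\<close>, so they extend to all small \<open>s\<close>.\<close>
    have ev1: "\<forall>\<^sub>F s in at_right 0. 0 \<le> (\<lambda>x. C0 * fst x ^ 4 - (fst x)\<^sup>2 * S (snd x)) (s, w s)"
    proof (rule algebraic_frequently_nonneg[OF \<epsilon> alg])
      show "real_polynomial_function (\<lambda>x. C0 * fst x ^ 4 - (fst x)\<^sup>2 * S (snd x))"
        using fst_poly S_poly by (intro real_polynomial_function_diff real_polynomial_function.intros(2,4)
          real_polynomial_function_power snd_poly) auto
      show "\<exists>\<^sub>F s in at_right 0. 0 \<le> C0 * fst (s, w s) ^ 4 - (fst (s, w s))\<^sup>2 * S (snd (s, w s))"
        using freq4 by (rule frequently_elim1) (use small(1) in auto)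
    qed
    have ev2: "\<forall>\<^sub>F s in at_right 0. 0 \<le> (\<lambda>x. C0 * fst x ^ 4 - (f (snd x) - fst x)\<^sup>2) (s, w s)"
    proof (rule algebraic_frequently_nonneg[OF \<epsilon> alg])
      show "real_polynomial_function (\<lambda>x. C0 * fst x ^ 4 - (f (snd x) - fst x)\<^sup>2)"
        using fst_poly f by (intro real_polynomial_function_diff real_polynomial_function.intros(2,4)
          real_polynomial_function_power snd_poly) auto
      show "\<exists>\<^sub>F s in at_right 0. 0 \<le> C0 * fst (s, w s) ^ 4 - (f (snd (s, w s)) - fst (s, w s))\<^sup>2"
        using freq4 by (rule frequently_elim1) (use small(2) in auto)
    qed
    have ev3: "\<forall>\<^sub>F s in at_right 0. 0 \<le> (\<lambda>x. B\<^sup>2 - (snd x \<bullet> b)\<^sup>2) (s, w s)" if b: "b \<in> Basis" for b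
    proof (rule algebraic_frequently_nonneg[OF \<epsilon> alg])
      show "real_polynomial_function (\<lambda>x::real \<times> 'a. B\<^sup>2 - (snd x \<bullet> b)\<^sup>2)"
        by (intro real_polynomial_function_diff real_polynomial_function.intros(2) real_polynomial_function_power
          snd_poly real_polynomial_function.intros(1) bounded_linear_inner_left)
      show "\<exists>\<^sub>F s in at_right 0. 0 \<le> B\<^sup>2 - (snd (s, w s) \<bullet> b)\<^sup>2"
        using freq4
      proof (rule frequently_elim1)
        fix s assume a: "0 < s \<and> m s \<le> exp K * s ^ 4 \<and> w s = zm s"
        then have "\<bar>w s \<bullet> b\<bar> \<le> \<bar>B\<bar>" using small(3)[of s b] b B by simp
        then show "0 \<le> B\<^sup>2 - (snd (s, w s) \<bullet> b)\<^sup>2" by (simp add: abs_le_square_iff)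
      qed
    qed
    have "\<forall>\<^sub>F s in at_right 0. \<forall>b\<in>Basis. 0 \<le> B\<^sup>2 - (w s \<bullet> b)\<^sup>2"
      using ev3 by (intro eventually_ball_finite) auto
    with ev1 ev2 have "\<forall>\<^sub>F s in at_right 0. s\<^sup>2 * S (w s) \<le> C0 * s ^ 4 \<and> (f (w s) - s)\<^sup>2 \<le> C0 * s ^ 4 \<and>
        (\<forall>b\<in>Basis. (w s \<bullet> b)\<^sup>2 \<le> B\<^sup>2)"
      by eventually_elim auto
    then obtain \<epsilon>' where \<epsilon>': "0 < \<epsilon>'" "\<And>s. 0 < s \<Longrightarrow> s < \<epsilon>' \<Longrightarrow> s\<^sup>2 * S (w s) \<le> C0 * s ^ 4 \<and>
        (f (w s) - s)\<^sup>2 \<le> C0 * s ^ 4 \<and> (\<forall>b\<in>Basis. (w s \<bullet> b)\<^sup>2 \<le> B\<^sup>2)"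
      by (auto simp: eventually_at_right_field)
    show False
    proof (rule no_slow_algebraic_curve[of f g "min \<epsilon> \<epsilon>'" B w])
      show "0 < min \<epsilon> \<epsilon>'" "0 \<le> B" using \<epsilon> \<epsilon>' B by auto
      show "algebraic_on (min \<epsilon> \<epsilon>') (\<lambda>s. w s \<bullet> b)" if "b \<in> Basis" for b
        by (rule algebraic_on_mono[OF alg[OF that]]) simp
      show "continuous_on UNIV (g b)" if "b \<in> Basis" for b
        using g[OF that] by (intro continuous_on_polymonial_function) (simp add: real_polynomial_function_eq)
      fix s assume "s \<in> {0<..<min \<epsilon> \<epsilon>'}"
      then have s: "0 < s" "s < \<epsilon>'" by auto
      have C0B: "C0 \<le> B\<^sup>2" using B self_le_power[of B 2] by simp
      have "(f (w s) - s)\<^sup>2 \<le> C0 * s ^ 4" using \<epsilon>'(2)[OF s] by blast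
      also have "\<dots> \<le> B\<^sup>2 * s ^ 4" using C0B by (intro mult_right_mono) auto
      also have "\<dots> = (B * s\<^sup>2)\<^sup>2" by (simp add: power_mult_distrib flip: power_mult)
      finally show "\<bar>f (w s) - s\<bar> \<le> B * s\<^sup>2" using B by (simp add: abs_le_square_iff[symmetric])
      fix b :: 'a assume b: "b \<in> Basis"
      have "(w s \<bullet> b)\<^sup>2 \<le> B\<^sup>2" using \<epsilon>'(2)[OF s] b by blast
      then show "\<bar>w s \<bullet> b\<bar> \<le> B" using B by (simp add: abs_le_square_iff[symmetric])
      have "s\<^sup>2 * S (w s) \<le> s\<^sup>2 * (C0 * s\<^sup>2)"
        using \<epsilon>'(2)[OF s] by (simp add: power4_eq_xxxx power2_eq_square mult_ac)
      then have S_le: "S (w s) \<le> C0 * s\<^sup>2" using s by simp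
      have "(g b (w s))\<^sup>2 \<le> S (w s)" unfolding S_def using b by (intro member_le_sum) auto
      also note S_le
      also have "C0 * s\<^sup>2 \<le> B\<^sup>2 * s\<^sup>2" using C0B by (intro mult_right_mono) auto
      also have "\<dots> = (B * s)\<^sup>2" by (simp add: power_mult_distrib)
      finally show "\<bar>g b (w s)\<bar> \<le> B * s" using B s by (simp add: abs_le_square_iff[symmetric])
    qed (rule df)
  qed
  then have "\<forall>\<^sub>F s in at_right 0. exp K * s ^ 4 < m s"
    by (simp add: frequently_def not_le)
  then obtain \<epsilon>1 where \<epsilon>1: "0 < \<epsilon>1" "\<And>s. 0 < s \<Longrightarrow> s < \<epsilon>1 \<Longrightarrow> exp K * s ^ 4 < m s"
    by (auto simp: eventually_at_right_field)
  \<comment> \<open>Inserting 2 keeps the set nonempty and makes the final exponent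
    \<open>q0 - 2\<close> nonnegative; \<open>q0 < 4\<close> makes it less than 2.\<close>
  define q0 where "q0 = Max (insert 2 {q\<in>E. q < 4})"
  have fin: "finite (insert 2 {q\<in>E. q < 4})" using E by auto
  have q0: "2 \<le> q0" "q0 < 4" using fin by (auto simp: q0_def Max_less_iff)
  have m_low: "exp (- K) * s powr q0 \<le> m s" if s: "0 < s" "s < \<epsilon>0" "s < \<epsilon>1" "s < 1" for s
  proof -
    obtain q where q: "q \<in> E" "\<bar>ln (m s) - q * ln s\<bar> \<le> K" using exponent[of s] s by auto
    have lns: "ln s < 0" using s by simp
    have "ln (exp K * s ^ 4) < ln (m s)" using \<epsilon>1(2)[of s] s m_pos[of s] by (subst ln_less_cancel_iff) auto
    then have "K + 4 * ln s < ln (m s)" using s by (simp add: ln_mult ln_realpow)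
    then have "4 * ln s < q * ln s" using q(2) by linarith
    then have "q < 4" using lns by (simp add: mult_less_cancel_right)
    then have "q \<le> q0" unfolding q0_def using fin q(1) by (intro Max_ge) auto
    then have "q0 * ln s \<le> q * ln s" using lns by (intro mult_right_mono_neg) auto
    then have "- K + q0 * ln s \<le> ln (m s)" using q(2) by linarith
    then have "exp (- K + q0 * ln s) \<le> m s" using m_pos[of s] s by (simp add: ln_ge_iff)
    then show ?thesis using s by (simp add: powr_def exp_add[symmetric])
  qed
  define N where "N = 1 + (\<Sum>b\<in>(Basis::'a set). \<bar>R\<bar> ^ (2 * D))"
  have N: "0 < N" unfolding N_def by (intro add_pos_nonneg sum_nonneg) auto
  \<comment> \<open>The solution of \<open>s powr (4 - q0) * N = exp (- K) / 2\<close>; below it the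
    penalty term uses up at most half of the lower bound for the minimum.\<close>
  define \<epsilon>2 where "\<epsilon>2 = (exp (- K) / (2 * N)) powr (1 / (4 - q0))"
  have "0 < \<epsilon>2" using N by (simp add: \<epsilon>2_def)
  define \<epsilon> where "\<epsilon> = Min {\<epsilon>0, \<epsilon>1, \<epsilon>2, 1}"
  have \<epsilon>: "0 < \<epsilon>" "\<epsilon> \<le> \<epsilon>0" "\<epsilon> \<le> \<epsilon>1" "\<epsilon> \<le> \<epsilon>2" "\<epsilon> \<le> 1"
    using E \<epsilon>1 \<open>0 < \<epsilon>2\<close> by (auto simp: \<epsilon>_def)
  have "exp (- K) / 2 * f z powr (q0 - 2) \<le> S z" if z: "norm z \<le> R" "0 < f z" "f z < \<epsilon>" for z
  proof -
    \<comment> \<open>At the level \<open>s = f z\<close> the middle term of \<open>H s z\<close>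
      vanishes, and the lower bound for the minimum becomes one for \<open>S z\<close>.\<close>
    define s where "s = f z"
    have s: "0 < s" "s < \<epsilon>0" "s < \<epsilon>1" "s < \<epsilon>2" "s < 1" using z \<epsilon> by (auto simp: s_def)
    have "(z \<bullet> b) ^ (2 * D) \<le> \<bar>R\<bar> ^ (2 * D)" if "b \<in> Basis" for b
    proof -
      have "\<bar>z \<bullet> b\<bar> \<le> \<bar>R\<bar>" using Basis_le_norm[OF that, of z] z(1) by linarith
      then have "\<bar>z \<bullet> b\<bar> ^ (2 * D) \<le> \<bar>R\<bar> ^ (2 * D)" by (intro power_mono) auto
      then show ?thesis by (simp add: power_even_abs)
    qed
    then have "1 + (\<Sum>b\<in>Basis. (z \<bullet> b) ^ (2 * D)) \<le> N" unfolding N_def by (intro add_left_mono sum_mono)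
    then have "H s z \<le> s\<^sup>2 * S z + s ^ 4 * N"
      unfolding H_def using s by (simp add: s_def mult_left_mono)
    moreover have "exp (- K) * s powr q0 \<le> H s z"
      using m_low[OF s(1,2,3,5)] zm[OF s(1), of z] by (simp add: m_def)
    ultimately have le: "exp (- K) * s powr q0 \<le> s\<^sup>2 * S z + s ^ 4 * N" by linarith
    have "s powr (4 - q0) \<le> \<epsilon>2 powr (4 - q0)" using s q0 by (intro powr_mono2) auto
    also have "\<dots> = exp (- K) / (2 * N)" using q0 N by (simp add: \<epsilon>2_def powr_powr)
    finally have "s powr (4 - q0) * N \<le> exp (- K) / 2" using N by (simp add: field_simps)
    then have "s powr q0 * (s powr (4 - q0) * N) \<le> s powr q0 * (exp (- K) / 2)" by (intro mult_left_mono) auto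
    moreover have "s powr q0 * s powr (4 - q0) = s ^ 4" using s by (simp add: powr_add[symmetric] powr_numeral)
    then have "s powr q0 * (s powr (4 - q0) * N) = s ^ 4 * N" by (simp only: mult.assoc[symmetric])
    ultimately have "s ^ 4 * N \<le> exp (- K) / 2 * s powr q0" by (simp only: mult.commute)
    then have "exp (- K) / 2 * s powr q0 \<le> s\<^sup>2 * S z" using le by linarith
    moreover have "s powr q0 = s\<^sup>2 * s powr (q0 - 2)"
    proof -
      have "s powr q0 = s powr (2 + (q0 - 2))" by simp
      also have "\<dots> = s powr 2 * s powr (q0 - 2)" by (rule powr_add)
      finally show ?thesis using s by (simp add: powr_numeral)
    qed
    ultimately have "s\<^sup>2 * (exp (- K) / 2 * s powr (q0 - 2)) \<le> s\<^sup>2 * S z"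
      by (simp only: mult.left_commute)
    then show ?thesis using s by (simp add: s_def)
  qed
  then show ?thesis
    using q0 \<epsilon> unfolding S_def
    by (intro exI[of _ "q0 - 2"] exI[of _ "exp (- K) / 2"] exI[of _ \<epsilon>]) auto
qed

section \<open>Convergence of descent sequences\<close>

text \<open>The tangent inequality at \<open>x\<close> for the concave function
  \<open>t powr (1 - \<theta>)\<close>.\<close>

lemma powr_concave_diff:
  fixes x y \<theta> :: real
  assumes "0 < y" "y \<le> x" "0 \<le> \<theta>" "\<theta> < 1"
  shows "(1 - \<theta>) * (x - y) \<le> x powr \<theta> * (x powr (1 - \<theta>) - y powr (1 - \<theta>))"
proof (cases "y = x")
  case False
  then have "\<exists>c. y < c \<and> c < x \<and> x powr (1 - \<theta>) - y powr (1 - \<theta>) = (x - y) * ((1 - \<theta>) * c powr (1 - \<theta> - 1))"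
  proof (intro MVT2)
    fix t assume "y \<le> t" "t \<le> x"
    then show "((\<lambda>x. x powr (1 - \<theta>)) has_real_derivative (1 - \<theta>) * t powr (1 - \<theta> - 1)) (at t)"
      using assms by (intro has_real_derivative_powr) auto
  qed (use assms False in auto)
  then obtain c where c: "y < c" "c < x" "x powr (1 - \<theta>) - y powr (1 - \<theta>) = (x - y) * ((1 - \<theta>) * c powr (- \<theta>))"
    by auto
  have "1 \<le> x powr \<theta> * c powr (- \<theta>)"
  proof -
    have "1 = c powr \<theta> * c powr (- \<theta>)" using assms c by (simp flip: powr_add)
    also have "\<dots> \<le> x powr \<theta> * c powr (- \<theta>)" using assms c by (intro mult_right_mono powr_mono2) auto
    finally show ?thesis .
  qed
  then have "((1 - \<theta>) * (x - y)) * 1 \<le> ((1 - \<theta>) * (x - y)) * (x powr \<theta> * c powr (- \<theta>))"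
    using assms by (intro mult_left_mono) auto
  then show ?thesis unfolding c(3) by (simp add: algebra_simps)
qed auto

text \<open>The Kurdyka-Lojasiewicz argument with the desingularizing function
  \<open>r powr (1 - \<theta>)\<close>. Its concavity turns decrease and gradient bound into an
  estimate of \<open>(\<Delta> (Suc k))\<^sup>2\<close> by the product of \<open>\<Delta> k\<close>
  and a telescoping difference. The inequality of arithmetic and geometric means linearizes this to
  \<open>two\<close>; half of its left side then absorbs the term \<open>\<Delta> k\<close>.\<close>

lemma kl_summable:
  fixes r \<Delta> :: "nat \<Rightarrow> real"
  assumes a: "0 < a" and B: "0 < B" and \<theta>: "0 \<le> \<theta>" "\<theta> < 1"
    and \<Delta>: "\<And>k. 0 \<le> \<Delta> k" and r: "\<And>k. 0 < r k"
    and dec: "\<And>k. a * (\<Delta> k)\<^sup>2 \<le> r k - r (Suc k)"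
    and rel: "\<And>k. r (Suc k) powr \<theta> \<le> B * \<Delta> k"
  shows "summable \<Delta>"
proof -
  define \<psi> where "\<psi> = (\<lambda>k. r k powr (1 - \<theta>))"
  define \<kappa> where "\<kappa> = B / ((1 - \<theta>) * a)"
  have \<kappa>: "0 < \<kappa>" using a B \<theta> by (simp add: \<kappa>_def)
  have mono: "r (Suc k) \<le> r k" for k using dec[of k] a by (smt (verit) mult_nonneg_nonneg zero_le_power2)
  have \<psi>_mono: "\<psi> (Suc k) \<le> \<psi> k" for k unfolding \<psi>_def using mono[of k] r[of "Suc k"] \<theta> by (intro powr_mono2) auto
  have two: "2 * \<Delta> (Suc k) \<le> \<Delta> k + \<kappa> * (\<psi> (Suc k) - \<psi> (Suc (Suc k)))" for k
  proof -
    let ?d = "\<psi> (Suc k) - \<psi> (Suc (Suc k))"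
    have "(1 - \<theta>) * (a * (\<Delta> (Suc k))\<^sup>2) \<le> (1 - \<theta>) * (r (Suc k) - r (Suc (Suc k)))"
      using dec[of "Suc k"] \<theta> by (intro mult_left_mono) auto
    also have "\<dots> \<le> r (Suc k) powr \<theta> * ?d"
      unfolding \<psi>_def using r mono \<theta> by (intro powr_concave_diff) auto
    also have "\<dots> \<le> B * \<Delta> k * ?d"
      using rel[of k] \<psi>_mono[of "Suc k"] by (intro mult_right_mono) auto
    finally have "((1 - \<theta>) * a) * (\<Delta> (Suc k))\<^sup>2 \<le> B * (\<Delta> k * ?d)" by (simp add: mult.assoc)
    moreover have "B = ((1 - \<theta>) * a) * \<kappa>" using a \<theta> by (simp add: \<kappa>_def)
    ultimately have "((1 - \<theta>) * a) * (\<Delta> (Suc k))\<^sup>2 \<le> ((1 - \<theta>) * a) * (\<Delta> k * (\<kappa> * ?d))"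
      by (simp add: mult_ac)
    then have "(\<Delta> (Suc k))\<^sup>2 \<le> \<Delta> k * (\<kappa> * ?d)" using a \<theta> by simp
    then have "(2 * \<Delta> (Suc k))\<^sup>2 \<le> 4 * (\<Delta> k * (\<kappa> * ?d))" by (simp add: power2_eq_square)
    also have "\<dots> \<le> (\<Delta> k + \<kappa> * ?d)\<^sup>2"
      using zero_le_power2[of "\<Delta> k - \<kappa> * ?d"] by (simp add: power2_eq_square algebra_simps)
    finally show ?thesis
      using \<Delta>[of k] \<kappa> \<psi>_mono[of "Suc k"] by (intro power2_le_imp_le[of "2 * \<Delta> (Suc k)"]) auto
  qed
  have "(\<Sum>k<n. \<Delta> (Suc k)) + \<Delta> n \<le> \<Delta> 0 + \<kappa> * (\<psi> (Suc 0) - \<psi> (Suc n))" for n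
  proof (induction n)
    case (Suc n)
    then show ?case using two[of n] by (simp add: algebra_simps)
  qed simp
  moreover have "0 \<le> \<psi> k" for k by (simp add: \<psi>_def)
  ultimately have "(\<Sum>k<n. \<Delta> (Suc k)) \<le> \<Delta> 0 + \<kappa> * \<psi> (Suc 0)" for n
    using \<Delta>[of n] \<kappa> by (smt (verit, best) mult_left_mono)
  then have "summable (\<lambda>k. \<Delta> (Suc k))"
    using \<Delta> by (intro summableI_nonneg_bounded) auto
  then show ?thesis by (simp add: summable_Suc_iff)
qed

text \<open>A gradient bound on the positive coordinates suffices: at each iterate the gradient inequality is
  applied to the restriction of \<open>f\<close> to the face of the orthant that contains the iterate.\<close>

lemma descent_in_orthant_convergent:
  fixes z :: "nat \<Rightarrow> 'a::euclidean_space" and f :: "'a \<Rightarrow> real"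
  assumes f: "real_polynomial_function f"
    and g: "\<And>b. b \<in> Basis \<Longrightarrow> real_polynomial_function (g b)"
    and df: "\<And>z. (f has_derivative (\<lambda>h. \<Sum>b\<in>Basis. g b z * (h \<bullet> b))) (at z)"
    and below: "\<And>k. 0 \<le> f (z k)"
    and nonneg: "\<And>k b. b \<in> Basis \<Longrightarrow> 0 \<le> z k \<bullet> b"
    and bound: "\<And>k. norm (z k) \<le> R"
    and a: "0 < a" and dec: "\<And>k. a * (norm (z (Suc k) - z k))\<^sup>2 \<le> f (z k) - f (z (Suc k))"
    and rel: "\<And>k b. b \<in> Basis \<Longrightarrow> 0 < z (Suc k) \<bullet> b \<Longrightarrow> \<bar>g b (z (Suc k))\<bar> \<le> C * norm (z (Suc k) - z k)"
  shows "convergent z"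
proof -
  have "f (z (Suc k)) \<le> f (z k)" for k using dec[of k] a by (smt (verit) mult_nonneg_nonneg zero_le_power2)
  then have decseq: "decseq (\<lambda>k. f (z k))" by (simp add: decseq_Suc_iff)
  then obtain l where l: "(\<lambda>k. f (z k)) \<longlonglongrightarrow> l" "\<And>k. l \<le> f (z k)"
    using decseq_convergent[of "\<lambda>k. f (z k)" 0] below by blast
  define r where "r = (\<lambda>k. f (z k) - l)"
  have r_nonneg: "0 \<le> r k" for k using l(2) by (simp add: r_def)
  have r0: "r \<longlonglongrightarrow> 0" unfolding r_def using tendsto_diff[OF l(1) tendsto_const[of l]] by simp
  have r_antimono: "r m \<le> r k" if "k \<le> m" for k m using decseq that by (simp add: r_def decseq_def)
  show ?thesis
  \<comment> \<open>If the limit value is attained, the descent makes the sequence stationary.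
    Otherwise all \<open>r k\<close> are positive, as the gradient inequality and
    \<open>kl_summable\<close> demand.\<close>
  proof (cases "\<exists>K. r K = 0")
    case True
    then obtain K where K: "r K = 0" by blast
    have zero: "r k = 0" if "K \<le> k" for k using r_antimono[OF that] r_nonneg[of k] K by simp
    have "z (Suc k) = z k" if "K \<le> k" for k
    proof -
      have "f (z k) - f (z (Suc k)) = 0" using zero[of k] zero[of "Suc k"] that by (simp add: r_def)
      then have "a * (norm (z (Suc k) - z k))\<^sup>2 \<le> 0" using dec[of k] by simp
      then show ?thesis using a by (simp add: mult_le_0_iff)
    qed
    then have const: "z (K + n) = z K" for n by (induction n) auto
    have "z \<longlonglongrightarrow> z K"
    proof (rule LIMSEQ_offset[of _ K])
      show "(\<lambda>n. z (n + K)) \<longlonglongrightarrow> z K" using const by (simp add: add.commute)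
    qed
    then show ?thesis by (rule convergentI)
  next
    case False
    then have r_pos: "0 < r k" for k using r_nonneg[of k] by (metis less_eq_real_def)
    \<comment> \<open>Composing with the projection onto the span of \<open>A\<close> turns the
      restriction to a face into a polynomial on the whole space, whose gradient has only the
      coordinates in \<open>A\<close>.\<close>
    define mask where "mask = (\<lambda>A (x::'a). \<Sum>b\<in>A. (x \<bullet> b) *\<^sub>R b)"
    have mask_inner: "mask A x \<bullet> b = (if b \<in> A then x \<bullet> b else 0)" if "A \<subseteq> Basis" "b \<in> Basis" for A x b
    proof -
      have "finite A" using that finite_subset[OF _ finite_Basis] by blast
      have "mask A x \<bullet> b = (\<Sum>c\<in>A. if c = b then x \<bullet> c else 0)"
        unfolding mask_def inner_sum_left using that by (intro sum.cong) (auto simp: inner_Basis subset_eq)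
      then show ?thesis using \<open>finite A\<close> by simp
    qed
    define KL where "KL = (\<lambda>A \<theta> c \<epsilon>. 0 \<le> \<theta> \<and> \<theta> < 2 \<and> 0 < c \<and> 0 < \<epsilon> \<and>
      (\<forall>x. norm x \<le> R \<longrightarrow> 0 < f (mask A x) - l \<longrightarrow> f (mask A x) - l < \<epsilon> \<longrightarrow>
         c * (f (mask A x) - l) powr \<theta> \<le> (\<Sum>b\<in>Basis. (if b \<in> A then g b (mask A x) else 0)\<^sup>2)))"
    have "\<forall>A\<in>Pow Basis. \<exists>\<theta> c \<epsilon>. KL A \<theta> c \<epsilon>"
    proof
      fix A :: "'a set" assume "A \<in> Pow Basis"
      then have A: "A \<subseteq> Basis" by simp
      have mask_lin: "bounded_linear (mask A)" unfolding mask_def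
        by (intro bounded_linear_sum bounded_linear_compose[OF bounded_linear_scaleR_left bounded_linear_inner_left])
      have comp: "real_polynomial_function (\<lambda>x. p (mask A x))" if "real_polynomial_function p" for p
        using real_polynomial_function_compose[OF polynomial_function_bounded_linear[OF mask_lin] that] by (simp add: o_def)
      show "\<exists>\<theta> c \<epsilon>. KL A \<theta> c \<epsilon>"
        unfolding KL_def
      proof (rule lojasiewicz_gradient)
        show "real_polynomial_function (\<lambda>x. f (mask A x) - l)" by (rule real_polynomial_function_diff[OF comp[OF f] real_polynomial_function.intros(2)])
        show "real_polynomial_function (\<lambda>x. if b \<in> A then g b (mask A x) else 0)" if "b \<in> Basis" for b
          using comp[OF g[OF that]] by (cases "b \<in> A") auto
        fix x
        have "((\<lambda>x. f (mask A x)) has_derivative (\<lambda>h. \<Sum>b\<in>Basis. g b (mask A x) * (mask A h \<bullet> b))) (at x)"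
          by (rule has_derivative_compose[OF bounded_linear_imp_has_derivative[OF mask_lin] df])
        moreover have "(\<lambda>h. \<Sum>b\<in>Basis. g b (mask A x) * (mask A h \<bullet> b)) =
            (\<lambda>h. \<Sum>b\<in>Basis. (if b \<in> A then g b (mask A x) else 0) * (h \<bullet> b))"
          using A by (intro ext sum.cong) (auto simp: mask_inner)
        ultimately have "((\<lambda>x. f (mask A x)) has_derivative
            (\<lambda>h. \<Sum>b\<in>Basis. (if b \<in> A then g b (mask A x) else 0) * (h \<bullet> b))) (at x)" by simp
        from has_derivative_diff[OF this has_derivative_const[of l]]
        show "((\<lambda>x. f (mask A x) - l) has_derivative
            (\<lambda>h. \<Sum>b\<in>Basis. (if b \<in> A then g b (mask A x) else 0) * (h \<bullet> b))) (at x)" by simp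
      qed
    qed
    from bchoice[OF this] obtain \<theta>' where "\<forall>A\<in>Pow Basis. \<exists>c \<epsilon>. KL A (\<theta>' A) c \<epsilon>" by (elim exE)
    from bchoice[OF this] obtain c' where "\<forall>A\<in>Pow Basis. \<exists>\<epsilon>. KL A (\<theta>' A) (c' A) \<epsilon>" by (elim exE)
    from bchoice[OF this] obtain \<epsilon>' where "\<forall>A\<in>Pow Basis. KL A (\<theta>' A) (c' A) (\<epsilon>' A)" by (elim exE)
    note KL = this[unfolded KL_def]
    \<comment> \<open>Below level 1 a power decreases as its exponent grows, so the largest exponent
      and the smallest constant serve all faces; hence the \<open>min 1\<close> in
      \<open>\<epsilon>\<close>.\<close>
    define \<theta> where "\<theta> = Max (\<theta>' ` Pow Basis)"
    define c where "c = Min (c' ` Pow Basis)"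
    define \<epsilon> where "\<epsilon> = min 1 (Min (\<epsilon>' ` Pow Basis))"
    have fin: "finite (Pow (Basis :: 'a set))" "Pow (Basis :: 'a set) \<noteq> {}" by auto
    have \<theta>: "0 \<le> \<theta>" "\<theta> < 2" "\<And>A. A \<in> Pow Basis \<Longrightarrow> \<theta>' A \<le> \<theta>"
    proof -
      show le: "\<theta>' A \<le> \<theta>" if "A \<in> Pow Basis" for A
        unfolding \<theta>_def using fin that by (intro Max_ge) auto
      have "0 \<le> \<theta>' {}" using KL by simp
      also have "\<dots> \<le> \<theta>" by (rule le) simp
      finally show "0 \<le> \<theta>" .
      show "\<theta> < 2" unfolding \<theta>_def using fin KL by (subst Max_less_iff) auto
    qed
    have c: "0 < c" "\<And>A. A \<in> Pow Basis \<Longrightarrow> c \<le> c' A"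
      unfolding c_def using fin KL by (subst Min_gr_iff; auto) auto
    have \<epsilon>: "0 < \<epsilon>" "\<epsilon> \<le> 1" "\<And>A. A \<in> Pow Basis \<Longrightarrow> \<epsilon> \<le> \<epsilon>' A"
    proof -
      have "0 < Min (\<epsilon>' ` Pow Basis)" using fin KL by (subst Min_gr_iff) auto
      then show "0 < \<epsilon>" "\<epsilon> \<le> 1" by (auto simp: \<epsilon>_def)
      show "\<epsilon> \<le> \<epsilon>' A" if "A \<in> Pow Basis" for A
        unfolding \<epsilon>_def using fin that by (intro min.coboundedI2 Min_le) auto
    qed
    have "\<forall>\<^sub>F k in sequentially. r k < \<epsilon>" using order_tendstoD(2)[OF r0 \<epsilon>(1)] .
    then obtain K where K: "\<And>k. K \<le> k \<Longrightarrow> r k < \<epsilon>" by (auto simp: eventually_sequentially)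
    define \<Delta> where "\<Delta> = (\<lambda>k. norm (z (Suc k) - z k))"
    define S where "S = real DIM('a) * C\<^sup>2 / c"
    have S: "0 \<le> S" using c by (simp add: S_def)
    \<comment> \<open>\<open>S\<close> may be zero; the summand 1 provides the positive constant
      that \<open>kl_summable\<close> takes.\<close>
    have main: "r (Suc k) powr (\<theta> / 2) \<le> (sqrt S + 1) * \<Delta> k" if k: "K \<le> k" for k
    proof -
      \<comment> \<open>The support of the new iterate: \<open>mask A\<close> fixes the iterate, and
        \<open>rel\<close> controls exactly these partial derivatives.\<close>
      define A where "A = {b\<in>Basis. 0 < z (Suc k) \<bullet> b}"
      have A: "A \<in> Pow Basis" by (auto simp: A_def)
      have mz: "mask A (z (Suc k)) = z (Suc k)"
      proof (rule euclidean_eqI)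
        fix b :: 'a assume b: "b \<in> Basis"
        have "b \<notin> A \<Longrightarrow> z (Suc k) \<bullet> b = 0" using nonneg[OF b, of "Suc k"] b by (simp add: A_def)
        then show "mask A (z (Suc k)) \<bullet> b = z (Suc k) \<bullet> b" using A b by (simp add: mask_inner)
      qed
      have rk: "0 < r (Suc k)" "r (Suc k) < \<epsilon>" using r_pos K[of "Suc k"] k by auto
      have "c * r (Suc k) powr \<theta> \<le> c' A * r (Suc k) powr \<theta>' A"
        using c(2)[OF A] c(1) \<theta>(3)[OF A] rk \<epsilon>(2) by (intro mult_mono powr_mono') auto
      also have "\<dots> \<le> (\<Sum>b\<in>Basis. (if b \<in> A then g b (z (Suc k)) else 0)\<^sup>2)"
      proof -
        have "norm x \<le> R \<Longrightarrow> 0 < f (mask A x) - l \<Longrightarrow> f (mask A x) - l < \<epsilon>' A \<Longrightarrow>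
         c' A * (f (mask A x) - l) powr \<theta>' A \<le> (\<Sum>b\<in>Basis. (if b \<in> A then g b (mask A x) else 0)\<^sup>2)" for x
          using KL A by blast
        from this[of "z (Suc k)"] show ?thesis
          using bound[of "Suc k"] rk \<epsilon>(3)[OF A] unfolding mz r_def by linarith
      qed
      also have "\<dots> \<le> (\<Sum>b\<in>(Basis::'a set). C\<^sup>2 * (\<Delta> k)\<^sup>2)"
      proof (intro sum_mono)
        fix b :: 'a assume b: "b \<in> Basis"
        show "(if b \<in> A then g b (z (Suc k)) else 0)\<^sup>2 \<le> C\<^sup>2 * (\<Delta> k)\<^sup>2"
        proof (cases "b \<in> A")
          case True
          then have "\<bar>g b (z (Suc k))\<bar> \<le> \<bar>C * \<Delta> k\<bar>" using rel[OF b, of k] by (auto simp: A_def \<Delta>_def)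
          then show ?thesis using True by (simp add: abs_le_square_iff power_mult_distrib)
        qed auto
      qed
      also have "\<dots> = c * (S * (\<Delta> k)\<^sup>2)" using c by (simp add: S_def)
      finally have "r (Suc k) powr \<theta> \<le> S * (\<Delta> k)\<^sup>2" using c by simp
      moreover have "(r (Suc k) powr (\<theta> / 2))\<^sup>2 = r (Suc k) powr \<theta>"
        using rk by (simp add: power2_eq_square flip: powr_add)
      ultimately have "(r (Suc k) powr (\<theta> / 2))\<^sup>2 \<le> (sqrt S * \<Delta> k)\<^sup>2" using S by (simp add: power_mult_distrib)
      then have "r (Suc k) powr (\<theta> / 2) \<le> sqrt S * \<Delta> k"
        by (rule power2_le_imp_le) (simp add: S \<Delta>_def)
      also have "\<dots> \<le> (sqrt S + 1) * \<Delta> k" by (intro mult_right_mono) (auto simp: \<Delta>_def)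
      finally show ?thesis .
    qed
    have "summable (\<lambda>k. \<Delta> (k + K))"
    proof (rule kl_summable[of a "sqrt S + 1" "\<theta> / 2" _ "\<lambda>k. r (k + K)"])
      show "a * (\<Delta> (k + K))\<^sup>2 \<le> r (k + K) - r (Suc k + K)" for k
        using dec[of "k + K"] by (simp add: r_def \<Delta>_def)
      show "r (Suc k + K) powr (\<theta> / 2) \<le> (sqrt S + 1) * \<Delta> (k + K)" for k using main[of "k + K"] by simp
      show "0 < sqrt S + 1" using S by (simp add: add_nonneg_pos)
    qed (use a \<theta> r_pos in \<open>auto simp: \<Delta>_def\<close>)
    then have "summable \<Delta>" by (rule summable_iff_shift[THEN iffD1])
    then have "summable (\<lambda>k. z (Suc k) - z k)" unfolding \<Delta>_def by (rule summable_norm_cancel)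
    then obtain d where "(\<lambda>n. \<Sum>k<n. z (Suc k) - z k) \<longlonglongrightarrow> d" unfolding summable_def sums_def by blast
    then have "(\<lambda>n. z n - z 0) \<longlonglongrightarrow> d" by (simp add: sum_lessThan_telescope)
    then have "(\<lambda>n. (z n - z 0) + z 0) \<longlonglongrightarrow> d + z 0" by (intro tendsto_add tendsto_const)
    then show ?thesis by (auto intro: convergentI)
  qed
qed

section \<open>One update of a pair of columns\<close>

declare transpose_matrix_vector [simp del]

section \<open>Rank-one matrices and matrix-vector bounds\<close>

definition outer :: "real ^ 'm \<Rightarrow> real ^ 'n \<Rightarrow> real ^ 'n ^ 'm" where
  "outer x y = (\<chi> a b. x $ a * y $ b)"

lemma outer_mult_vec: "outer x y *v v = (y \<bullet> v) *\<^sub>R x"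
  by (simp add: outer_def vec_eq_iff matrix_vector_mult_def inner_vec_def sum_distrib_left mult_ac)

lemma transpose_outer_mult_vec: "transpose (outer x y) *v u = (x \<bullet> u) *\<^sub>R y"
  by (simp add: outer_def vec_eq_iff matrix_vector_mult_def transpose_def inner_vec_def sum_distrib_left mult_ac)

lemma inner_outer: "R \<bullet> outer x y = x \<bullet> (R *v y)"
  by (simp add: outer_def inner_vec_def matrix_vector_mult_def sum_distrib_left mult_ac)

lemma norm_outer: "norm (outer x y) = norm x * norm y"
proof -
  have "(norm (outer x y))\<^sup>2 = (norm x * norm y)\<^sup>2"
    by (simp add: power2_norm_eq_inner inner_outer outer_mult_vec power_mult_distrib)
  then show ?thesis by (simp add: power2_eq_iff_nonneg)
qed

lemma outer_diff: "outer x' y' - outer x y = outer x' (y' - y) + outer (x' - x) y"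
  by (simp add: outer_def vec_eq_iff algebra_simps)

lemma inner_transpose_mult_vec: "y \<bullet> (transpose R *v u) = (R *v y) \<bullet> (u :: real ^ 'm)"
  for R :: "real ^ 'n ^ 'm"
  by (metis dot_lmul_matrix inner_commute transpose_matrix_vector)

lemma norm_matrix_mult_vec_le: "norm (R *v y) \<le> norm R * norm y"
  for R :: "real ^ 'n ^ 'm"
proof (rule power2_le_imp_le)
  have "(norm (R *v y))\<^sup>2 = (\<Sum>a\<in>UNIV. (R $ a \<bullet> y)\<^sup>2)"
    unfolding power2_norm_eq_inner by (simp add: inner_vec_def matrix_vector_mult_def power2_eq_square)
  also have "\<dots> \<le> (\<Sum>a\<in>UNIV. (R $ a \<bullet> R $ a) * (y \<bullet> y))"
    by (intro sum_mono Cauchy_Schwarz_ineq)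
  also have "\<dots> = (norm R * norm y)\<^sup>2"
    unfolding power_mult_distrib power2_norm_eq_inner
    by (simp add: sum_distrib_right inner_vec_def[of R])
  finally show "(norm (R *v y))\<^sup>2 \<le> (norm R * norm y)\<^sup>2" .
qed simp

lemma norm_transpose_mult_vec_le: "norm (transpose R *v u) \<le> norm R * norm u"
  for R :: "real ^ 'n ^ 'm"
proof -
  let ?t = "transpose R *v u"
  have "norm ?t * norm ?t = ?t \<bullet> ?t" by (simp flip: power2_norm_eq_inner add: power2_eq_square)
  also have "\<dots> = (R *v ?t) \<bullet> u" by (rule inner_transpose_mult_vec)
  also have "\<dots> \<le> norm (R *v ?t) * norm u" by (rule norm_cauchy_schwarz)
  also have "\<dots> \<le> (norm R * norm ?t) * norm u" by (intro mult_right_mono norm_matrix_mult_vec_le) auto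
  finally have "norm ?t * norm ?t \<le> (norm R * norm u) * norm ?t" by (simp add: mult_ac)
  then show ?thesis by (cases "norm ?t = 0") (auto simp: mult_le_cancel_right)
qed

lemma inner_nonneg_vec: "0 \<le> (x :: real ^ 'm) \<Longrightarrow> 0 \<le> y \<Longrightarrow> 0 \<le> x \<bullet> y"
  by (auto simp: inner_vec_def less_eq_vec_def intro!: sum_nonneg)

section \<open>Optimality conditions on the orthant and on the sphere\<close>

lemma complementary_vec:
  assumes "0 \<le> (x :: real ^ 'm)" "0 \<le> \<nu>" "x \<bullet> \<nu> \<le> 0"
  shows "x $ a = 0 \<or> \<nu> $ a = 0"
proof -
  have nn: "0 \<le> x $ a * \<nu> $ a" for a using assms by (simp add: less_eq_vec_def)
  then have "(\<Sum>a\<in>UNIV. x $ a * \<nu> $ a) = 0"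
    using assms(3) by (intro order_antisym sum_nonneg) (auto simp: inner_vec_def)
  then have "x $ a * \<nu> $ a = 0" using nn by (subst (asm) sum_nonneg_eq_0_iff) auto
  then show ?thesis by simp
qed

text \<open>On the nonnegative cone \<open>v \<bullet> u \<le> (v \<bullet> x') * norm u\<close> by homogeneity; this is the first-order
  condition of that inequality at \<open>x'\<close>.\<close>

lemma sphere_orthant_max:
  fixes v x' u :: "real ^ 'm"
  assumes x': "0 \<le> x'" "norm x' = 1"
    and max: "\<And>u. 0 \<le> u \<Longrightarrow> norm u = 1 \<Longrightarrow> v \<bullet> u \<le> v \<bullet> x'" and u: "0 \<le> u"
  shows "v \<bullet> u \<le> (v \<bullet> x') * (x' \<bullet> u)"
proof -
  define \<kappa> where "\<kappa> = v \<bullet> x'"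
  have x'x': "x' \<bullet> x' = 1" using x'(2) by (simp flip: power2_norm_eq_inner)
  have homog: "v \<bullet> w \<le> \<kappa> * norm w" if w: "0 \<le> w" for w
  proof (cases "w = 0")
    case False
    have "0 \<le> (1 / norm w) *\<^sub>R w" using w by (simp add: less_eq_vec_def)
    then have "v \<bullet> ((1 / norm w) *\<^sub>R w) \<le> \<kappa>" unfolding \<kappa>_def using False by (intro max) auto
    then show ?thesis using False by (simp add: field_simps)
  qed simp
  have step: "v \<bullet> u \<le> \<kappa> * (x' \<bullet> u) + t * (\<bar>\<kappa>\<bar> * (norm u)\<^sup>2)" if t: "0 < t" for t
  proof -
    have w: "0 \<le> x' + t *\<^sub>R u" using x' u t by (simp add: less_eq_vec_def)
    have norm2: "(norm (x' + t *\<^sub>R u))\<^sup>2 = 1 + 2 * t * (x' \<bullet> u) + t\<^sup>2 * (norm u)\<^sup>2"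
      unfolding power2_norm_eq_inner
      by (simp add: inner_add_left inner_add_right x'x' inner_commute power2_eq_square algebra_simps)
    have xu: "0 \<le> x' \<bullet> u" using x' u by (intro inner_nonneg_vec)
    \<comment> \<open>Both bounds on the norm are required, because \<open>\<kappa>\<close> may have
      either sign.\<close>
    have lower: "1 + t * (x' \<bullet> u) \<le> norm (x' + t *\<^sub>R u)"
      using norm_cauchy_schwarz[of x' "x' + t *\<^sub>R u"] x' by (simp add: inner_add_right x'x')
    have upper: "norm (x' + t *\<^sub>R u) \<le> 1 + t * (x' \<bullet> u) + t\<^sup>2 * (norm u)\<^sup>2"
    proof (rule power2_le_imp_le)
      let ?p = "t * (x' \<bullet> u)" and ?q = "t\<^sup>2 * (norm u)\<^sup>2"
      have "0 \<le> ?p" "0 \<le> ?q" using xu t by auto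
      moreover have "(1 + p + q)\<^sup>2 = 1 + 2 * p + q + (q + (p + q)\<^sup>2)" for p q :: real
        by (simp add: power2_eq_square algebra_simps)
      from this[of ?p ?q] have "1 + 2 * ?p + ?q \<le> (1 + ?p + ?q)\<^sup>2"
        using \<open>0 \<le> ?q\<close> zero_le_power2[of "?p + ?q"] by linarith
      then show "(norm (x' + t *\<^sub>R u))\<^sup>2 \<le> (1 + ?p + ?q)\<^sup>2" unfolding norm2 by simp
      show "0 \<le> 1 + ?p + ?q" using \<open>0 \<le> ?p\<close> \<open>0 \<le> ?q\<close> by simp
    qed
    have "\<kappa> + t * (v \<bullet> u) \<le> \<kappa> * norm (x' + t *\<^sub>R u)"
      using homog[OF w] by (simp add: inner_add_right \<kappa>_def)
    also have "\<dots> \<le> \<kappa> * (1 + t * (x' \<bullet> u)) + \<bar>\<kappa>\<bar> * (t\<^sup>2 * (norm u)\<^sup>2)"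
    proof (cases "0 \<le> \<kappa>")
      case True
      then have "\<kappa> * norm (x' + t *\<^sub>R u) \<le> \<kappa> * (1 + t * (x' \<bullet> u) + t\<^sup>2 * (norm u)\<^sup>2)"
        using upper by (intro mult_left_mono)
      then show ?thesis using True by (simp add: algebra_simps)
    next
      case False
      then have "\<kappa> * norm (x' + t *\<^sub>R u) \<le> \<kappa> * (1 + t * (x' \<bullet> u))"
        using lower by (intro mult_left_mono_neg) auto
      also have "\<dots> \<le> \<kappa> * (1 + t * (x' \<bullet> u)) + \<bar>\<kappa>\<bar> * (t\<^sup>2 * (norm u)\<^sup>2)" by simp
      finally show ?thesis .
    qed
    finally have "t * (v \<bullet> u) \<le> t * (\<kappa> * (x' \<bullet> u) + t * (\<bar>\<kappa>\<bar> * (norm u)\<^sup>2))"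
      by (simp add: power2_eq_square algebra_simps)
    then show ?thesis using t by simp
  qed
  have "((\<lambda>t. \<kappa> * (x' \<bullet> u) + t * (\<bar>\<kappa>\<bar> * (norm u)\<^sup>2)) \<longlongrightarrow> \<kappa> * (x' \<bullet> u) + 0 * (\<bar>\<kappa>\<bar> * (norm u)\<^sup>2)) (at_right 0)"
    by (intro tendsto_intros)
  moreover have "\<forall>\<^sub>F t in at_right 0. v \<bullet> u \<le> \<kappa> * (x' \<bullet> u) + t * (\<bar>\<kappa>\<bar> * (norm u)\<^sup>2)"
    using step by (auto simp: eventually_at_right_field intro: exI[of _ 1])
  ultimately have "v \<bullet> u \<le> \<kappa> * (x' \<bullet> u) + 0 * (\<bar>\<kappa>\<bar> * (norm u)\<^sup>2)"
    by (intro tendsto_lowerbound) auto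
  then show ?thesis by (simp add: \<kappa>_def)
qed

text \<open>The minimum is compared with the points of the segment towards \<open>v\<close>;
  dividing by the step \<open>t\<close> and letting it tend to zero leaves the first-order
  term.\<close>

lemma orthant_quadratic_min:
  fixes c y' v :: "real ^ 'n"
  assumes y': "0 \<le> y'"
    and min: "\<And>v. 0 \<le> v \<Longrightarrow> 1 / 2 * (norm y')\<^sup>2 + y' \<bullet> c \<le> 1 / 2 * (norm v)\<^sup>2 + v \<bullet> c" and v: "0 \<le> v"
  shows "0 \<le> (y' + c) \<bullet> (v - y')"
proof -
  have step: "0 \<le> (y' + c) \<bullet> (v - y') + t * (1 / 2 * (norm (v - y'))\<^sup>2)" if t: "0 < t" "t < 1" for t
  proof -
    have "0 \<le> y' $ a + t * (v $ a - y' $ a)" for a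
    proof -
      have "0 \<le> (1 - t) * y' $ a + t * v $ a" using y' v t by (simp add: less_eq_vec_def)
      then show ?thesis by (simp add: algebra_simps)
    qed
    then have "0 \<le> y' + t *\<^sub>R (v - y')" by (simp add: less_eq_vec_def)
    from min[OF this] have "0 \<le> t * ((y' + c) \<bullet> (v - y') + t * (1 / 2 * (norm (v - y'))\<^sup>2))"
      unfolding power2_norm_eq_inner
      by (simp add: inner_add_left inner_add_right inner_diff_left inner_diff_right inner_commute algebra_simps)
    then show ?thesis using t by (simp add: zero_le_mult_iff)
  qed
  have "((\<lambda>t. (y' + c) \<bullet> (v - y') + t * (1 / 2 * (norm (v - y'))\<^sup>2)) \<longlongrightarrow>
      (y' + c) \<bullet> (v - y') + 0 * (1 / 2 * (norm (v - y'))\<^sup>2)) (at_right 0)"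
    by (intro tendsto_intros)
  moreover have "\<forall>\<^sub>F t in at_right 0. 0 \<le> (y' + c) \<bullet> (v - y') + t * (1 / 2 * (norm (v - y'))\<^sup>2)"
    using step by (auto simp: eventually_at_right_field intro!: exI[of _ 1])
  ultimately have "0 \<le> (y' + c) \<bullet> (v - y') + 0 * (1 / 2 * (norm (v - y'))\<^sup>2)"
    by (intro tendsto_lowerbound) auto
  then show ?thesis by simp
qed

text \<open>\<open>R\<close> is the residual without the pair that is updated, so
  \<open>R + outer x y\<close> and \<open>R + outer x' y'\<close> are the residuals before and after
  the step.\<close>

locale rri_step =
  fixes R :: "real ^ 'n ^ 'm" and x x' :: "real ^ 'm" and y y' :: "real ^ 'n" and Lmin L :: real
  assumes x: "0 \<le> x" "norm x = 1" and y: "0 \<le> y" and Lmin: "0 < Lmin"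
    and L: "Lmin \<le> L" "(norm y)\<^sup>2 \<le> L"
    and x'_min: "is_arg_min (\<lambda>u. L / 2 * (norm (u - x))\<^sup>2 + y \<bullet> (transpose (R + outer x y) *v u))
      (\<lambda>u. 0 \<le> u \<and> norm u = 1) x'"
    and y'_min: "is_arg_min (\<lambda>v. 1 / 2 * (norm v)\<^sup>2 + v \<bullet> (transpose R *v x')) (\<lambda>v. 0 \<le> v) y'"
begin

text \<open>Since \<open>x\<close> and \<open>u\<close> are unit vectors, the quadratic part of the
  \<open>x\<close> objective is affine in \<open>u\<close>, and the objective equals
  \<open>L - v \<bullet> u\<close>. \<open>lam\<close> is the multiplier of the sphere,
  \<open>\<nu>\<close> that of \<open>x' \<ge> 0\<close>, and \<open>\<sigma>\<close>, the gradient
  of the \<open>y\<close> objective at \<open>y'\<close>, that of \<open>y' \<ge> 0\<close>.\<close>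

definition "v = (L - (norm y)\<^sup>2) *\<^sub>R x - R *v y"
definition "lam = v \<bullet> x'"
definition "\<nu> = lam *\<^sub>R x' - v"
definition "\<sigma> = y' + transpose R *v x'"

lemma x': "0 \<le> x'" "norm x' = 1" and y': "0 \<le> y'"
  using x'_min y'_min by (auto simp: is_arg_min_def)

lemma xx: "x \<bullet> x = 1" "x' \<bullet> x' = 1"
  using x x' by (simp_all flip: power2_norm_eq_inner)

lemma x'_max: "0 \<le> u \<Longrightarrow> norm u = 1 \<Longrightarrow> v \<bullet> u \<le> v \<bullet> x'"
proof -
  have obj: "L / 2 * (norm (u - x))\<^sup>2 + y \<bullet> (transpose (R + outer x y) *v u) = L - v \<bullet> u" if "norm u = 1" for u
  proof -
    have "u \<bullet> u = 1" using that by (simp flip: power2_norm_eq_inner)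
    then have n: "(norm (u - x))\<^sup>2 = 2 - 2 * (x \<bullet> u)"
      by (simp add: power2_norm_eq_inner inner_diff_left inner_diff_right xx inner_commute)
    have o: "y \<bullet> (transpose (R + outer x y) *v u) = (R *v y) \<bullet> u + (norm y)\<^sup>2 * (x \<bullet> u)"
      unfolding inner_transpose_mult_vec
      by (simp add: matrix_vector_mult_add_rdistrib outer_mult_vec inner_add_left power2_norm_eq_inner)
    show ?thesis unfolding n o v_def by (simp add: inner_diff_left algebra_simps)
  qed
  show ?thesis if "0 \<le> u" "norm u = 1"
  proof -
    have "\<not> L / 2 * (norm (u - x))\<^sup>2 + y \<bullet> (transpose (R + outer x y) *v u) <
        L / 2 * (norm (x' - x))\<^sup>2 + y \<bullet> (transpose (R + outer x y) *v x')"
      using x'_min that unfolding is_arg_min_def by blast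
    then show ?thesis unfolding obj[OF that(2)] obj[OF x'(2)] by simp
  qed
qed

lemma v_le: "0 \<le> u \<Longrightarrow> v \<bullet> u \<le> lam * (x' \<bullet> u)"
  unfolding lam_def using x' x'_max by (rule sphere_orthant_max)

lemma y'_opt: "0 \<le> w \<Longrightarrow> 0 \<le> \<sigma> \<bullet> (w - y')"
  unfolding \<sigma>_def
proof (rule orthant_quadratic_min[OF y'])
  show "1 / 2 * (norm y')\<^sup>2 + y' \<bullet> (transpose R *v x') \<le> 1 / 2 * (norm v)\<^sup>2 + v \<bullet> (transpose R *v x')" if "0 \<le> v" for v
    using y'_min that unfolding is_arg_min_def by (meson not_less)
qed

lemma \<sigma>_nonneg: "0 \<le> \<sigma>"
proof -
  have "0 \<le> \<sigma> $ b" for b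
  proof -
    have "0 \<le> y' + axis b 1" using y' by (auto simp: less_eq_vec_def axis_def)
    from y'_opt[OF this] show ?thesis by (simp add: inner_axis)
  qed
  then show ?thesis by (simp add: less_eq_vec_def)
qed

lemma \<sigma>_y': "\<sigma> \<bullet> y' = 0"
  using y'_opt[of 0] inner_nonneg_vec[OF \<sigma>_nonneg y'] by simp

lemma \<nu>_nonneg: "0 \<le> \<nu>"
proof -
  have "0 \<le> \<nu> $ a" for a
  proof -
    have "0 \<le> (axis a 1 :: real ^ 'm)" by (auto simp: less_eq_vec_def axis_def)
    from v_le[OF this] show ?thesis by (simp add: inner_axis \<nu>_def)
  qed
  then show ?thesis by (simp add: less_eq_vec_def)
qed

lemma x'_\<nu>: "x' \<bullet> \<nu> = 0"
  unfolding \<nu>_def by (simp add: inner_diff_right xx lam_def inner_commute)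

lemma Ry: "R *v y = \<nu> - lam *\<^sub>R x' + (L - (norm y)\<^sup>2) *\<^sub>R x"
  unfolding \<nu>_def v_def by simp

text \<open>The decrease of half the squared residual by passing from \<open>x\<close> to
  \<open>x'\<close> with \<open>y\<close> kept, and then from \<open>y\<close> to \<open>y'\<close>
  with \<open>x'\<close> kept.\<close>

definition "dec_x = (R *v y) \<bullet> (x - x')"
definition "dec_y = (R *v y) \<bullet> x' + 1 / 2 * (norm y)\<^sup>2 + 1 / 2 * (norm y')\<^sup>2"

lemma half_norm_residual:
  "1 / 2 * (norm (R + outer x y))\<^sup>2 = 1 / 2 * (norm R)\<^sup>2 + (R *v y) \<bullet> x + 1 / 2 * (norm y)\<^sup>2"
proof -
  have "(norm (R + outer x y))\<^sup>2 = (norm R)\<^sup>2 + 2 * (R \<bullet> outer x y) + (norm (outer x y))\<^sup>2"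
    by (simp add: power2_norm_eq_inner inner_add_left inner_add_right inner_commute)
  then show ?thesis using x by (simp add: inner_outer norm_outer inner_commute)
qed

lemma y'_residual: "(R *v y') \<bullet> x' = - (norm y')\<^sup>2"
proof -
  have "(R *v y') \<bullet> x' = y' \<bullet> (transpose R *v x')" by (simp add: inner_transpose_mult_vec)
  also have "transpose R *v x' = \<sigma> - y'" by (simp add: \<sigma>_def)
  finally show ?thesis using \<sigma>_y' by (simp add: inner_diff_right inner_commute power2_norm_eq_inner)
qed

lemma half_norm_residual_y':
  "1 / 2 * (norm (R + outer x' y'))\<^sup>2 = 1 / 2 * (norm R)\<^sup>2 - 1 / 2 * (norm y')\<^sup>2"
proof -
  have "(norm (R + outer x' y'))\<^sup>2 = (norm R)\<^sup>2 + 2 * (R \<bullet> outer x' y') + (norm (outer x' y'))\<^sup>2"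
    by (simp add: power2_norm_eq_inner inner_add_left inner_add_right inner_commute)
  moreover have "R \<bullet> outer x' y' = - (norm y')\<^sup>2" using y'_residual by (simp add: inner_outer inner_commute)
  ultimately show ?thesis using x' by (simp add: norm_outer)
qed

lemma decrease: "1 / 2 * (norm (R + outer x y))\<^sup>2 - 1 / 2 * (norm (R + outer x' y'))\<^sup>2 = dec_x + dec_y"
  unfolding half_norm_residual half_norm_residual_y' dec_x_def dec_y_def
  by (simp add: inner_diff_right)

text \<open>The \<open>y\<close> objective is quadratic with unit Hessian, and its first-order term
  \<open>\<sigma> \<bullet> (y - y')\<close> is nonnegative by complementarity.\<close>

lemma dec_y_ge: "1 / 2 * (norm (y' - y))\<^sup>2 \<le> dec_y"
proof -
  have "(R *v y) \<bullet> x' = y \<bullet> (\<sigma> - y')" by (simp add: \<sigma>_def inner_transpose_mult_vec)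
  moreover have "0 \<le> \<sigma> \<bullet> y" using y \<sigma>_nonneg by (rule inner_nonneg_vec[rotated])
  moreover have "(norm (y' - y))\<^sup>2 = (norm y)\<^sup>2 - 2 * (y \<bullet> y') + (norm y')\<^sup>2"
    by (simp add: power2_norm_eq_inner inner_diff_left inner_diff_right inner_commute)
  ultimately show ?thesis unfolding dec_y_def by (simp add: inner_diff_right inner_commute)
qed

lemma norm_x_diff: "(norm (x' - x))\<^sup>2 = 2 * (1 - x' \<bullet> x)"
  by (simp add: power2_norm_eq_inner inner_diff_left inner_diff_right xx inner_commute)

lemma dec_x_eq: "dec_x = (L - (norm y)\<^sup>2) * (1 - x' \<bullet> x) + (lam - v \<bullet> x)"
proof -
  have eq: "R *v y = (L - (norm y)\<^sup>2) *\<^sub>R x - v" by (simp add: v_def)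
  show ?thesis unfolding dec_x_def lam_def eq
    by (simp add: inner_diff_left inner_diff_right xx inner_commute algebra_simps)
qed

text \<open>\<open>v_le\<close> at \<open>u = x\<close> shows that \<open>lam\<close> acts as
  curvature along the sphere, in addition to the \<open>L - (norm y)\<^sup>2\<close> left from the
  proximal term.\<close>

lemma dec_x_ge: "(L - (norm y)\<^sup>2 + lam) / 2 * (norm (x' - x))\<^sup>2 \<le> dec_x"
proof -
  have le: "lam * (1 - x' \<bullet> x) \<le> lam - v \<bullet> x" using v_le[OF x(1)] by (simp add: algebra_simps)
  have "(a + b) / 2 * (2 * d) = a * d + b * d" for a b d :: real by (simp add: algebra_simps)
  from this[of "L - (norm y)\<^sup>2" lam "1 - x' \<bullet> x"] le show ?thesis
    unfolding norm_x_diff dec_x_eq by linarith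
qed

lemma dec_x_nonneg: "0 \<le> dec_x"
proof -
  have "x' \<bullet> x \<le> norm x' * norm x" by (rule norm_cauchy_schwarz)
  then have "0 \<le> (L - (norm y)\<^sup>2) * (1 - x' \<bullet> x)" using L x x' by simp
  moreover have "v \<bullet> x \<le> lam" unfolding lam_def using x by (intro x'_max)
  ultimately show ?thesis unfolding dec_x_eq by simp
qed

lemma dec_y_nonneg: "0 \<le> dec_y"
  using dec_y_ge zero_le_power2[of "norm (y' - y)"] by linarith

text \<open>If \<open>lam\<close> were small, the update of \<open>y\<close> would decrease the objective by at least
  \<open>Lmin / 4\<close>.\<close>

lemma sufficient_decrease:
  assumes "dec_x + dec_y \<le> Lmin / 4"
  shows "Lmin / 8 * (norm (x' - x))\<^sup>2 + 1 / 2 * (norm (y' - y))\<^sup>2 \<le> dec_x + dec_y"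
proof -
  \<comment> \<open>Nonnegativity of both columns allows the proximal part of \<open>lam\<close> to
    be dropped.\<close>
  have "0 \<le> x \<bullet> x'" using x x' by (intro inner_nonneg_vec)
  then have "0 \<le> (L - (norm y)\<^sup>2) * (x \<bullet> x')" using L by simp
  then have "- ((R *v y) \<bullet> x') \<le> lam" by (simp add: lam_def v_def inner_diff_left)
  moreover have "dec_y \<le> Lmin / 4" using assms dec_x_nonneg by simp
  moreover have "- ((R *v y) \<bullet> x') = 1 / 2 * (norm y)\<^sup>2 + 1 / 2 * (norm y')\<^sup>2 - dec_y" by (simp add: dec_y_def)
  \<comment> \<open>\<open>lam\<close> is at least \<open>(norm y)\<^sup>2 / 2 - Lmin / 4\<close>,
    so the right side is at least \<open>L - (norm y)\<^sup>2 / 2 - Lmin / 4\<close>, hence at least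
    \<open>L / 2 - Lmin / 4\<close>.\<close>
  ultimately have "Lmin / 4 \<le> L - (norm y)\<^sup>2 + lam"
    using L zero_le_power2[of "norm y'"] by linarith
  then have "Lmin / 8 * (norm (x' - x))\<^sup>2 \<le> (L - (norm y)\<^sup>2 + lam) / 2 * (norm (x' - x))\<^sup>2"
    by (intro mult_right_mono) auto
  then show ?thesis using dec_x_ge dec_y_ge by linarith
qed

text \<open>With \<open>E\<close> the change of the residual after this step, the following are the columns of the gradient
  at the end of the cycle. No multiplier for the sphere remains: by complementarity of
  \<open>y'\<close> the radial component of the gradient in \<open>x'\<close> is negligible.\<close>

lemma approximate_stationarity:
  fixes E :: "real ^ 'n ^ 'm"
  defines "G \<equiv> R + outer x' y' + E"
  defines "e \<equiv> 2 * ((L - (norm y)\<^sup>2) * norm (x' - x) + norm R * norm (y' - y) + norm E * norm y') + norm E * norm y'"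
  shows "- e \<le> (G *v y') $ a" "0 < x' $ a \<Longrightarrow> \<bar>(G *v y') $ a\<bar> \<le> e"
    "- norm E \<le> (transpose G *v x') $ b" "0 < y' $ b \<Longrightarrow> \<bar>(transpose G *v x') $ b\<bar> \<le> norm E"
proof -
  have Gy: "transpose G *v x' = \<sigma> + transpose E *v x'"
  proof -
    have "transpose G = transpose R + transpose (outer x' y') + transpose E"
      by (simp add: G_def transpose_def vec_eq_iff)
    then show ?thesis
      by (simp add: matrix_vector_mult_add_rdistrib transpose_outer_mult_vec xx \<sigma>_def)
  qed
  have eb: "\<bar>(transpose E *v x') $ b\<bar> \<le> norm E"
    using component_le_norm_cart[of "transpose E *v x'" b] norm_transpose_mult_vec_le[of E x'] x' by simp
  show "- norm E \<le> (transpose G *v x') $ b"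
  proof -
    have "0 \<le> \<sigma> $ b" using \<sigma>_nonneg by (simp add: less_eq_vec_def)
    then show ?thesis using eb by (simp add: Gy)
  qed
  show "\<bar>(transpose G *v x') $ b\<bar> \<le> norm E" if "0 < y' $ b"
    using eb that complementary_vec[OF y' \<sigma>_nonneg, of b] \<sigma>_y' by (simp add: Gy inner_commute)
  define err where "err = (L - (norm y)\<^sup>2) *\<^sub>R (x - x') + R *v (y' - y) + E *v y'"
  define \<mu> where "\<mu> = L - (norm y)\<^sup>2 - lam + (norm y')\<^sup>2"
  have Gx: "G *v y' = \<nu> + \<mu> *\<^sub>R x' + err"
  proof -
    have "G *v y' = R *v y + R *v (y' - y) + (norm y')\<^sup>2 *\<^sub>R x' + E *v y'"
      by (simp add: G_def matrix_vector_mult_add_rdistrib outer_mult_vec matrix_vector_mult_diff_distrib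
          power2_norm_eq_inner)
    then show ?thesis unfolding Ry \<mu>_def err_def by (simp add: algebra_simps scaleR_add_left scaleR_diff_left)
  qed
  have norm_err: "norm err \<le> (L - (norm y)\<^sup>2) * norm (x' - x) + norm R * norm (y' - y) + norm E * norm y'"
  proof -
    have "norm err \<le> norm ((L - (norm y)\<^sup>2) *\<^sub>R (x - x')) + norm (R *v (y' - y)) + norm (E *v y')"
      unfolding err_def by (intro norm_triangle_le add_mono norm_triangle_ineq order_refl)
    also have "norm ((L - (norm y)\<^sup>2) *\<^sub>R (x - x')) = (L - (norm y)\<^sup>2) * norm (x' - x)"
      using L by (simp add: norm_minus_commute)
    finally show ?thesis
      using norm_matrix_mult_vec_le[of R "y' - y"] norm_matrix_mult_vec_le[of E y'] by linarith
  qed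
  \<comment> \<open>Pairing with \<open>x'\<close> isolates \<open>\<mu>\<close>:
    \<open>\<nu>\<close> is orthogonal to \<open>x'\<close>, and as \<open>\<sigma>\<close> is
    orthogonal to \<open>y'\<close>, only \<open>E\<close> remains in the pairing of
    \<open>x'\<close> with \<open>G *v y'\<close>. The error \<open>err\<close> enters the gradient
    directly and once more through \<open>\<mu>\<close>, whence the factor 2 in
    \<open>e\<close>.\<close>
  have "\<bar>\<mu>\<bar> \<le> norm err + norm E * norm y'"
  proof -
    have "x' \<bullet> (G *v y') = \<mu> + x' \<bullet> err"
      unfolding Gx by (simp add: inner_add_right x'_\<nu> xx)
    moreover have "x' \<bullet> (G *v y') = y' \<bullet> (transpose E *v x')"
    proof -
      have "x' \<bullet> (G *v y') = y' \<bullet> (transpose G *v x')" by (simp add: inner_transpose_mult_vec inner_commute)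
      then show ?thesis unfolding Gy using \<sigma>_y' by (simp add: inner_add_right inner_commute)
    qed
    moreover have "\<bar>x' \<bullet> err\<bar> \<le> norm err" using Cauchy_Schwarz_ineq2[of x' err] x' by simp
    moreover have "\<bar>y' \<bullet> (transpose E *v x')\<bar> \<le> norm E * norm y'"
    proof -
      have "\<bar>y' \<bullet> (transpose E *v x')\<bar> \<le> norm y' * norm (transpose E *v x')" by (rule Cauchy_Schwarz_ineq2)
      also have "\<dots> \<le> norm y' * norm E"
        using norm_transpose_mult_vec_le[of E x'] x' by (intro mult_left_mono) auto
      finally show ?thesis by (simp add: mult.commute)
    qed
    ultimately show ?thesis by linarith
  qed
  moreover have "\<bar>x' $ a\<bar> \<le> 1" using component_le_norm_cart[of x' a] x' by simp
  ultimately have "\<bar>\<mu> * x' $ a\<bar> \<le> (norm err + norm E * norm y') * 1"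
    unfolding abs_mult by (intro mult_mono) auto
  moreover have "\<bar>err $ a\<bar> \<le> norm err" by (rule component_le_norm_cart)
  ultimately have "\<bar>\<mu> * x' $ a + err $ a\<bar> \<le> 2 * norm err + norm E * norm y'"
    using abs_triangle_ineq[of "\<mu> * x' $ a" "err $ a"] by simp
  also have "\<dots> \<le> e" unfolding e_def by (intro add_right_mono mult_left_mono norm_err) simp
  finally have ea: "\<bar>\<mu> * x' $ a + err $ a\<bar> \<le> e" .
  show "- e \<le> (G *v y') $ a"
  proof -
    have "0 \<le> \<nu> $ a" using \<nu>_nonneg by (simp add: less_eq_vec_def)
    then show ?thesis using ea by (simp add: Gx)
  qed
  show "\<bar>(G *v y') $ a\<bar> \<le> e" if "0 < x' $ a"
    using ea that complementary_vec[OF x'(1) \<nu>_nonneg, of a] x'_\<nu> by (simp add: Gx add.assoc)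
qed

end

section \<open>One cycle\<close>

lemma cols_product_outer: "cols_product S X Y = (\<Sum>j\<in>S. outer (column j X) (column j Y))"
  by (simp add: cols_product_def outer_def column_def vec_eq_iff)

lemma norm_columns: "(norm (A :: real ^ 'p ^ 'm))\<^sup>2 = (\<Sum>j\<in>UNIV. (norm (column j A))\<^sup>2)"
proof -
  have "(norm A)\<^sup>2 = (\<Sum>a\<in>UNIV. \<Sum>j\<in>UNIV. A $ a $ j * A $ a $ j)"
    unfolding power2_norm_eq_inner by (simp add: inner_vec_def)
  also have "\<dots> = (\<Sum>j\<in>UNIV. \<Sum>a\<in>UNIV. A $ a $ j * A $ a $ j)" by (rule sum.swap)
  also have "\<dots> = (\<Sum>j\<in>UNIV. (norm (column j A))\<^sup>2)"
    unfolding power2_norm_eq_inner by (simp add: inner_vec_def column_def)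
  finally show ?thesis .
qed

lemma norm_column_le: "norm (column j A) \<le> norm (A :: real ^ 'p ^ 'm)"
proof (rule power2_le_imp_le)
  show "(norm (column j A))\<^sup>2 \<le> (norm A)\<^sup>2"
    unfolding norm_columns[of A] by (intro member_le_sum) auto
qed simp

lemma column_diff: "column j (A - B) = column j A - column j B"
  by (simp add: column_def vec_eq_iff)

text \<open>The rank-one terms of the product are entrywise nonnegative, so nothing cancels and each
  of them is dominated by the product. Its norm is that of the column of \<open>Y\<close>, because
  the column of \<open>X\<close> is a unit vector. A bound on the objective thereby bounds
  \<open>Y\<close>.\<close>

lemma norm_column_le_norm_product:
  fixes X :: "real ^ 'p ^ 'm" and Y :: "real ^ 'p ^ 'n"
  assumes X: "\<And>j. 0 \<le> column j X" "norm (column i X) = 1" and Y: "\<And>j. 0 \<le> column j Y"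
  shows "norm (column i Y) \<le> norm (X ** transpose Y)"
proof -
  have nn: "0 \<le> X $ a $ j" "0 \<le> Y $ b $ j" for a b j
    using X(1)[of j] Y[of j] by (auto simp: less_eq_vec_def column_def)
  have "norm (column i Y) = norm (outer (column i X) (column i Y))" using X(2) by (simp add: norm_outer)
  also have "\<dots> \<le> norm (X ** transpose Y)"
  proof (rule power2_le_imp_le)
    have "(outer (column i X) (column i Y) $ a $ b)\<^sup>2 \<le> ((X ** transpose Y) $ a $ b)\<^sup>2" for a b
    proof (rule power_mono)
      have "X $ a $ i * Y $ b $ i \<le> (\<Sum>j\<in>UNIV. X $ a $ j * Y $ b $ j)"
        using nn by (intro member_le_sum) auto
      then show "outer (column i X) (column i Y) $ a $ b \<le> (X ** transpose Y) $ a $ b"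
        by (simp add: outer_def column_def matrix_matrix_mult_def transpose_def)
      show "0 \<le> outer (column i X) (column i Y) $ a $ b" using nn by (simp add: outer_def column_def)
    qed
    then show "(norm (outer (column i X) (column i Y)))\<^sup>2 \<le> (norm (X ** transpose Y))\<^sup>2"
      unfolding power2_norm_eq_inner by (auto simp: inner_vec_def power2_eq_square intro!: sum_mono)
  qed simp
  finally show ?thesis .
qed

locale normalized_rri_cycle =
  fixes Lmin :: real and M :: "real ^ 'n ^ 'm" and \<pi> :: "nat \<Rightarrow> 'p::finite"
    and X X' :: "real ^ 'p ^ 'm" and Y Y' :: "real ^ 'p ^ 'n"
  assumes Lmin: "0 < Lmin" and cycle: "rri_cycle Lmin M \<pi> X Y X' Y'"
    and X: "\<And>j. 0 \<le> column j X" "\<And>j. norm (column j X) = 1" and Y: "\<And>j. 0 \<le> column j Y"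
begin

declare One_nat_def [simp del]

definition "f = 1 / 2 * (norm (X ** transpose Y - M))\<^sup>2"
definition "f' = 1 / 2 * (norm (X' ** transpose Y' - M))\<^sup>2"
definition "w i = outer (column (\<pi> i) X) (column (\<pi> i) Y)"
definition "w' i = outer (column (\<pi> i) X') (column (\<pi> i) Y')"
text \<open>The residual at the start of step \<open>i\<close>; the index
  \<open>Suc CARD('p)\<close> gives the residual after the whole cycle.\<close>

definition "W i = (\<Sum>l\<in>{1..<i}. w' l) + (\<Sum>l\<in>{i..CARD('p)}. w l) - M"
definition "R i = (\<Sum>l\<in>{1..<i}. w' l) + (\<Sum>l\<in>{i<..CARD('p)}. w l) - M"
definition "\<delta> = norm ((X', Y') - (X, Y))"

lemma bij: "bij_betw \<pi> {1..CARD('p)} UNIV"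
  using cycle by (simp add: rri_cycle_def)

lemma cols_product_image:
  assumes "A \<subseteq> {1..CARD('p)}"
  shows "cols_product (\<pi> ` A) U V = (\<Sum>l\<in>A. outer (column (\<pi> l) U) (column (\<pi> l) V))"
proof -
  have "inj_on \<pi> A" using bij assms by (auto simp: bij_betw_def intro: inj_on_subset)
  then show ?thesis by (simp add: cols_product_outer sum.reindex)
qed

lemma W_eq:
  assumes "1 \<le> i" "i \<le> Suc CARD('p)"
  shows "cols_product (\<pi> ` {1..<i}) X' Y' + cols_product (\<pi> ` {i..CARD('p)}) X Y - M = W i"
  using assms by (subst (1 2) cols_product_image) (auto simp: W_def w_def w'_def)

lemma R_eq:
  assumes "1 \<le> i" "i \<le> CARD('p)"
  shows "cols_product (\<pi> ` {1..<i}) X' Y' + cols_product (\<pi> ` {i<..CARD('p)}) X Y - M = R i"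
  using assms by (subst (1 2) cols_product_image) (auto simp: R_def w_def w'_def)

lemma W_first: "W 1 = X ** transpose Y - M"
  using W_eq[of 1] bij by (simp add: bij_betw_def cols_product_UNIV cols_product_outer[of "{}"])

lemma W_last: "W (Suc CARD('p)) = X' ** transpose Y' - M"
  using W_eq[of "Suc CARD('p)"] bij
  by (simp add: bij_betw_def cols_product_UNIV atLeastLessThanSuc_atLeastAtMost cols_product_outer[of "{}"])

lemma W_before: "1 \<le> i \<Longrightarrow> i \<le> CARD('p) \<Longrightarrow> W i = R i + w i"
proof -
  assume "1 \<le> i" "i \<le> CARD('p)"
  then have "{i..CARD('p)} = insert i {i<..CARD('p)}" by auto
  then show ?thesis by (simp add: W_def R_def)
qed

lemma W_after: "1 \<le> i \<Longrightarrow> W (Suc i) = R i + w' i"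
proof -
  assume "1 \<le> i"
  then have "{1..<Suc i} = insert i {1..<i}" "{Suc i..CARD('p)} = {i<..CARD('p)}" by auto
  then show ?thesis by (simp add: W_def R_def)
qed

lemma step:
  assumes i: "1 \<le> i" "i \<le> CARD('p)"
  shows "rri_step (R i) (column (\<pi> i) X) (column (\<pi> i) X') (column (\<pi> i) Y) (column (\<pi> i) Y') Lmin (rri_L Lmin Y (\<pi> i))"
proof
  have "i \<in> {1..CARD('p)}" using i by simp
  then have "is_arg_min
          (\<lambda>x. rri_L Lmin Y (\<pi> i) / 2 * (norm (x - column (\<pi> i) X))\<^sup>2
               + column (\<pi> i) Y \<bullet>
                   (transpose (cols_product (\<pi> ` {1..<i}) X' Y'
                               + cols_product (\<pi> ` {i..CARD('p)}) X Y - M) *v x))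
          (\<lambda>x. 0 \<le> x \<and> norm x = 1)
          (column (\<pi> i) X') \<and>
        is_arg_min
          (\<lambda>y. 1 / 2 * (norm y)\<^sup>2
               + y \<bullet>
                   (transpose (cols_product (\<pi> ` {1..<i}) X' Y'
                               + cols_product (\<pi> ` {i<..CARD('p)}) X Y - M) *v column (\<pi> i) X'))
          (\<lambda>y. 0 \<le> y)
          (column (\<pi> i) Y')"
    using cycle unfolding rri_cycle_def by blast
  moreover have "W i = R i + outer (column (\<pi> i) X) (column (\<pi> i) Y)"
    using W_before[OF i] by (simp add: w_def)
  ultimately show
    "is_arg_min (\<lambda>u. rri_L Lmin Y (\<pi> i) / 2 * (norm (u - column (\<pi> i) X))\<^sup>2 +
        column (\<pi> i) Y \<bullet> (transpose (R i + outer (column (\<pi> i) X) (column (\<pi> i) Y)) *v u))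
      (\<lambda>u. 0 \<le> u \<and> norm u = 1) (column (\<pi> i) X')"
    "is_arg_min (\<lambda>v. 1 / 2 * (norm v)\<^sup>2 + v \<bullet> (transpose (R i) *v column (\<pi> i) X')) (\<lambda>v. 0 \<le> v) (column (\<pi> i) Y')"
    using i by (simp_all add: W_eq R_eq)
qed (use Lmin X Y in \<open>auto simp: rri_L_def\<close>)

lemma index_of_column: "\<exists>i. 1 \<le> i \<and> i \<le> CARD('p) \<and> \<pi> i = j"
proof -
  have "j \<in> \<pi> ` {1..CARD('p)}" using bij by (simp add: bij_betw_def)
  then show ?thesis by auto
qed

lemma normalized': "0 \<le> column j X'" "norm (column j X') = 1" "0 \<le> column j Y'"
proof -
  obtain i where i: "1 \<le> i" "i \<le> CARD('p)" "\<pi> i = j" using index_of_column by blast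
  interpret rri_step "R i" "column (\<pi> i) X" "column (\<pi> i) X'" "column (\<pi> i) Y" "column (\<pi> i) Y'" Lmin "rri_L Lmin Y (\<pi> i)"
    by (rule step[OF i(1,2)])
  show "0 \<le> column j X'" "norm (column j X') = 1" "0 \<le> column j Y'" using x' y' i(3) by auto
qed

definition "dec i = 1 / 2 * (norm (W i))\<^sup>2 - 1 / 2 * (norm (W (Suc i)))\<^sup>2"

lemma dec:
  assumes i: "1 \<le> i" "i \<le> CARD('p)"
  shows "0 \<le> dec i"
    and "dec i \<le> Lmin / 4 \<Longrightarrow> Lmin / 8 * (norm (column (\<pi> i) (X' - X)))\<^sup>2 + 1 / 2 * (norm (column (\<pi> i) (Y' - Y)))\<^sup>2 \<le> dec i"
proof -
  interpret rri_step "R i" "column (\<pi> i) X" "column (\<pi> i) X'" "column (\<pi> i) Y" "column (\<pi> i) Y'" Lmin "rri_L Lmin Y (\<pi> i)"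
    by (rule step[OF i])
  have eq: "dec i = dec_x + dec_y"
    using decrease by (simp add: dec_def W_before[OF i] W_after[OF i(1)] w_def w'_def)
  show "0 \<le> dec i" unfolding eq using dec_x_nonneg dec_y_nonneg by simp
  show "Lmin / 8 * (norm (column (\<pi> i) (X' - X)))\<^sup>2 + 1 / 2 * (norm (column (\<pi> i) (Y' - Y)))\<^sup>2 \<le> dec i"
    if "dec i \<le> Lmin / 4"
    using sufficient_decrease that unfolding eq column_diff by simp
qed

lemma sum_dec: "(\<Sum>i\<in>{1..CARD('p)}. dec i) = f - f'"
proof -
  have "(\<Sum>i\<in>{1..<Suc CARD('p)}. - (1 / 2 * (norm (W (Suc i)))\<^sup>2) - - (1 / 2 * (norm (W i))\<^sup>2)) =
      - (1 / 2 * (norm (W (Suc CARD('p))))\<^sup>2) - - (1 / 2 * (norm (W 1))\<^sup>2)"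
    by (rule sum_Suc_diff') simp
  then show ?thesis
    unfolding W_first W_last f_def f'_def dec_def by (simp add: atLeastLessThanSuc_atLeastAtMost)
qed

lemma descent: "f' \<le> f"
proof -
  have "0 \<le> (\<Sum>i\<in>{1..CARD('p)}. dec i)" by (intro sum_nonneg dec) auto
  then show ?thesis by (simp add: sum_dec)
qed

lemma norm_W: "1 \<le> i \<Longrightarrow> i \<le> Suc CARD('p) \<Longrightarrow> 1 / 2 * (norm (W i))\<^sup>2 \<le> f"
proof (induction i rule: nat_induct_at_least)
  case base
  then show ?case by (simp only: W_first f_def order_refl)
next
  case (Suc i)
  then have "1 / 2 * (norm (W i))\<^sup>2 \<le> f" "0 \<le> dec i" using dec(1)[of i] by auto
  then show ?case unfolding dec_def by linarith
qed

lemma sum_index: "(\<Sum>i\<in>{1..CARD('p)}. F (\<pi> i)) = (\<Sum>j\<in>UNIV. F j)"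
  using sum.reindex_bij_betw[OF bij] .

lemma delta_sq: "\<delta>\<^sup>2 = (norm (X' - X))\<^sup>2 + (norm (Y' - Y))\<^sup>2"
  by (simp add: \<delta>_def norm_Pair)

text \<open>The decreases of the single steps are nonnegative, so a small total makes each of them
  small enough for \<open>dec(2)\<close>.\<close>

lemma sufficient_descent:
  assumes "f - f' \<le> Lmin / 4"
  shows "min (Lmin / 8) (1 / 2) * \<delta>\<^sup>2 \<le> f - f'"
proof -
  let ?a = "min (Lmin / 8) (1 / 2)"
  have le: "?a * (norm (column (\<pi> i) (X' - X)))\<^sup>2 + ?a * (norm (column (\<pi> i) (Y' - Y)))\<^sup>2 \<le> dec i"
    if i: "i \<in> {1..CARD('p)}" for i
  proof -
    have "dec i \<le> (\<Sum>i\<in>{1..CARD('p)}. dec i)" using i dec(1) by (intro member_le_sum) auto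
    then have "dec i \<le> Lmin / 4" using assms by (simp add: sum_dec)
    then have "Lmin / 8 * (norm (column (\<pi> i) (X' - X)))\<^sup>2 + 1 / 2 * (norm (column (\<pi> i) (Y' - Y)))\<^sup>2 \<le> dec i"
      using dec(2) i by auto
    moreover have "?a * (norm (column (\<pi> i) (X' - X)))\<^sup>2 \<le> Lmin / 8 * (norm (column (\<pi> i) (X' - X)))\<^sup>2"
      "?a * (norm (column (\<pi> i) (Y' - Y)))\<^sup>2 \<le> 1 / 2 * (norm (column (\<pi> i) (Y' - Y)))\<^sup>2"
      by (intro mult_right_mono; simp)+
    ultimately show ?thesis by linarith
  qed
  have "?a * \<delta>\<^sup>2 = (\<Sum>i\<in>{1..CARD('p)}. ?a * (norm (column (\<pi> i) (X' - X)))\<^sup>2 + ?a * (norm (column (\<pi> i) (Y' - Y)))\<^sup>2)"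
    unfolding delta_sq norm_columns
    using sum_index[of "\<lambda>j. ?a * (norm (column j (X' - X)))\<^sup>2"] sum_index[of "\<lambda>j. ?a * (norm (column j (Y' - Y)))\<^sup>2"]
    by (simp add: sum.distrib sum_distrib_left distrib_left)
  also have "\<dots> \<le> f - f'" unfolding sum_dec[symmetric] using le by (rule sum_mono)
  finally show ?thesis .
qed

lemma delta_columns: "norm (column j X' - column j X) \<le> \<delta>" "norm (column j Y' - column j Y) \<le> \<delta>"
proof -
  have "(norm (X' - X))\<^sup>2 \<le> \<delta>\<^sup>2" "(norm (Y' - Y))\<^sup>2 \<le> \<delta>\<^sup>2" unfolding delta_sq by auto
  then have "norm (X' - X) \<le> \<delta>" "norm (Y' - Y) \<le> \<delta>" by (auto intro: power2_le_imp_le simp: \<delta>_def)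
  then show "norm (column j X' - column j X) \<le> \<delta>" "norm (column j Y' - column j Y) \<le> \<delta>"
    using norm_column_le[of j "X' - X"] norm_column_le[of j "Y' - Y"] by (auto simp: column_diff)
qed

text \<open>In multiples of \<open>\<delta>\<close>, the later steps change the residual by at most
  \<open>CARD('p) * (1 + B)\<close>. The first two summands bound the error of the gradient in
  \<open>X\<close>, the last one the error in \<open>Y\<close>; the sum serves both.\<close>

definition "step_bound B = 2 * ((Lmin + B\<^sup>2) + B + real CARD('p) * (1 + B) * B) +
  real CARD('p) * (1 + B) * B + real CARD('p) * (1 + B)"

lemma approximate_stationarity:
  assumes B: "\<And>j. norm (column j Y) \<le> B" "\<And>j. norm (column j Y') \<le> B" "\<forall>i\<in>{1..CARD('p)}. norm (R i) \<le> B"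
  defines "G \<equiv> X' ** transpose Y' - M"
  shows "- (step_bound B * \<delta>) \<le> (G *v column j Y') $ a"
    "0 < X' $ a $ j \<Longrightarrow> \<bar>(G *v column j Y') $ a\<bar> \<le> step_bound B * \<delta>"
    "- (step_bound B * \<delta>) \<le> (transpose G *v column j X') $ b"
    "0 < Y' $ b $ j \<Longrightarrow> \<bar>(transpose G *v column j X') $ b\<bar> \<le> step_bound B * \<delta>"
proof -
  obtain i where i: "1 \<le> i" "i \<le> CARD('p)" "\<pi> i = j" using index_of_column by blast
  interpret rri_step "R i" "column (\<pi> i) X" "column (\<pi> i) X'" "column (\<pi> i) Y" "column (\<pi> i) Y'" Lmin "rri_L Lmin Y (\<pi> i)"
    by (rule step[OF i(1,2)])
  have B0: "0 \<le> B" using B(1)[of j] norm_ge_zero order_trans by blast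
  have \<delta>0: "0 \<le> \<delta>" by (simp add: \<delta>_def)
  \<comment> \<open>The change of the residual by the later steps of the cycle, which
    \<open>G\<close> contains and \<open>R i\<close> does not.\<close>
  define E where "E = (\<Sum>l\<in>{Suc i..CARD('p)}. w' l - w l)"
  define c where "c = real CARD('p) * (1 + B)"
  have c0: "0 \<le> c" using B0 by (simp add: c_def)
  have E: "norm E \<le> c * \<delta>"
  proof -
    have "norm (w' l - w l) \<le> (1 + B) * \<delta>" for l
    proof -
      have "norm (w' l - w l) \<le> norm (column (\<pi> l) X') * norm (column (\<pi> l) Y' - column (\<pi> l) Y) +
          norm (column (\<pi> l) X' - column (\<pi> l) X) * norm (column (\<pi> l) Y)"
        unfolding w_def w'_def outer_diff by (rule norm_triangle_le) (simp add: norm_outer)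
      also have "\<dots> \<le> 1 * \<delta> + \<delta> * B"
        using normalized'(2)[of "\<pi> l"] delta_columns[of "\<pi> l"] B(1)[of "\<pi> l"] \<delta>0
        by (intro add_mono mult_mono) auto
      finally show ?thesis by (simp add: algebra_simps)
    qed
    then have "norm E \<le> (\<Sum>l\<in>{Suc i..CARD('p)}. (1 + B) * \<delta>)"
      unfolding E_def by (intro sum_norm_le)
    also have "\<dots> = real (CARD('p) - i) * ((1 + B) * \<delta>)" by simp
    also have "\<dots> \<le> real CARD('p) * ((1 + B) * \<delta>)" using B0 \<delta>0 by (intro mult_right_mono) auto
    finally show ?thesis by (simp add: c_def mult.assoc)
  qed
  have G: "G = R i + outer (column (\<pi> i) X') (column (\<pi> i) Y') + E"
  proof -
    have eq: "{1..<Suc CARD('p)} = {1..<Suc i} \<union> {Suc i..CARD('p)}" using i by auto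
    have "(\<Sum>l\<in>{1..<Suc CARD('p)}. w' l) = (\<Sum>l\<in>{1..<Suc i}. w' l) + (\<Sum>l\<in>{Suc i..CARD('p)}. w' l)"
      unfolding eq by (rule sum.union_disjoint) auto
    then have "W (Suc CARD('p)) = W (Suc i) + E"
      unfolding W_def E_def sum_subtractf by simp
    then show ?thesis unfolding G_def W_last W_after[OF i(1)] w'_def .
  qed
  define e where "e = 2 * ((rri_L Lmin Y (\<pi> i) - (norm (column (\<pi> i) Y))\<^sup>2) * norm (column (\<pi> i) X' - column (\<pi> i) X) +
     norm (R i) * norm (column (\<pi> i) Y' - column (\<pi> i) Y) + norm E * norm (column (\<pi> i) Y')) +
    norm E * norm (column (\<pi> i) Y')"
  have EB: "norm E * norm (column (\<pi> i) Y') \<le> c * \<delta> * B"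
    using E B(2) c0 \<delta>0 by (intro mult_mono) auto
  have RB: "norm (R i) * norm (column (\<pi> i) Y' - column (\<pi> i) Y) \<le> B * \<delta>"
    using B(3) i delta_columns B0 by (intro mult_mono) auto
  have LB: "(rri_L Lmin Y (\<pi> i) - (norm (column (\<pi> i) Y))\<^sup>2) * norm (column (\<pi> i) X' - column (\<pi> i) X) \<le> (Lmin + B\<^sup>2) * \<delta>"
  proof (intro mult_mono)
    have "(norm (column (\<pi> i) Y))\<^sup>2 \<le> B\<^sup>2" using B(1) by (intro power_mono) auto
    then show "rri_L Lmin Y (\<pi> i) - (norm (column (\<pi> i) Y))\<^sup>2 \<le> Lmin + B\<^sup>2"
      using Lmin by (auto simp: rri_L_def max_def)
  qed (use delta_columns Lmin in auto)
  have "e \<le> 2 * ((Lmin + B\<^sup>2) * \<delta> + B * \<delta> + c * \<delta> * B) + c * \<delta> * B"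
    unfolding e_def by (intro add_mono mult_left_mono LB RB EB) auto
  also have "\<dots> \<le> \<dots> + c * \<delta>" using c0 \<delta>0 by simp
  also have "\<dots> = step_bound B * \<delta>" by (simp add: step_bound_def c_def algebra_simps)
  finally have eb: "e \<le> step_bound B * \<delta>" .
  have "0 \<le> (Lmin + B\<^sup>2) * \<delta>" "0 \<le> B * \<delta>" "0 \<le> c * \<delta> * B" using Lmin B0 c0 \<delta>0 by auto
  then have "0 \<le> 2 * ((Lmin + B\<^sup>2) * \<delta> + B * \<delta> + c * \<delta> * B) + c * \<delta> * B"
    by (intro add_nonneg_nonneg mult_nonneg_nonneg[of 2]) auto
  then have "c * \<delta> \<le> 2 * ((Lmin + B\<^sup>2) * \<delta> + B * \<delta> + c * \<delta> * B) + c * \<delta> * B + c * \<delta>" by simp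
  also have "\<dots> = step_bound B * \<delta>" by (simp add: step_bound_def c_def algebra_simps)
  finally have Eb: "norm E \<le> step_bound B * \<delta>" using E by linarith
  note s = approximate_stationarity[where E = E, folded G, folded e_def, unfolded i(3)]
  show "- (step_bound B * \<delta>) \<le> (G *v column j Y') $ a" using s(1)[of a] eb by linarith
  show "\<bar>(G *v column j Y') $ a\<bar> \<le> step_bound B * \<delta>" if "0 < X' $ a $ j"
    using s(2)[of a] eb that by (simp add: column_def)
  show "- (step_bound B * \<delta>) \<le> (transpose G *v column j X') $ b" using s(3)[of b] Eb by linarith
  show "\<bar>(transpose G *v column j X') $ b\<bar> \<le> step_bound B * \<delta>" if "0 < Y' $ b $ j"
    using s(4)[of b] Eb that by (simp add: column_def)
qed

lemma norm_column_Y_le: "norm (column j Y) \<le> sqrt (2 * f) + norm M"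
proof -
  have "norm (column j Y) \<le> norm (X ** transpose Y)" using X Y by (intro norm_column_le_norm_product)
  also have "\<dots> \<le> norm (X ** transpose Y - M) + norm M" using norm_triangle_ineq[of "X ** transpose Y - M" M] by simp
  also have "norm (X ** transpose Y - M) = sqrt (2 * f)" by (simp add: f_def)
  finally show ?thesis .
qed

lemma norm_R_le:
  assumes "1 \<le> i" "i \<le> CARD('p)"
  shows "norm (R i) \<le> 2 * sqrt (2 * f) + norm M"
proof -
  have "norm (R i) \<le> norm (W i) + norm (w i)"
    using norm_triangle_ineq4[of "W i" "w i"] by (simp add: W_before[OF assms])
  moreover have "norm (w i) \<le> sqrt (2 * f) + norm M"
    using norm_column_Y_le[of "\<pi> i"] X(2) by (simp add: w_def norm_outer)
  moreover have "norm (W i) \<le> sqrt (2 * f)"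
    using norm_W[of i] assms by (intro real_le_rsqrt) simp
  ultimately show ?thesis by linarith
qed

end

section \<open>The objective and its critical points\<close>

definition nmf_half_sq :: "real ^ 'n ^ 'm \<Rightarrow> (real ^ 'p ^ 'm) \<times> (real ^ 'p ^ 'n) \<Rightarrow> real" where
  "nmf_half_sq M Z = 1 / 2 * (norm (fst Z ** transpose (snd Z) - M))\<^sup>2"

definition nmf_gradient ::
    "real ^ 'n ^ 'm \<Rightarrow> (real ^ 'p ^ 'm) \<times> (real ^ 'p ^ 'n) \<Rightarrow> (real ^ 'p ^ 'm) \<times> (real ^ 'p ^ 'n)" where
  "nmf_gradient M Z = (let G = fst Z ** transpose (snd Z) - M in (G ** snd Z, transpose G ** fst Z))"

lemma nmf_half_sq_altdef:
  "nmf_half_sq M Z = (\<Sum>a\<in>UNIV. \<Sum>b\<in>UNIV. 1 / 2 * ((\<Sum>j\<in>UNIV. fst Z $ a $ j * snd Z $ b $ j) - M $ a $ b)\<^sup>2)"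
  unfolding nmf_half_sq_def power2_norm_eq_inner
  by (simp add: inner_vec_def matrix_matrix_mult_def transpose_def sum_distrib_left power2_eq_square)

lemma bounded_linear_fst_entry: "bounded_linear (\<lambda>Z :: (real ^ 'p ^ 'm) \<times> (real ^ 'p ^ 'n). fst Z $ a $ j)"
  by (intro bounded_linear_compose[OF bounded_linear_vec_nth] bounded_linear_fst)

lemma bounded_linear_snd_entry: "bounded_linear (\<lambda>Z :: (real ^ 'p ^ 'm) \<times> (real ^ 'p ^ 'n). snd Z $ b $ j)"
  by (intro bounded_linear_compose[OF bounded_linear_vec_nth] bounded_linear_snd)

lemma real_polynomial_nmf_half_sq:
  "real_polynomial_function (nmf_half_sq M :: (real ^ 'p ^ 'm) \<times> (real ^ 'p ^ 'n) \<Rightarrow> real)"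
  unfolding nmf_half_sq_altdef[abs_def]
  by (intro real_polynomial_function_sum real_polynomial_function.intros(2,4) real_polynomial_function_power
      real_polynomial_function_diff real_polynomial_function.intros(1) bounded_linear_fst_entry bounded_linear_snd_entry) auto

lemma has_derivative_nmf_half_sq:
  "(nmf_half_sq M has_derivative (\<lambda>h. nmf_gradient M Z \<bullet> h)) (at (Z :: (real ^ 'p ^ 'm) \<times> (real ^ 'p ^ 'n)))"
proof -
  define E where "E = (\<lambda>Z :: (real ^ 'p ^ 'm) \<times> (real ^ 'p ^ 'n). \<lambda>a b. (\<Sum>j\<in>UNIV. fst Z $ a $ j * snd Z $ b $ j) - M $ a $ b)"
  have dE: "((\<lambda>Z. E Z a b) has_derivative
      (\<lambda>h. \<Sum>j\<in>UNIV. fst Z $ a $ j * snd h $ b $ j + fst h $ a $ j * snd Z $ b $ j)) (at Z)" for a b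
  proof -
    have "((\<lambda>Z. fst Z $ a $ j * snd Z $ b $ j) has_derivative
      (\<lambda>h. fst Z $ a $ j * snd h $ b $ j + fst h $ a $ j * snd Z $ b $ j)) (at Z)" for j
      by (rule has_derivative_mult[OF bounded_linear_imp_has_derivative[OF bounded_linear_fst_entry]
            bounded_linear_imp_has_derivative[OF bounded_linear_snd_entry]])
    then have "((\<lambda>Z. \<Sum>j\<in>UNIV. fst Z $ a $ j * snd Z $ b $ j) has_derivative
      (\<lambda>h. \<Sum>j\<in>UNIV. fst Z $ a $ j * snd h $ b $ j + fst h $ a $ j * snd Z $ b $ j)) (at Z)"
      by (intro has_derivative_sum)
    from has_derivative_diff[OF this has_derivative_const[of "M $ a $ b"]] show ?thesis
      unfolding E_def by simp
  qed
  have half_sq: "((\<lambda>z. 1 / 2 * (u z)\<^sup>2) has_derivative (\<lambda>h. u Z * u' h)) (at Z)"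
    if "(u has_derivative u') (at Z)" for u u' :: "(real ^ 'p ^ 'm) \<times> (real ^ 'p ^ 'n) \<Rightarrow> real"
    using has_derivative_mult_right[OF has_derivative_power[OF that, of 2], of "1 / 2"]
    by (simp add: mult.commute)
  have "(nmf_half_sq M has_derivative (\<lambda>h. \<Sum>a\<in>UNIV. \<Sum>b\<in>UNIV. E Z a b *
      (\<Sum>j\<in>UNIV. fst Z $ a $ j * snd h $ b $ j + fst h $ a $ j * snd Z $ b $ j))) (at Z)"
  proof -
    have alt: "nmf_half_sq M = (\<lambda>Z. \<Sum>a\<in>UNIV. \<Sum>b\<in>UNIV. 1 / 2 * (E Z a b)\<^sup>2)"
      by (rule ext) (simp only: nmf_half_sq_altdef E_def)
    show ?thesis unfolding alt by (intro has_derivative_sum half_sq dE)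
  qed
  moreover have "(\<Sum>a\<in>UNIV. \<Sum>b\<in>UNIV. E Z a b *
      (\<Sum>j\<in>UNIV. fst Z $ a $ j * snd h $ b $ j + fst h $ a $ j * snd Z $ b $ j)) = nmf_gradient M Z \<bullet> h" for h
  proof -
    define G where "G = fst Z ** transpose (snd Z) - M"
    have G: "G $ a $ b = E Z a b" for a b
      by (simp add: G_def E_def matrix_matrix_mult_def transpose_def)
    have "nmf_gradient M Z \<bullet> h = (\<Sum>a\<in>UNIV. \<Sum>j\<in>UNIV. (\<Sum>b\<in>UNIV. E Z a b * snd Z $ b $ j) * fst h $ a $ j) +
        (\<Sum>b\<in>UNIV. \<Sum>j\<in>UNIV. (\<Sum>a\<in>UNIV. E Z a b * fst Z $ a $ j) * snd h $ b $ j)"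
      unfolding nmf_gradient_def Let_def inner_prod_def fst_conv snd_conv G_def[symmetric]
      by (simp add: inner_vec_def matrix_matrix_mult_def transpose_def G)
    also have "(\<Sum>a\<in>UNIV. \<Sum>j\<in>UNIV. (\<Sum>b\<in>UNIV. E Z a b * snd Z $ b $ j) * fst h $ a $ j) =
        (\<Sum>a\<in>UNIV. \<Sum>b\<in>UNIV. \<Sum>j\<in>UNIV. E Z a b * (fst h $ a $ j * snd Z $ b $ j))"
      unfolding sum_distrib_right by (intro sum.cong refl, subst sum.swap) (simp add: mult_ac)
    also have "(\<Sum>b\<in>UNIV. \<Sum>j\<in>UNIV. (\<Sum>a\<in>UNIV. E Z a b * fst Z $ a $ j) * snd h $ b $ j) =
        (\<Sum>b\<in>UNIV. \<Sum>a\<in>UNIV. \<Sum>j\<in>UNIV. E Z a b * (fst Z $ a $ j * snd h $ b $ j))"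
      unfolding sum_distrib_right by (intro sum.cong refl, subst sum.swap) (simp add: mult_ac)
    also have "\<dots> = (\<Sum>a\<in>UNIV. \<Sum>b\<in>UNIV. \<Sum>j\<in>UNIV. E Z a b * (fst Z $ a $ j * snd h $ b $ j))"
      by (rule sum.swap)
    finally show ?thesis
      by (simp add: sum_distrib_left distrib_left sum.distrib)
  qed
  ultimately show ?thesis by simp
qed

lemma nmf_gradient_partials:
  "(nmf_half_sq M has_derivative (\<lambda>h. \<Sum>b\<in>Basis. (nmf_gradient M Z \<bullet> b) * (h \<bullet> b))) (at Z)"
  unfolding euclidean_inner[symmetric] by (rule has_derivative_nmf_half_sq)

text \<open>Uniqueness of the derivative identifies the entries of the gradient with the polynomial
  partial derivatives from \<open>polynomial_partials\<close>.\<close>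

lemma real_polynomial_nmf_gradient:
  fixes b :: "(real ^ 'p ^ 'm) \<times> (real ^ 'p ^ 'n)"
  assumes b: "b \<in> Basis"
  shows "real_polynomial_function (\<lambda>Z. nmf_gradient M Z \<bullet> b)"
proof -
  obtain g where g: "\<forall>b\<in>Basis. real_polynomial_function (g b)"
    "\<forall>Z. ((nmf_half_sq M :: (real ^ 'p ^ 'm) \<times> (real ^ 'p ^ 'n) \<Rightarrow> real) has_derivative (\<lambda>h. \<Sum>b\<in>Basis. g b Z * (h \<bullet> b))) (at Z)"
    using polynomial_partials[OF real_polynomial_nmf_half_sq[of M]] by blast
  have "g b Z = nmf_gradient M Z \<bullet> b" for Z
  proof -
    have eq: "(\<lambda>h. \<Sum>b\<in>Basis. g b Z * (h \<bullet> b)) = (\<lambda>h. nmf_gradient M Z \<bullet> h)"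
      by (rule has_derivative_unique[OF g(2)[rule_format] has_derivative_nmf_half_sq])
    have "(\<Sum>c\<in>Basis. g c Z * (b \<bullet> c)) = (\<Sum>c\<in>Basis. if c = b then g c Z else 0)"
      using b by (intro sum.cong) (auto simp: inner_Basis)
    then show ?thesis using fun_cong[OF eq, of b] b by simp
  qed
  then have "g b = (\<lambda>Z. nmf_gradient M Z \<bullet> b)" by (intro ext)
  then show ?thesis using g(1) b by auto
qed

lemma nmf_Basis_cases:
  fixes b :: "(real ^ 'p ^ 'm) \<times> (real ^ 'p ^ 'n)"
  assumes "b \<in> Basis"
  obtains (fst) a j where "\<And>Z. Z \<bullet> b = fst Z $ a $ j" | (snd) c j where "\<And>Z. Z \<bullet> b = snd Z $ c $ j"
proof -
  from assms consider u where "u \<in> Basis" "b = (u, 0)" | u where "u \<in> Basis" "b = (0, u)"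
    by (auto simp: Basis_prod_def)
  then show ?thesis
  proof cases
    case 1
    then obtain a j where "u = axis a (axis j 1)" by (auto simp: Basis_vec_def)
    then have "Z \<bullet> b = fst Z $ a $ j" for Z using 1 by (simp add: inner_prod_def inner_axis)
    then show ?thesis by (rule fst)
  next
    case 2
    then obtain a j where "u = axis a (axis j 1)" by (auto simp: Basis_vec_def)
    then have "Z \<bullet> b = snd Z $ a $ j" for Z using 2 by (simp add: inner_prod_def inner_axis)
    then show ?thesis by (rule snd)
  qed
qed

lemma nmf_gradient_entries:
  "fst (nmf_gradient M (X, Y)) $ a $ j = ((X ** transpose Y - M) *v column j Y) $ a"
  "snd (nmf_gradient M (X, Y)) $ b $ j = (transpose (X ** transpose Y - M) *v column j X) $ b"
  by (simp_all add: nmf_gradient_def Let_def matrix_vector_mult_def column_def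
      matrix_matrix_mult_def[of "X ** transpose Y - M"] matrix_matrix_mult_def[of "transpose (X ** transpose Y - M)"])

text \<open>By complementarity the gradient has a nonnegative product with every direction into the
  orthant, and outside the orthant the objective is infinite. So 0 is already a Frechet subgradient
  at \<open>Z\<close>, and constant sequences witness the limiting one.\<close>

lemma nmf_critical_pointI:
  fixes Z :: "(real ^ 'p ^ 'm) \<times> (real ^ 'p ^ 'n)"
  assumes Z: "0 \<le> fst Z" "0 \<le> snd Z"
    and grad: "\<And>b. b \<in> Basis \<Longrightarrow> 0 \<le> nmf_gradient M Z \<bullet> b"
      "\<And>b. b \<in> Basis \<Longrightarrow> 0 < Z \<bullet> b \<Longrightarrow> nmf_gradient M Z \<bullet> b = 0"
  shows "nmf_critical_point M Z"
proof -
  let ?F = "nmf_objective M :: (real ^ 'p ^ 'm) \<times> (real ^ 'p ^ 'n) \<Rightarrow> ereal"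
    and ?f = "nmf_half_sq M :: (real ^ 'p ^ 'm) \<times> (real ^ 'p ^ 'n) \<Rightarrow> real"
  have F_in: "?F W = ereal (?f W)" if "0 \<le> fst W" "0 \<le> snd W" for W
    using that by (cases W) (simp add: nmf_objective_def nmf_half_sq_def set_indicator_def)
  have F_out: "?F W = \<infinity>" if "\<not> (0 \<le> fst W \<and> 0 \<le> snd W)" for W
    using that by (cases W) (auto simp: nmf_objective_def set_indicator_def)
  have coord: "0 \<le> W \<bullet> b" if "0 \<le> fst W" "0 \<le> snd W" "b \<in> Basis" for W b :: "(real ^ 'p ^ 'm) \<times> (real ^ 'p ^ 'n)"
    using that(3) by (cases rule: nmf_Basis_cases) (use that(1,2) in \<open>auto simp: less_eq_vec_def\<close>)
  have "0 \<in> frechet_subdifferential ?F Z"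
    unfolding frechet_subdifferential_def mem_Collect_eq
  proof (intro conjI)
    show "\<bar>?F Z\<bar> \<noteq> \<infinity>" using F_in Z by simp
    show "0 \<le> Liminf (at Z) (\<lambda>z. (?F z - ?F Z - ereal (0 \<bullet> (z - Z))) / ereal (norm (z - Z)))"
      unfolding le_Liminf_iff
    proof (intro allI impI)
      fix y :: ereal assume "y < 0"
      then obtain e' where e': "y < ereal e'" "ereal e' < 0" using ereal_dense2 by blast
      define e where "e = - e'"
      have e: "0 < e" "y < ereal (- e)" using e' by (auto simp: e_def)
      obtain d where d: "0 < d" "\<And>z. norm (z - Z) < d \<Longrightarrow>
          norm (?f z - ?f Z - nmf_gradient M Z \<bullet> (z - Z)) \<le> e * norm (z - Z)"
        using has_derivative_nmf_half_sq[of M Z] e(1) unfolding has_derivative_at_alt by blast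
      have "y < (?F z - ?F Z - ereal (0 \<bullet> (z - Z))) / ereal (norm (z - Z))" if z: "z \<noteq> Z" "dist z Z < d" for z
      proof (cases "0 \<le> fst z \<and> 0 \<le> snd z")
        case True
        have "0 \<le> nmf_gradient M Z \<bullet> (z - Z)"
        proof (subst euclidean_inner, intro sum_nonneg)
          fix b :: "(real ^ 'p ^ 'm) \<times> (real ^ 'p ^ 'n)" assume b: "b \<in> Basis"
          show "0 \<le> (nmf_gradient M Z \<bullet> b) * ((z - Z) \<bullet> b)"
          proof (cases "0 < Z \<bullet> b")
            case False
            then have "Z \<bullet> b = 0" using coord[OF Z b] by simp
            then show ?thesis using grad(1)[OF b] coord[of z b] True b by (simp add: inner_diff_left)
          qed (simp add: grad(2)[OF b])
        qed
        then have "- e * norm (z - Z) \<le> ?f z - ?f Z"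
          using d(2)[of z] z by (simp add: dist_norm abs_le_iff)
        then have "- e \<le> (?f z - ?f Z) / norm (z - Z)" using z by (simp add: pos_le_divide_eq)
        then have "ereal (- e) \<le> (?F z - ?F Z - ereal (0 \<bullet> (z - Z))) / ereal (norm (z - Z))"
          using True Z z by (simp add: F_in)
        then show ?thesis using e(2) by (rule less_le_trans[rotated])
      next
        case False
        then have "(?F z - ?F Z - ereal (0 \<bullet> (z - Z))) / ereal (norm (z - Z)) = \<infinity>"
          using z Z by (simp add: F_in F_out)
        then show ?thesis using \<open>y < 0\<close> by (cases y) auto
      qed
      then show "\<forall>\<^sub>F z in at Z. y < (?F z - ?F Z - ereal (0 \<bullet> (z - Z))) / ereal (norm (z - Z))"
        unfolding eventually_at using d(1) by blast
    qed
  qed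
  then show ?thesis
    unfolding nmf_critical_point_def limiting_subdifferential_def mem_Collect_eq
    using F_in Z by (intro conjI exI[of _ "\<lambda>_. Z"] exI[of _ "\<lambda>_. 0"]) auto
qed

section \<open>Convergence of the iteration\<close>

theorem theorem3p3:
  fixes M :: "real ^ 'n ^ 'm"
    and Lmin :: real
    and \<pi> :: "nat \<Rightarrow> nat \<Rightarrow> 'p::finite"
    and X :: "nat \<Rightarrow> real ^ 'p ^ 'm"
    and Y :: "nat \<Rightarrow> real ^ 'p ^ 'n"
  assumes "0 \<le> M"
    and "0 < Lmin"
    and "\<And>k. rri_cycle Lmin M (\<pi> k) (X k) (Y k) (X (Suc k)) (Y (Suc k))"
  shows "bounded (Y ` {1..}) \<and>
         (\<exists>Z. (\<lambda>k. (X k, Y k)) \<longlonglongrightarrow> Z \<and> nmf_critical_point M Z)"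
proof -
  have feasible: "0 \<le> column j (X (Suc k))" "norm (column j (X (Suc k))) = 1" "0 \<le> column j (Y (Suc k))" for j k
  proof -
    have "bij_betw (\<pi> k) {1..CARD('p)} UNIV" using assms(3)[of k] by (simp add: rri_cycle_def)
    then have "j \<in> \<pi> k ` {1..CARD('p)}" by (simp add: bij_betw_def)
    then obtain i where "i \<in> {1..CARD('p)}" "\<pi> k i = j" by blast
    then show "0 \<le> column j (X (Suc k))" "norm (column j (X (Suc k))) = 1" "0 \<le> column j (Y (Suc k))"
      using assms(3)[of k] by (auto simp: rri_cycle_def is_arg_min_def)
  qed
  \<comment> \<open>The starting point is arbitrary; the iterates are feasible and normalized only
    from index 1 on, where \<open>z\<close> starts.\<close>
  interpret c: normalized_rri_cycle Lmin M "\<pi> (Suc k)" "X (Suc k)" "X (Suc (Suc k))" "Y (Suc k)" "Y (Suc (Suc k))" for k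
    by unfold_locales (use assms feasible in auto)
  define z where "z = (\<lambda>k. (X (Suc k), Y (Suc k)))"
  define F where "F = (nmf_half_sq M :: (real ^ 'p ^ 'm) \<times> (real ^ 'p ^ 'n) \<Rightarrow> real)"
  have f: "c.f k = F (z k)" and f': "c.f' k = F (z (Suc k))" for k
    by (simp_all add: c.f_def c.f'_def F_def z_def nmf_half_sq_def)
  have \<delta>: "c.\<delta> k = norm (z (Suc k) - z k)" for k by (simp add: c.\<delta>_def z_def)
  have F_nonneg: "0 \<le> F x" for x by (simp add: F_def nmf_half_sq_def)
  have "F (z (Suc k)) \<le> F (z k)" for k using c.descent[of k] by (simp add: f f')
  then have decseq: "decseq (\<lambda>k. F (z k))" by (simp add: decseq_Suc_iff)
  then obtain l where l: "(\<lambda>k. F (z k)) \<longlonglongrightarrow> l"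
    using decseq_convergent[of "\<lambda>k. F (z k)" 0] F_nonneg by blast
  have "(\<lambda>k. F (z k) - F (z (Suc k))) \<longlonglongrightarrow> l - l"
    by (intro tendsto_diff l LIMSEQ_Suc)
  then have "\<forall>\<^sub>F k in sequentially. F (z k) - F (z (Suc k)) < Lmin / 4"
    using assms(2) by (intro order_tendstoD) auto
  then obtain K where K: "\<And>k. K \<le> k \<Longrightarrow> F (z k) - F (z (Suc k)) < Lmin / 4"
    by (auto simp: eventually_sequentially)
  \<comment> \<open>The factor 2 comes from \<open>norm_R_le\<close>; the resulting bound also
    covers \<open>norm_column_Y_le\<close>.\<close>
  define B where "B = 2 * sqrt (2 * F (z 0)) + norm M"
  have sqrt_le: "sqrt (2 * F (z k)) \<le> sqrt (2 * F (z 0))" for k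
    using decseqD[OF decseq, of 0 k] by simp
  have Y_B: "norm (column j (Y (Suc k))) \<le> B" for j k
  proof -
    have "0 \<le> sqrt (2 * F (z 0))" using F_nonneg[of "z 0"] by simp
    then show ?thesis using c.norm_column_Y_le[of j k] sqrt_le[of k] unfolding f B_def by linarith
  qed
  have R_B: "\<forall>i\<in>{1..CARD('p)}. norm (c.R k i) \<le> B" for k
  proof
    fix i assume "i \<in> {1..CARD('p)}"
    then have "1 \<le> i" "i \<le> CARD('p)" by auto
    from c.norm_R_le[OF this, of k] show "norm (c.R k i) \<le> B"
      using sqrt_le[of k] unfolding f B_def by linarith
  qed
  define C where "C = c.step_bound B"
  have stat: "- (C * norm (z (Suc k) - z k)) \<le> nmf_gradient M (z (Suc k)) \<bullet> b"
    "0 < z (Suc k) \<bullet> b \<Longrightarrow> \<bar>nmf_gradient M (z (Suc k)) \<bullet> b\<bar> \<le> C * norm (z (Suc k) - z k)"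
    if b: "b \<in> Basis" for b k
  proof -
    note s = c.approximate_stationarity[of k B, OF Y_B Y_B R_B, unfolded \<delta>, folded C_def]
    from b show "- (C * norm (z (Suc k) - z k)) \<le> nmf_gradient M (z (Suc k)) \<bullet> b"
      by (cases rule: nmf_Basis_cases) (simp_all only: z_def nmf_gradient_entries s[unfolded z_def])
    from b show "\<bar>nmf_gradient M (z (Suc k)) \<bullet> b\<bar> \<le> C * norm (z (Suc k) - z k)" if "0 < z (Suc k) \<bullet> b"
    proof (cases rule: nmf_Basis_cases)
      case (fst a j)
      then have "0 < X (Suc (Suc k)) $ a $ j" using that by (simp add: z_def)
      from s(2)[OF this] show ?thesis by (simp add: fst z_def nmf_gradient_entries)
    next
      case (snd c j)
      then have "0 < Y (Suc (Suc k)) $ c $ j" using that by (simp add: z_def)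
      from s(4)[OF this] show ?thesis by (simp add: snd z_def nmf_gradient_entries)
    qed
  qed
  have nonneg: "0 \<le> X (Suc k)" "0 \<le> Y (Suc k)" for k
  proof -
    have "0 \<le> X (Suc k) $ a $ j" "0 \<le> Y (Suc k) $ b $ j" for a b j
      using feasible(1,3)[of j k] by (auto simp: less_eq_vec_def column_def)
    then show "0 \<le> X (Suc k)" "0 \<le> Y (Suc k)" by (auto simp: less_eq_vec_def)
  qed
  have z_nonneg: "0 \<le> z k \<bullet> b" if "b \<in> Basis" for b k
    using that by (cases rule: nmf_Basis_cases) (use nonneg in \<open>auto simp: z_def less_eq_vec_def\<close>)
  have "norm (z k) \<le> sqrt (real CARD('p)) + sqrt (real CARD('p) * B\<^sup>2)" for k
  proof -
    have "(norm (X (Suc k)))\<^sup>2 \<le> real CARD('p)" by (simp add: norm_columns feasible)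
    then have "norm (X (Suc k)) \<le> sqrt (real CARD('p))" by (rule real_le_rsqrt)
    moreover have "(norm (Y (Suc k)))\<^sup>2 \<le> (\<Sum>j\<in>(UNIV :: 'p set). B\<^sup>2)"
      unfolding norm_columns using Y_B by (intro sum_mono power_mono) auto
    then have "norm (Y (Suc k)) \<le> sqrt (real CARD('p) * B\<^sup>2)" by (intro real_le_rsqrt) simp
    ultimately show ?thesis using norm_Pair_le[of "X (Suc k)" "Y (Suc k)"] by (simp add: z_def)
  qed
  note z_bound = this
  \<comment> \<open>From \<open>K\<close> on each cycle decreases the objective by less than
    \<open>Lmin / 4\<close>, as \<open>sufficient_descent\<close> presupposes.\<close>
  have "convergent (\<lambda>k. z (k + K))"
  proof (rule descent_in_orthant_convergent[of F "\<lambda>b Z. nmf_gradient M Z \<bullet> b" _ _ "min (Lmin / 8) (1 / 2)" C])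
    show "real_polynomial_function F" unfolding F_def by (rule real_polynomial_nmf_half_sq)
    show "(F has_derivative (\<lambda>h. \<Sum>b\<in>Basis. (nmf_gradient M Z \<bullet> b) * (h \<bullet> b))) (at Z)" for Z
      unfolding F_def by (rule nmf_gradient_partials)
    show "min (Lmin / 8) (1 / 2) * (norm (z (Suc k + K) - z (k + K)))\<^sup>2 \<le> F (z (k + K)) - F (z (Suc k + K))" for k
      using c.sufficient_descent[of "k + K"] K[of "k + K"] by (simp add: f f' \<delta>)
    show "\<bar>nmf_gradient M (z (Suc k + K)) \<bullet> b\<bar> \<le> C * norm (z (Suc k + K) - z (k + K))"
      if "b \<in> Basis" "0 < z (Suc k + K) \<bullet> b" for k b
      using stat(2)[of b "k + K"] that by simp
  qed (use real_polynomial_nmf_gradient F_nonneg z_nonneg z_bound assms(2) in auto)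
  then obtain Z where "(\<lambda>k. z (k + K)) \<longlonglongrightarrow> Z" by (auto simp: convergent_def)
  then have z_lim: "z \<longlonglongrightarrow> Z" by (rule LIMSEQ_offset)
  have diff0: "(\<lambda>k. C * norm (z (Suc k) - z k)) \<longlonglongrightarrow> 0"
    using tendsto_mult[OF tendsto_const tendsto_norm[OF tendsto_diff[OF LIMSEQ_Suc[OF z_lim] z_lim]], of C] by simp
  have crit: "nmf_critical_point M Z"
  proof (rule nmf_critical_pointI)
    have lim_entry: "(\<lambda>k. z k \<bullet> b) \<longlonglongrightarrow> Z \<bullet> b" for b by (intro tendsto_intros z_lim)
    have fst_lim: "(\<lambda>k. X (Suc k) $ a $ j) \<longlonglongrightarrow> fst Z $ a $ j" for a j
      using tendsto_vec_nth[OF tendsto_vec_nth[OF tendsto_fst[OF z_lim]], of a j] by (simp add: z_def)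
    have snd_lim: "(\<lambda>k. Y (Suc k) $ a $ j) \<longlonglongrightarrow> snd Z $ a $ j" for a j
      using tendsto_vec_nth[OF tendsto_vec_nth[OF tendsto_snd[OF z_lim]], of a j] by (simp add: z_def)
    show "0 \<le> fst Z" using nonneg(1)
      by (auto simp: less_eq_vec_def intro!: LIMSEQ_le_const[OF fst_lim])
    show "0 \<le> snd Z" using nonneg(2)
      by (auto simp: less_eq_vec_def intro!: LIMSEQ_le_const[OF snd_lim])
    fix b :: "(real ^ 'p ^ 'm) \<times> (real ^ 'p ^ 'n)" assume b: "b \<in> Basis"
    have "continuous_on UNIV (\<lambda>Z. nmf_gradient M Z \<bullet> b)"
      using real_polynomial_nmf_gradient[OF b]
      by (intro continuous_on_polymonial_function) (simp add: real_polynomial_function_eq)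
    then have "isCont (\<lambda>Z. nmf_gradient M Z \<bullet> b) Z"
      by (metis continuous_on_eq_continuous_at open_UNIV UNIV_I)
    from isCont_tendsto_compose[OF this LIMSEQ_Suc[OF z_lim]]
    have g_lim: "(\<lambda>k. nmf_gradient M (z (Suc k)) \<bullet> b) \<longlonglongrightarrow> nmf_gradient M Z \<bullet> b" .
    \<comment> \<open>The lower bound holds for all partial derivatives and passes to the limit. A
      coordinate that is positive in the limit is eventually positive, so there the two-sided bound
      forces the limit to be zero.\<close>
    have "- 0 \<le> nmf_gradient M Z \<bullet> b"
      by (rule LIMSEQ_le[OF tendsto_minus[OF diff0] g_lim]) (use stat(1)[OF b] in auto)
    then show "0 \<le> nmf_gradient M Z \<bullet> b" by simp
    assume "0 < Z \<bullet> b"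
    then have "\<forall>\<^sub>F k in sequentially. 0 < z (Suc k) \<bullet> b"
      by (intro order_tendstoD(1)[OF LIMSEQ_Suc[OF lim_entry]])
    then have "\<forall>\<^sub>F k in sequentially. norm (nmf_gradient M (z (Suc k)) \<bullet> b) \<le> C * norm (z (Suc k) - z k)"
      by eventually_elim (use stat(2)[OF b] in auto)
    then have "(\<lambda>k. nmf_gradient M (z (Suc k)) \<bullet> b) \<longlonglongrightarrow> 0"
      using diff0 by (rule Lim_null_comparison)
    then show "nmf_gradient M Z \<bullet> b = 0" using g_lim LIMSEQ_unique by blast
  qed
  have lim: "(\<lambda>k. (X k, Y k)) \<longlonglongrightarrow> Z"
    by (rule LIMSEQ_imp_Suc) (use z_lim in \<open>simp add: z_def\<close>)
  have "bounded (range Y)"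
    using tendsto_snd[OF lim] by (intro convergent_imp_bounded) auto
  then have "bounded (Y ` {1..})" by (rule bounded_subset) auto
  then show ?thesis using lim crit by blast
qed

end
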